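(* Let $R$ be an $F$-finite noetherian ring of characteristic $p>0$ (not necessarily local) and let $I$ be an ideal of $R$. (1) If one of the minimal primes over $I$ has height at least one, then $1\le r^I(I)\le c^I(I)$. (2) If one of the minimal primes over $I$ has height at least two, then $1<r^I(I)\le c^I(I)$.
   Context: $F$-finite means the Frobenius endomorphism is finite. $I^{[p^n]}$ is the ideal generated by $p^n$-th powers of elements of $I$. The tight closure $\mathfrak a^*$ of an ideal $\mathfrak a$ is the ideal of all $x\in R$ for which there is $c\in R$, not in any minimal prime of $R$, with $cx^{p^n}\in\mathfrak a^{[p^n]}$ for all large $n$. $c^I(I)=\lim_{n\to\infty}\frac1{p^n}\sup\{t\in\mathbb N: I^t\nsubseteq I^{[p^n]}\}$ is the $F$-threshold of $I$ with respect to itself, and $r^I(I)=\lim_{n\to\infty}\frac1{p^n}\max\{t\in\mathbb N: I^t\nsubseteq(I^{[p^n]})^*\}$ is the $F$-threshold up to tight closure; both limits exist. *)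

theory Defs
  imports Complex_Main "HOL-Library.Extended_Nat" "HOL-Algebra.Algebra"
begin

text \<open>The additive order of \<open>\<one>\<close>; \<open>group.ord\<close> is \<open>0\<close> for elements of infinite order.\<close>

definition ring_char :: "('a, 'b) ring_scheme \<Rightarrow> nat" where
  "ring_char R = group.ord (add_monoid R) \<one>\<^bsub>R\<^esub>"

text \<open>The target is a finitely generated module over the source, which acts through \<open>h\<close>.\<close>

definition finite_ring_hom ::
    "('a, 'm) ring_scheme \<Rightarrow> ('b, 'n) ring_scheme \<Rightarrow> ('a \<Rightarrow> 'b) \<Rightarrow> bool" where
  "finite_ring_hom R S h \<longleftrightarrow> h \<in> ring_hom R S \<and>
     (\<exists>B. finite B \<and> B \<subseteq> carrier S \<and>
       (\<forall>y\<in>carrier S. \<exists>a\<in>B \<rightarrow> carrier R. y = (\<Oplus>\<^bsub>S\<^esub>b\<in>B. h (a b) \<otimes>\<^bsub>S\<^esub> b)))"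

definition F_finite :: "('a, 'b) ring_scheme \<Rightarrow> nat \<Rightarrow> bool" where
  "F_finite R p \<longleftrightarrow> finite_ring_hom R R (\<lambda>x. x [^]\<^bsub>R\<^esub> p)"

definition minimal_primes_over :: "('a, 'b) ring_scheme \<Rightarrow> 'a set \<Rightarrow> 'a set set" where
  "minimal_primes_over R I =
     {P. primeideal P R \<and> I \<subseteq> P \<and> (\<forall>Q. primeideal Q R \<and> I \<subseteq> Q \<and> Q \<subseteq> P \<longrightarrow> Q = P)}"

definition minimal_primes :: "('a, 'b) ring_scheme \<Rightarrow> 'a set set" where
  "minimal_primes R = minimal_primes_over R {\<zero>\<^bsub>R\<^esub>}"

definition prime_height :: "('a, 'b) ring_scheme \<Rightarrow> 'a set \<Rightarrow> enat" where
  "prime_height R P = Sup {enat n | n. \<exists>Q :: nat \<Rightarrow> 'a set.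
     (\<forall>i\<le>n. primeideal (Q i) R) \<and> (\<forall>i<n. Q i \<subset> Q (Suc i)) \<and> Q n = P}"

definition bracket_power :: "('a, 'b) ring_scheme \<Rightarrow> 'a set \<Rightarrow> nat \<Rightarrow> 'a set" where
  "bracket_power R I q = Idl\<^bsub>R\<^esub> ((\<lambda>x. x [^]\<^bsub>R\<^esub> q) ` I)"

definition tight_closure :: "('a, 'b) ring_scheme \<Rightarrow> nat \<Rightarrow> 'a set \<Rightarrow> 'a set" where
  "tight_closure R p A = {x \<in> carrier R. \<exists>c\<in>carrier R. (\<forall>P\<in>minimal_primes R. c \<notin> P) \<and>
     (\<forall>\<^sub>F n in sequentially. c \<otimes>\<^bsub>R\<^esub> x [^]\<^bsub>R\<^esub> (p ^ n) \<in> bracket_power R A (p ^ n))}"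

text \<open>Powers of an ideal are taken in the multiplicative monoid of ideals, so that
  \<open>I\<^sup>0\<close> is the unit ideal.\<close>

abbreviation ideal_power :: "('a, 'b) ring_scheme \<Rightarrow> 'a set \<Rightarrow> nat \<Rightarrow> 'a set" where
  "ideal_power R I t \<equiv> I [^]\<^bsub>ideals_set R\<^esub> t"

text \<open>The thresholds \<open>c\<^sup>I(I)\<close> and \<open>r\<^sup>I(I)\<close>. For an ideal \<open>I\<close> of a noetherian ring of
  characteristic \<open>p\<close> the sets of exponents are bounded; the second one is nonempty as soon as
  the tight closure of \<open>bracket_power R I (p ^ n)\<close> is a proper ideal.\<close>

definition F_threshold_self :: "('a, 'b) ring_scheme \<Rightarrow> nat \<Rightarrow> 'a set \<Rightarrow> real" where
  "F_threshold_self R p I = lim (\<lambda>n.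
     1 / real (p ^ n) * real (Sup {t. \<not> ideal_power R I t \<subseteq> bracket_power R I (p ^ n)}))"

definition F_threshold_tight_self :: "('a, 'b) ring_scheme \<Rightarrow> nat \<Rightarrow> 'a set \<Rightarrow> real" where
  "F_threshold_tight_self R p I = lim (\<lambda>n.
     1 / real (p ^ n) *
       real (Max {t. \<not> ideal_power R I t \<subseteq> tight_closure R p (bracket_power R I (p ^ n))}))"

end

theory Submission
  imports Defs "HOL-Library.Function_Algebras" "HOL-Library.Fun_Lexorder"
    "HOL-Computational_Algebra.Primes"
begin

text \<open>
  The limits exist because \<open>I\<^sup>s \<subseteq> I\<^bsup>[q]\<^esup>\<close> implies \<open>I\<^bsup>(s + m) q'\<^esup> \<subseteq> I\<^bsup>[q q']\<^esup>\<close> for an ideal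
  with \<open>m\<close> generators, and likewise for tight closures. Hence, if the threshold up to tight closure is
  smaller than \<open>\<rho>\<close>, there is a single \<open>c\<close> outside all minimal primes such that for every large power
  \<open>q\<close> of \<open>p\<close> some \<open>s \<le> \<rho> q\<close> satisfies \<open>c I\<^sup>s \<subseteq> I\<^bsup>[q]\<^esup>\<close>. Fix a minimal prime \<open>P\<close> over \<open>I\<close> and a
  minimal prime \<open>p0\<close> of \<open>R\<close> below it, and work modulo \<open>p0\<close> and locally at \<open>P\<close>.

  If \<open>P \<noteq> p0\<close> and \<open>\<rho> < 1\<close>, then \<open>c I\<^sup>s \<subseteq> I\<^sup>q\<close>, so that Artin--Rees cancels \<open>c\<close> and gives
  \<open>I\<^sup>s \<subseteq> I\<^bsup>s + 1\<^esup>\<close>, against Krull's intersection theorem.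

  If the height is at least two and \<open>\<rho> = 1 + \<epsilon>\<close>, compare lengths modulo \<open>I\<^bsup>q + n\<^esup>\<close> with \<open>n = \<delta> q\<close> and
  \<open>\<epsilon>\<close> small against \<open>\<delta>\<close>: up to a bounded shift, \<open>I\<^bsup>q (1 + \<epsilon>)\<^esup> / I\<^bsup>q + n\<^esup>\<close> embeds by multiplication
  with \<open>c\<close> into the image of \<open>I\<^bsup>[q]\<^esup>\<close>, whose length is at most \<open>m\<close> times that of \<open>R / I\<^sup>n\<close>. The length
  of \<open>I\<^sup>i / I\<^bsup>i + 1\<^esup>\<close> lies between two positive multiples of \<open>i\<^bsup>D - 1\<^esup>\<close>, where \<open>D\<close> is read off the
  down-closed set of standard monomials, so the inequality forces \<open>\<delta>\<^bsup>D - 1\<^esup>\<close> to be bounded below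
  independently of \<open>\<delta>\<close>. Since \<open>D \<le> 1\<close> would make these lengths bounded and the height at most one,
  this is absurd.
\<close>

text \<open>Neither localizations nor quotient rings are formed: lengths at P modulo p0 are read off
  chains of saturated ideals of R itself. Hilbert polynomials are avoided too. It is enough that the
  upper and the lower bound for the number of standard monomials have the same exponent, and this
  holds for every nonempty down-closed set of multi-indices, whose growth is governed by the largest
  coordinate cone inside it.

  The order of the quantifiers shapes the second part. The multiplier c, and with it the shift h of
  levels that c causes, depends on how close \<rho> is to 1. So a constant B is fixed first,
  depending only on the growth of the standard monomials, the number of generators and one length;
  then M > B and \<rho> = 1 + 1/(4 M); only then c and h; finally n large against h, with q = M n.
  The comparison of lengths becomes M^(D - 1) <= B. For D = 1 this says nothing, and the prime
  strictly between p0 and P is what excludes that case.\<close>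

no_notation Sum_Type.Plus (infixr \<open><+>\<close> 65)

section \<open>Multi-indices\<close>

definition multi_indices :: "nat \<Rightarrow> (nat \<Rightarrow> nat) set" where
  "multi_indices m = {\<alpha>. \<forall>i\<ge>m. \<alpha> i = 0}"

definition multi_indices_deg :: "nat \<Rightarrow> nat \<Rightarrow> (nat \<Rightarrow> nat) set" where
  "multi_indices_deg m n = {\<alpha> \<in> multi_indices m. sum \<alpha> {..<m} = n}"

lemma multi_indices_deg_le:
  assumes "\<alpha> \<in> multi_indices_deg m n"
  shows "\<alpha> i \<le> n"
proof (cases "i < m")
  case True
  then have "\<alpha> i \<le> sum \<alpha> {..<m}"
    by (intro member_le_sum) auto
  with assms show ?thesis
    by (simp add: multi_indices_deg_def)
next
  case False
  with assms show ?thesis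
    by (simp add: multi_indices_deg_def multi_indices_def)
qed

lemma finite_multi_indices_deg: "finite (multi_indices_deg m n)"
proof -
  have "multi_indices_deg m n \<subseteq> {f. \<forall>i. (i \<in> {..<m} \<longrightarrow> f i \<in> {..n}) \<and> (i \<notin> {..<m} \<longrightarrow> f i = 0)}"
    using multi_indices_deg_le by (auto simp: multi_indices_deg_def multi_indices_def)
  moreover have "finite {f. \<forall>i. (i \<in> {..<m} \<longrightarrow> f i \<in> {..n}) \<and> (i \<notin> {..<m} \<longrightarrow> f i = (0::nat))}"
    by (rule finite_set_of_finite_funs) auto
  ultimately show ?thesis
    by (rule finite_subset)
qed

lemma multi_indices_deg_0 [simp]: "multi_indices_deg m 0 = {0}"
proof
  show "multi_indices_deg m 0 \<subseteq> {0}"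
    using multi_indices_deg_le[of _ m 0] by (auto simp: zero_fun_def)
  show "{0} \<subseteq> multi_indices_deg m 0"
    by (auto simp: multi_indices_deg_def multi_indices_def)
qed

lemma multi_indices_add:
  "\<alpha> \<in> multi_indices m \<Longrightarrow> \<beta> \<in> multi_indices m \<Longrightarrow> \<alpha> + \<beta> \<in> multi_indices m"
  by (auto simp: multi_indices_def)

lemma multi_indices_diff: "\<alpha> \<in> multi_indices m \<Longrightarrow> \<alpha> - \<beta> \<in> multi_indices m"
  by (auto simp: multi_indices_def)

lemma multi_indices_deg_add:
  "\<alpha> \<in> multi_indices_deg m a \<Longrightarrow> \<beta> \<in> multi_indices_deg m b \<Longrightarrow> \<alpha> + \<beta> \<in> multi_indices_deg m (a + b)"
  by (auto simp: multi_indices_deg_def multi_indices_add sum.distrib)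

lemma multi_indices_add_diff: "(\<beta> :: nat \<Rightarrow> nat) \<le> \<alpha> \<Longrightarrow> \<beta> + (\<alpha> - \<beta>) = \<alpha>"
  by (auto simp: le_fun_def)

lemma multi_indices_deg_diff:
  assumes "\<alpha> \<in> multi_indices_deg m a" "\<beta> \<in> multi_indices_deg m b" "\<beta> \<le> \<alpha>"
  shows "\<alpha> - \<beta> \<in> multi_indices_deg m (a - b)"
proof -
  have "sum (\<lambda>i. \<alpha> i - \<beta> i) {..<m} = sum \<alpha> {..<m} - sum \<beta> {..<m}"
    using assms(3) by (intro sum_subtractf_nat) (auto simp: le_fun_def)
  with assms show ?thesis
    by (simp add: multi_indices_deg_def multi_indices_diff)
qed

lemma exists_multi_index_le:
  assumes "\<alpha> \<in> multi_indices_deg m a" "b \<le> a"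
  shows "\<exists>\<beta>\<in>multi_indices_deg m b. \<beta> \<le> \<alpha>"
  using assms
proof (induction "a - b" arbitrary: a \<alpha>)
  case 0
  then show ?case by auto
next
  case (Suc k)
  then have "sum \<alpha> {..<m} \<noteq> 0"
    by (auto simp: multi_indices_deg_def)
  then obtain i where i: "i < m" "\<alpha> i > 0"
    by (metis lessThan_iff neq0_conv sum.neutral)
  let ?\<alpha> = "\<alpha>(i := \<alpha> i - 1)"
  have "sum \<alpha> {..<m} = Suc (sum ?\<alpha> {..<m})"
    using i by (simp add: sum.remove[of "{..<m}" i])
  then have "?\<alpha> \<in> multi_indices_deg m (a - 1)"
    using Suc.prems by (auto simp: multi_indices_deg_def multi_indices_def)
  moreover have "k = a - 1 - b" "b \<le> a - 1"
    using Suc by auto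
  ultimately obtain \<beta> where "\<beta> \<in> multi_indices_deg m b" "\<beta> \<le> ?\<alpha>"
    using Suc.hyps(1) by blast
  moreover have "?\<alpha> \<le> \<alpha>"
    by (auto simp: le_fun_def)
  ultimately show ?case
    by (meson order_trans)
qed

text \<open>Compatibility with addition makes the lexicographic order \<open>less_fun\<close> a
  monomial order: multiplying a form by a monomial preserves its leading monomial.\<close>

lemma less_fun_add:
  "less_fun \<alpha> \<beta> \<Longrightarrow> less_fun (\<alpha> + \<gamma>) (\<beta> + \<gamma> :: nat \<Rightarrow> nat)"
  by (auto simp: less_fun_def)

lemma multi_indices_trichotomy:
  assumes "\<alpha> \<in> multi_indices m" "\<beta> \<in> multi_indices m"
  shows "less_fun \<alpha> \<beta> \<or> \<alpha> = \<beta> \<or> less_fun \<beta> \<alpha>"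
proof (rule less_fun_trichotomy)
  have "{k. \<alpha> k \<noteq> \<beta> k} \<subseteq> {..<m}"
  proof
    fix k assume "k \<in> {k. \<alpha> k \<noteq> \<beta> k}"
    then show "k \<in> {..<m}"
      using assms by (cases "k < m") (auto simp: multi_indices_def)
  qed
  then show "finite {k. \<alpha> k \<noteq> \<beta> k}"
    by (rule finite_subset) simp
qed

lemma multi_indices_max:
  assumes "finite T" "T \<noteq> {}" "T \<subseteq> multi_indices m"
  shows "\<exists>\<alpha>\<in>T. \<forall>\<beta>\<in>T. \<beta> = \<alpha> \<or> less_fun \<beta> \<alpha>"
  using assms
proof (induction T rule: finite_ne_induct)
  case (insert x F)
  then obtain \<alpha> where "\<alpha> \<in> F" "\<forall>\<beta>\<in>F. \<beta> = \<alpha> \<or> less_fun \<beta> \<alpha>"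
    by auto
  then show ?case
    using multi_indices_trichotomy[of x m \<alpha>] insert.prems less_fun_trans by (metis insert_iff subsetD)
qed auto

text \<open>Some subsequence is monotone; if it is nonincreasing, it is constant from the point
  where it attains its minimum, and that tail serves.\<close>

lemma nat_seq_nondecreasing_subseq:
  fixes f :: "nat \<Rightarrow> nat"
  shows "\<exists>r :: nat \<Rightarrow> nat. strict_mono r \<and> (\<forall>i j. i \<le> j \<longrightarrow> f (r i) \<le> f (r j))"
proof -
  obtain r :: "nat \<Rightarrow> nat" where r: "strict_mono r" "monoseq (\<lambda>n. f (r n))"
    using seq_monosub by blast
  show ?thesis
  proof (cases "\<forall>i j. i \<le> j \<longrightarrow> f (r i) \<le> f (r j)")
    case False
    then have dec: "f (r j) \<le> f (r i)" if "i \<le> j" for i j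
      using r(2) that unfolding monoseq_def by blast
    obtain N where N: "\<And>n. f (r N) \<le> f (r n)"
      using ex_has_least_nat[of "\<lambda>_. True" _ "\<lambda>n. f (r n)"] by blast
    have "f (r (i + N)) = f (r N)" for i
      using N[of "i + N"] dec[of N "i + N"] by simp
    moreover have "strict_mono (\<lambda>i. r (i + N))"
      using r(1) by (auto simp: strict_mono_def)
    ultimately have "strict_mono (\<lambda>i. r (i + N)) \<and> (\<forall>i j. i \<le> j \<longrightarrow> f (r (i + N)) \<le> f (r (j + N)))"
      by simp
    then show ?thesis
      by (rule exI[where x = "\<lambda>i. r (i + N)"])
  qed (use r(1) in blast)
qed

text \<open>Dickson's lemma in the form of an infinite chain, obtained by thinning out the sequence
  one coordinate at a time.\<close>

lemma dickson:
  assumes "\<And>k. f k \<in> multi_indices m"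
  shows "\<exists>r :: nat \<Rightarrow> nat. strict_mono r \<and> (\<forall>i j. i \<le> j \<longrightarrow> f (r i) \<le> f (r j))"
proof -
  have "\<exists>r :: nat \<Rightarrow> nat. strict_mono r \<and> (\<forall>l<n. \<forall>i j. i \<le> j \<longrightarrow> f (r i) l \<le> f (r j) l)" for n
  proof (induction n)
    case 0
    show ?case
      by (intro exI[where x = "id :: nat \<Rightarrow> nat"] conjI strict_mono_id) simp
  next
    case (Suc n)
    then obtain r :: "nat \<Rightarrow> nat" where r: "strict_mono r" "\<forall>l<n. \<forall>i j. i \<le> j \<longrightarrow> f (r i) l \<le> f (r j) l"
      by blast
    obtain r' :: "nat \<Rightarrow> nat" where r': "strict_mono r'" "\<forall>i j. i \<le> j \<longrightarrow> f (r (r' i)) n \<le> f (r (r' j)) n"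
      using nat_seq_nondecreasing_subseq[of "\<lambda>k. f (r k) n"] by blast
    have "r' i \<le> r' j" if "i \<le> j" for i j
      using that r'(1) by (simp add: strict_mono_less_eq)
    then have "\<forall>l<Suc n. \<forall>i j. i \<le> j \<longrightarrow> f ((r \<circ> r') i) l \<le> f ((r \<circ> r') j) l"
      using r(2) r'(2) less_Suc_eq by auto
    moreover have "strict_mono (r \<circ> r')"
      using r(1) r'(1) by (rule strict_mono_o)
    ultimately show ?case
      by (intro exI[where x = "r \<circ> r'"] conjI)
  qed
  then obtain r :: "nat \<Rightarrow> nat" where r: "strict_mono r" "\<forall>l<m. \<forall>i j. i \<le> j \<longrightarrow> f (r i) l \<le> f (r j) l"
    by blast
  have "f (r i) l \<le> f (r j) l" if "i \<le> j" for i j l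
    using r(2) that assms by (cases "l < m") (auto simp: multi_indices_def)
  with r(1) show ?thesis
    by (auto simp: le_fun_def)
qed

section \<open>Growth of down-closed sets of multi-indices\<close>

lemma card_multi_indices_bounded_off:
  assumes S: "S \<subseteq> {..<m}" "card S \<le> D" and b: "1 \<le> b"
  shows "card {\<alpha> \<in> multi_indices_deg m n. \<forall>i\<in>{..<m} - S. \<alpha> i < b} \<le> b ^ m * (n + 1) ^ (D - 1)"
    (is "card ?A \<le> _")
\<comment> \<open>For empty \<open>S\<close> there is no coordinate that the degree could determine.
  Here \<open>D\<close> may be 0, where \<open>D - 1\<close> is 0 by truncation.\<close>
proof (cases "S = {}")
  case True
  have "inj_on (\<lambda>\<alpha>. restrict \<alpha> {..<m}) ?A"
  proof (rule inj_onI)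
    fix \<alpha> \<beta> assume *: "\<alpha> \<in> ?A" "\<beta> \<in> ?A" "restrict \<alpha> {..<m} = restrict \<beta> {..<m}"
    have "\<alpha> i = \<beta> i" for i
      using * by (cases "i < m") (auto simp: multi_indices_deg_def multi_indices_def dest: fun_cong[of _ _ i])
    then show "\<alpha> = \<beta>" by auto
  qed
  moreover have "(\<lambda>\<alpha>. restrict \<alpha> {..<m}) ` ?A \<subseteq> {..<m} \<rightarrow>\<^sub>E {..<b}"
    using True by (intro image_subsetI restrict_PiE_iff[THEN iffD2]) auto
  ultimately have "card ?A \<le> card ({..<m} \<rightarrow>\<^sub>E {..<b})"
    by (intro card_inj_on_le) (auto intro: finite_PiE)
  also have "\<dots> = b ^ m"
    by (simp add: card_PiE)
  also have "\<dots> \<le> b ^ m * (n + 1) ^ (D - 1)"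
    by simp
  finally show ?thesis .
next
  case False
  then obtain s where s: "s \<in> S" "s < m"
    using S by auto
  \<comment> \<open>The coordinate at \<open>s\<close> is recovered from the fixed degree, so only
    \<open>card S - 1\<close> coordinates range up to \<open>n\<close>.\<close>
  let ?X = "{..<m} - {s}"
  let ?B = "\<lambda>i. if i \<in> S then {..n} else {..<b}"
  have finS: "finite S"
    using S finite_subset by blast
  have "inj_on (\<lambda>\<alpha>. restrict \<alpha> ?X) ?A"
  proof (rule inj_onI)
    fix \<alpha> \<beta> assume *: "\<alpha> \<in> ?A" "\<beta> \<in> ?A" "restrict \<alpha> ?X = restrict \<beta> ?X"
    have eq: "\<alpha> i = \<beta> i" if "i \<in> ?X" for i
      using *(3) that by (auto dest: fun_cong[of _ _ i])
    have "sum \<alpha> {..<m} = sum \<beta> {..<m}"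
      using *(1,2) by (auto simp: multi_indices_deg_def)
    moreover have "sum \<alpha> ?X = sum \<beta> ?X"
      using eq by (intro sum.cong) auto
    ultimately have "\<alpha> s = \<beta> s"
      using s by (simp add: sum.remove[of "{..<m}" s])
    moreover have "\<alpha> i = \<beta> i" if "i \<ge> m" for i
      using *(1,2) that by (auto simp: multi_indices_deg_def multi_indices_def)
    ultimately have "\<alpha> i = \<beta> i" for i
      using eq[of i] by (metis DiffI insertE lessThan_iff not_le empty_iff)
    then show "\<alpha> = \<beta>" by auto
  qed
  moreover have "(\<lambda>\<alpha>. restrict \<alpha> ?X) ` ?A \<subseteq> PiE ?X ?B"
    using multi_indices_deg_le by (intro image_subsetI restrict_PiE_iff[THEN iffD2]) auto
  ultimately have "card ?A \<le> card (PiE ?X ?B)"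
    by (intro card_inj_on_le finite_PiE) auto
  also have "\<dots> = (\<Prod>i\<in>?X. card (?B i))"
    by (simp add: card_PiE)
  also have "\<dots> = (\<Prod>i\<in>?X. if i \<in> S then n + 1 else b)"
    by (intro prod.cong) auto
  also have "\<dots> = (n + 1) ^ card (?X \<inter> S) * b ^ card (?X \<inter> - S)"
    by (simp add: prod.If_cases Collect_neg_eq)
  also have "\<dots> \<le> (n + 1) ^ (D - 1) * b ^ m"
  proof (rule mult_mono)
    have "?X \<inter> S = S - {s}"
      using S by auto
    then have "card (?X \<inter> S) = card S - 1"
      using s finS by simp
    with S(2) show "(n + 1) ^ card (?X \<inter> S) \<le> (n + 1) ^ (D - 1)"
      by (intro power_increasing) auto
    have "card (?X \<inter> - S) \<le> card {..<m}"
      by (intro card_mono) auto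
    with b show "b ^ card (?X \<inter> - S) \<le> b ^ m"
      by (intro power_increasing) auto
  qed auto
  finally show ?thesis
    by (simp add: mult.commute)
qed

text \<open>Every \<open>T\<close> with \<open>D + 1\<close> elements has a witness outside
  \<open>\<Sigma>\<close> supported on \<open>T\<close>. An element of \<open>\<Sigma>\<close> whose
  entries on \<open>T\<close> are at least those of all witnesses would dominate that witness, so at
  most \<open>D\<close> of its entries are large.\<close>

lemma down_closed_card_upper:
  assumes "\<Sigma> \<subseteq> multi_indices m"
    and down: "\<And>\<alpha> \<beta>. \<beta> \<in> \<Sigma> \<Longrightarrow> \<alpha> \<le> \<beta> \<Longrightarrow> \<alpha> \<in> \<Sigma>"
    and no_cone: "\<And>T. T \<subseteq> {..<m} \<Longrightarrow> card T = Suc D \<Longrightarrow>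
       \<exists>\<alpha>\<in>multi_indices m. (\<forall>i. i \<notin> T \<longrightarrow> \<alpha> i = 0) \<and> \<alpha> \<notin> \<Sigma>"
  shows "\<exists>C. \<forall>n. card (\<Sigma> \<inter> multi_indices_deg m n) \<le> C * (n + 1) ^ (D - 1)"
proof -
  define \<T> where "\<T> = {T. T \<subseteq> {..<m} \<and> card T = Suc D}"
  have "\<forall>T\<in>\<T>. \<exists>\<alpha>\<in>multi_indices m. (\<forall>i. i \<notin> T \<longrightarrow> \<alpha> i = 0) \<and> \<alpha> \<notin> \<Sigma>"
    using no_cone by (auto simp: \<T>_def)
  then obtain w where w: "\<And>T. T \<in> \<T> \<Longrightarrow> w T \<in> multi_indices m \<and> (\<forall>i. i \<notin> T \<longrightarrow> w T i = 0) \<and> w T \<notin> \<Sigma>"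
    by metis
  have "finite \<T>"
    by (auto simp: \<T>_def)
  define b where "b = Suc (\<Sum>T\<in>\<T>. \<Sum>i<m. w T i)"
  have wb: "w T i \<le> b" if "T \<in> \<T>" "i < m" for T i
  proof -
    have "w T i \<le> (\<Sum>i<m. w T i)"
      using that by (intro member_le_sum) auto
    also have "\<dots> \<le> (\<Sum>T\<in>\<T>. \<Sum>i<m. w T i)"
      using that \<open>finite \<T>\<close> by (intro member_le_sum) auto
    finally show ?thesis
      by (simp add: b_def)
  qed
  let ?\<S> = "{S. S \<subseteq> {..<m} \<and> card S \<le> D}"
  let ?F = "\<lambda>n S. {\<alpha> \<in> multi_indices_deg m n. \<forall>i\<in>{..<m} - S. \<alpha> i < b}"
  have sub: "\<Sigma> \<inter> multi_indices_deg m n \<subseteq> (\<Union>S\<in>?\<S>. ?F n S)" for n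
  proof
    fix \<beta> assume \<beta>: "\<beta> \<in> \<Sigma> \<inter> multi_indices_deg m n"
    define S where "S = {i. i < m \<and> b \<le> \<beta> i}"
    have "card S \<le> D"
    proof (rule ccontr)
      assume "\<not> card S \<le> D"
      then obtain T where T: "T \<subseteq> S" "card T = Suc D"
        using obtain_subset_with_card_n[of "Suc D" S] by auto
      then have "T \<in> \<T>"
        by (auto simp: \<T>_def S_def)
      have "w T i \<le> \<beta> i" for i
      proof (cases "i \<in> T")
        case True
        then have "i < m" "b \<le> \<beta> i"
          using T(1) by (auto simp: S_def)
        then show ?thesis
          using wb[OF \<open>T \<in> \<T>\<close>, of i] by simp
      qed (use w[OF \<open>T \<in> \<T>\<close>] in simp)
      then have "w T \<in> \<Sigma>"
        using down[of \<beta> "w T"] \<beta> by (auto simp: le_fun_def)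
      with w[OF \<open>T \<in> \<T>\<close>] show False
        by blast
    qed
    then have "S \<in> ?\<S>"
      by (auto simp: S_def)
    moreover have "\<beta> \<in> ?F n S"
      using \<beta> by (auto simp: S_def not_le)
    ultimately show "\<beta> \<in> (\<Union>S\<in>?\<S>. ?F n S)"
      by (rule UN_I)
  qed
  have fin: "finite ?\<S>"
    by (rule finite_subset[of _ "Pow {..<m}"]) auto
  have "card (\<Sigma> \<inter> multi_indices_deg m n) \<le> (card ?\<S> * b ^ m) * (n + 1) ^ (D - 1)" for n
  proof -
    have "card (\<Sigma> \<inter> multi_indices_deg m n) \<le> card (\<Union>S\<in>?\<S>. ?F n S)"
      using fin by (intro card_mono sub finite_UN_I) (auto intro: finite_subset[OF _ finite_multi_indices_deg])
    also have "\<dots> \<le> (\<Sum>S\<in>?\<S>. card (?F n S))"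
      using fin by (rule card_UN_le)
    also have "\<dots> \<le> (\<Sum>S\<in>?\<S>. b ^ m * (n + 1) ^ (D - 1))"
      by (intro sum_mono card_multi_indices_bounded_off) (auto simp: b_def)
    finally show ?thesis
      by (simp add: mult.assoc)
  qed
  then show ?thesis
    by blast
qed

text \<open>All entries on \<open>S\<close> except one are chosen freely up to
  \<open>n div card S\<close>; the remaining one, at \<open>s\<close>, takes up what is left of the
  degree.\<close>

lemma cone_card_lower:
  assumes S: "S \<subseteq> {..<m}" "S \<noteq> {}"
    and cone: "\<And>\<alpha>. \<alpha> \<in> multi_indices m \<Longrightarrow> (\<forall>i. i \<notin> S \<longrightarrow> \<alpha> i = 0) \<Longrightarrow> \<alpha> \<in> \<Sigma>"
  shows "n ^ (card S - 1) \<le> card S ^ (card S - 1) * card (\<Sigma> \<inter> multi_indices_deg m n)"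
proof -
  obtain s where s: "s \<in> S" "s < m"
    using S by auto
  have finS: "finite S"
    using S finite_subset by blast
  define D where "D = card S"
  have D: "D > 0" "card (S - {s}) = D - 1"
    using S finS s by (auto simp: D_def card_gt_0_iff)
  let ?X = "(S - {s}) \<rightarrow>\<^sub>E {..n div D}"
  define \<Phi> where "\<Phi> = (\<lambda>\<phi> i. if i \<in> S - {s} then \<phi> i else if i = s then n - sum \<phi> (S - {s}) else 0 :: nat)"
  have "\<Phi> \<phi> \<in> \<Sigma> \<inter> multi_indices_deg m n" if "\<phi> \<in> ?X" for \<phi>
  proof -
    have "sum \<phi> (S - {s}) \<le> (\<Sum>i\<in>S - {s}. n div D)"
      using that by (intro sum_mono) auto
    also have "\<dots> = (D - 1) * (n div D)"
      using D by simp
    also have "\<dots> \<le> n"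
      by (metis diff_le_self div_times_less_eq_dividend le_trans mult.commute mult_le_mono1)
    finally have le: "sum \<phi> (S - {s}) \<le> n" .
    have "sum (\<Phi> \<phi>) {..<m} = sum (\<Phi> \<phi>) S"
      using S(1) by (intro sum.mono_neutral_right) (auto simp: \<Phi>_def s)
    also have "\<dots> = \<Phi> \<phi> s + sum (\<Phi> \<phi>) (S - {s})"
      using s finS by (simp add: sum.remove)
    also have "sum (\<Phi> \<phi>) (S - {s}) = sum \<phi> (S - {s})"
      by (intro sum.cong) (auto simp: \<Phi>_def)
    finally have "sum (\<Phi> \<phi>) {..<m} = n"
      using le by (simp add: \<Phi>_def)
    moreover have "\<Phi> \<phi> \<in> multi_indices m"
      using S(1) s by (auto simp: \<Phi>_def multi_indices_def)
    moreover from this have "\<Phi> \<phi> \<in> \<Sigma>"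
      using s by (intro cone) (auto simp: \<Phi>_def)
    ultimately show ?thesis
      by (simp add: multi_indices_deg_def)
  qed
  moreover have "inj_on \<Phi> ?X"
  proof (rule inj_onI)
    fix \<phi> \<psi> assume *: "\<phi> \<in> ?X" "\<psi> \<in> ?X" "\<Phi> \<phi> = \<Phi> \<psi>"
    show "\<phi> = \<psi>"
    proof (rule PiE_ext[OF *(1,2)])
      fix i assume "i \<in> S - {s}"
      then show "\<phi> i = \<psi> i"
        using fun_cong[OF *(3), of i] by (simp add: \<Phi>_def)
    qed
  qed
  ultimately have "card ?X \<le> card (\<Sigma> \<inter> multi_indices_deg m n)"
    by (intro card_inj_on_le[of \<Phi>]) (auto intro: finite_subset[OF _ finite_multi_indices_deg])
  moreover have "card ?X = (n div D + 1) ^ (D - 1)"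
    using D finS by (simp add: card_PiE)
  moreover have "n \<le> D * (n div D + 1)"
    using D(1) by (metis Suc_eq_plus1 dividend_less_times_div less_imp_le mult_Suc_right add.commute)
  then have "n ^ (D - 1) \<le> D ^ (D - 1) * (n div D + 1) ^ (D - 1)"
    by (metis power_mono power_mult_distrib zero_le)
  ultimately show ?thesis
    by (metis D_def le_trans mult_le_mono2)
qed

text \<open>The number \<open>D\<close> is the largest dimension of a coordinate cone contained in \<open>\<Sigma>\<close>.\<close>

lemma down_closed_growth:
  assumes "\<Sigma> \<subseteq> multi_indices m" "\<Sigma> \<noteq> {}"
    and down: "\<And>\<alpha> \<beta>. \<beta> \<in> \<Sigma> \<Longrightarrow> \<alpha> \<le> \<beta> \<Longrightarrow> \<alpha> \<in> \<Sigma>"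
  obtains C D where "\<And>n. card (\<Sigma> \<inter> multi_indices_deg m n) \<le> C * (n + 1) ^ (D - 1)"
    and "\<And>n. D \<noteq> 0 \<Longrightarrow> n ^ (D - 1) \<le> D ^ (D - 1) * card (\<Sigma> \<inter> multi_indices_deg m n)"
proof -
  define cone where "cone = (\<lambda>S. \<forall>\<alpha>\<in>multi_indices m. (\<forall>i. i \<notin> S \<longrightarrow> \<alpha> i = 0) \<longrightarrow> \<alpha> \<in> \<Sigma>)"
  have "(0 :: nat \<Rightarrow> nat) \<in> \<Sigma>"
    using assms(2) down[of _ 0] by (auto simp: le_fun_def)
  then have "cone {}"
    unfolding cone_def by (metis empty_iff ext zero_fun_apply)
  let ?\<S> = "{S. S \<subseteq> {..<m} \<and> cone S}"
  have fin: "finite ?\<S>"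
    by (rule finite_subset[of _ "Pow {..<m}"]) auto
  have ne: "card ` ?\<S> \<noteq> {}"
    using \<open>cone {}\<close> by auto
  define D where "D = Max (card ` ?\<S>)"
  have "D \<in> card ` ?\<S>"
    unfolding D_def using fin ne by (intro Max_in) auto
  then obtain S where S: "S \<subseteq> {..<m}" "cone S" "card S = D"
    by auto
  have max: "card T \<le> D" if "T \<subseteq> {..<m}" "cone T" for T
    unfolding D_def using that fin by (intro Max_ge) auto
  have "\<exists>C. \<forall>n. card (\<Sigma> \<inter> multi_indices_deg m n) \<le> C * (n + 1) ^ (D - 1)"
  proof (rule down_closed_card_upper[OF assms(1) down])
    fix T assume T: "T \<subseteq> {..<m}" "card T = Suc D"
    then have "\<not> cone T"
      using max[of T] by auto
    then show "\<exists>\<alpha>\<in>multi_indices m. (\<forall>i. i \<notin> T \<longrightarrow> \<alpha> i = 0) \<and> \<alpha> \<notin> \<Sigma>"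
      by (auto simp: cone_def)
  qed
  then obtain C where C: "\<And>n. card (\<Sigma> \<inter> multi_indices_deg m n) \<le> C * (n + 1) ^ (D - 1)"
    by blast
  have "n ^ (D - 1) \<le> D ^ (D - 1) * card (\<Sigma> \<inter> multi_indices_deg m n)" if "D \<noteq> 0" for n
  proof -
    have "S \<noteq> {}"
      using S that by auto
    with S show ?thesis
      using cone_card_lower[of S m \<Sigma> n] unfolding cone_def by blast
  qed
  with C that show thesis
    by blast
qed

section \<open>Artin--Rees and Krull\<close>

context ring
begin

lemma ideal_add_mem: "ideal J R \<Longrightarrow> a \<in> J \<Longrightarrow> b \<in> J \<Longrightarrow> a \<oplus> b \<in> J"
  by (simp add: additive_subgroup.a_closed ideal.axioms(1))

lemma ideal_zero_mem: "ideal J R \<Longrightarrow> \<zero> \<in> J"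
  by (simp add: additive_subgroup.zero_closed ideal.axioms(1))

lemma ideal_diff_mem: "ideal J R \<Longrightarrow> a \<in> J \<Longrightarrow> b \<in> J \<Longrightarrow> a \<ominus> b \<in> J"
  unfolding a_minus_def by (simp add: additive_subgroup.a_inv_closed ideal.axioms(1) ideal_add_mem)

lemma ideal_subset_carrier: "ideal J R \<Longrightarrow> J \<subseteq> carrier R"
  by (auto dest: ideal.Icarr)

lemma genideal_mem: "S \<subseteq> carrier R \<Longrightarrow> s \<in> S \<Longrightarrow> s \<in> Idl S"
  using genideal_self by blast

lemma genideal_closed: "S \<subseteq> carrier R \<Longrightarrow> x \<in> Idl S \<Longrightarrow> x \<in> carrier R"
  using ideal_subset_carrier[OF genideal_ideal] by blast

lemma set_add_memI: "a \<in> A \<Longrightarrow> b \<in> B \<Longrightarrow> x = a \<oplus> b \<Longrightarrow> x \<in> A <+> B"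
  by (auto simp: set_add_def')

lemma set_add_memE:
  assumes "x \<in> A <+> B"
  obtains a b where "a \<in> A" "b \<in> B" "x = a \<oplus> b"
  using assms by (auto simp: set_add_def')

lemma set_add_left: "ideal A R \<Longrightarrow> ideal B R \<Longrightarrow> A \<subseteq> A <+> B"
  using union_genideal genideal_self ideal_subset_carrier by (metis Un_subset_iff)

lemma set_add_right: "ideal A R \<Longrightarrow> ideal B R \<Longrightarrow> B \<subseteq> A <+> B"
  using union_genideal genideal_self ideal_subset_carrier by (metis Un_subset_iff)

lemma set_add_least: "ideal C R \<Longrightarrow> A \<subseteq> C \<Longrightarrow> B \<subseteq> C \<Longrightarrow> A <+> B \<subseteq> C"
  by (auto elim!: set_add_memE intro: ideal_add_mem)

lemma set_add_mono: "A \<subseteq> A' \<Longrightarrow> B \<subseteq> B' \<Longrightarrow> A <+> B \<subseteq> A' <+> B'"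
  by (fastforce elim!: set_add_memE intro: set_add_memI)

end

definition colon :: "('a, 'b) ring_scheme \<Rightarrow> 'a set \<Rightarrow> 'a \<Rightarrow> 'a set" where
  "colon R J c = {x \<in> carrier R. c \<otimes>\<^bsub>R\<^esub> x \<in> J}"

context cring
begin

lemma ideal_lmult_mem: "ideal J R \<Longrightarrow> a \<in> J \<Longrightarrow> r \<in> carrier R \<Longrightarrow> r \<otimes> a \<in> J"
  by (simp add: ideal.I_l_closed)

lemma ideal_rmult_mem: "ideal J R \<Longrightarrow> a \<in> J \<Longrightarrow> r \<in> carrier R \<Longrightarrow> a \<otimes> r \<in> J"
  by (simp add: ideal.I_r_closed)

lemma cring_idealI:
  assumes "J \<subseteq> carrier R" "\<zero> \<in> J"
    and "\<And>a b. a \<in> J \<Longrightarrow> b \<in> J \<Longrightarrow> a \<oplus> b \<in> J"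
    and mult: "\<And>a r. a \<in> J \<Longrightarrow> r \<in> carrier R \<Longrightarrow> r \<otimes> a \<in> J"
  shows "ideal J R"
proof (rule idealI)
  show "ring R" by (rule ring_axioms)
  have "\<ominus> a \<in> J" if "a \<in> J" for a
  proof -
    have "\<ominus> a = (\<ominus> \<one>) \<otimes> a"
      using assms(1) that by (simp add: l_minus subsetD)
    then show ?thesis
      using mult that by simp
  qed
  then show "subgroup J (add_monoid R)"
    using assms by (intro add.subgroupI) (auto simp: a_inv_def[symmetric])
  show "a \<otimes> r \<in> J" if "a \<in> J" "r \<in> carrier R" for a r
    using mult[OF that] assms(1) that by (simp add: m_comm subsetD)
qed (use mult in auto)

lemma colon_ideal:
  assumes "ideal J R" "c \<in> carrier R"
  shows "ideal (colon R J c) R"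
proof (rule cring_idealI)
  show "r \<otimes> a \<in> colon R J c" if "a \<in> colon R J c" "r \<in> carrier R" for a r
  proof -
    have "c \<otimes> (r \<otimes> a) = r \<otimes> (c \<otimes> a)"
      using that assms(2) by (simp add: colon_def m_lcomm)
    then show ?thesis
      using that assms by (simp add: colon_def ideal_lmult_mem)
  qed
qed (use assms in \<open>auto simp: colon_def r_distr ideal_zero_mem ideal_add_mem\<close>)

lemma genideal_mult_mem:
  assumes "ideal J R" "c \<in> carrier R" "S \<subseteq> carrier R" "\<And>s. s \<in> S \<Longrightarrow> c \<otimes> s \<in> J" "x \<in> Idl S"
  shows "c \<otimes> x \<in> J"
proof -
  have "Idl S \<subseteq> colon R J c"
    using assms by (intro genideal_minimal colon_ideal) (auto simp: colon_def)
  then show ?thesis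
    using assms(5) by (auto simp: colon_def)
qed

lemma genideal_mult_mem2:
  assumes "ideal J R" "S \<subseteq> carrier R" "T \<subseteq> carrier R"
    and "\<And>s t. s \<in> S \<Longrightarrow> t \<in> T \<Longrightarrow> s \<otimes> t \<in> J" "x \<in> Idl S" "y \<in> Idl T"
  shows "x \<otimes> y \<in> J"
proof -
  have x: "x \<in> carrier R" and y: "y \<in> carrier R"
    using assms(2,3,5,6) by (auto intro: genideal_closed)
  have "y \<otimes> s \<in> J" if "s \<in> S" for s
  proof -
    have "s \<otimes> y \<in> J"
      by (rule genideal_mult_mem[OF assms(1) _ assms(3) assms(4)[OF that] assms(6)]) (use that assms(2) in blast)
    then show ?thesis
      using that assms(2) y by (simp add: m_comm subsetD)
  qed
  then have "y \<otimes> x \<in> J"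
    by (rule genideal_mult_mem[OF assms(1) y assms(2) _ assms(5)])
  then show ?thesis
    using x y by (simp add: m_comm)
qed

lemma genideal_insertE:
  assumes "a \<in> carrier R" "S \<subseteq> carrier R" "y \<in> Idl (insert a S)"
  obtains r u where "r \<in> carrier R" "u \<in> Idl S" "y = r \<otimes> a \<oplus> u"
proof -
  have I: "ideal (PIdl a) R" "ideal (Idl S) R"
    using assms by (auto intro: cgenideal_ideal genideal_ideal)
  have "Idl (insert a S) \<subseteq> PIdl a <+> Idl S"
    using assms cgenideal_self[OF assms(1)] genideal_self[OF assms(2)]
      set_add_left[OF I] set_add_right[OF I]
    by (intro genideal_minimal add_ideals I) auto
  then obtain b u where "b \<in> PIdl a" "u \<in> Idl S" "y = b \<oplus> u"
    using assms(3) by (meson set_add_memE subsetD)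
  then show thesis
    using that by (auto simp: cgenideal_def)
qed

lemma PIdl_memE:
  assumes "x \<in> PIdl a"
  obtains r where "r \<in> carrier R" "x = r \<otimes> a"
  using assms by (auto simp: cgenideal_def)

lemma prime_mult_mem: "primeideal P R \<Longrightarrow> a \<in> carrier R \<Longrightarrow> b \<in> carrier R \<Longrightarrow> a \<otimes> b \<in> P \<Longrightarrow> a \<in> P \<or> b \<in> P"
  by (rule primeideal.I_prime)

lemma prime_one_notin: "primeideal P R \<Longrightarrow> \<one> \<notin> P"
  using ideal.one_imp_carrier primeideal.I_notcarr primeideal.axioms(1) by metis

end

context noetherian_ring
begin

lemma ascending_ideals_stabilize:
  assumes "\<And>i. ideal (J i) R" "\<And>i j. i \<le> j \<Longrightarrow> J i \<subseteq> J (j :: nat)"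
  shows "\<exists>n. \<forall>k\<ge>n. J k = J n"
proof -
  have "subset.chain {I. ideal I R} (range J)"
    unfolding pred_on.chain_def
  proof (intro conjI ballI)
    fix A B assume "A \<in> range J" "B \<in> range J"
    then obtain i j where "A = J i" "B = J j"
      by blast
    then show "(\<subset>)\<^sup>=\<^sup>= A B \<or> (\<subset>)\<^sup>=\<^sup>= B A"
      using assms(2)[of i j] assms(2)[of j i] nat_le_linear[of i j] by auto
  qed (use assms(1) in auto)
  then have "\<Union>(range J) \<in> range J"
    by (intro ideal_chain_is_trivial) auto
  then obtain n where "\<Union>(range J) = J n"
    by auto
  then show ?thesis
    using assms(2) by blast
qed

text \<open>In a noetherian ring the union of a nonempty chain of ideals is a member of the chain,
  so Zorn's lemma applies to an arbitrary nonempty family.\<close>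

lemma exists_maximal_ideal_in:
  assumes "F \<noteq> {}" "\<And>J. J \<in> F \<Longrightarrow> ideal J R"
  shows "\<exists>J\<in>F. \<forall>K\<in>F. J \<subseteq> K \<longrightarrow> K = J"
proof (rule subset_Zorn_nonempty[OF assms(1)])
  fix C assume C: "C \<noteq> {}" "subset.chain F C"
  then have "subset.chain {I. ideal I R} C"
    using assms(2) by (auto simp: pred_on.chain_def)
  then have "\<Union>C \<in> C"
    using C(1) by (intro ideal_chain_is_trivial)
  then show "\<Union>C \<in> F"
    using C(2) by (auto simp: pred_on.chain_def)
qed

end

section \<open>Monomials in the generators and powers of the ideal\<close>

locale generated_ideal = cring R for R (structure) +
  fixes g :: "nat \<Rightarrow> 'a" and m :: nat
  assumes g_closed [simp]: "g i \<in> carrier R"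
begin

definition mon :: "(nat \<Rightarrow> nat) \<Rightarrow> 'a" where
  "mon \<alpha> = (\<Otimes>i\<in>{..<m}. g i [^] \<alpha> i)"

abbreviation "E \<equiv> multi_indices_deg m"

definition pw :: "nat \<Rightarrow> 'a set" where
  "pw n = Idl (mon ` E n)"

lemma mon_closed [simp]: "mon \<alpha> \<in> carrier R"
  unfolding mon_def by (intro finprod_closed) auto

lemma mon_image_closed [simp]: "mon ` A \<subseteq> carrier R"
  by auto

lemma mon_add: "mon (\<alpha> + \<beta>) = mon \<alpha> \<otimes> mon \<beta>"
  unfolding mon_def by (subst finprod_multf[symmetric]) (auto intro!: finprod_cong' simp: nat_pow_mult)

lemma mon_0 [simp]: "mon 0 = \<one>"
  unfolding mon_def by (simp add: finprod_one_eqI)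

lemma mon_split: "\<beta> \<le> \<alpha> \<Longrightarrow> mon \<alpha> = mon \<beta> \<otimes> mon (\<alpha> - \<beta>)"
  by (metis mon_add multi_indices_add_diff)

lemma mon_pow: "mon (\<lambda>i. q * \<alpha> i) = mon \<alpha> [^] (q :: nat)"
proof (induction q)
  case 0
  have "(\<lambda>i. 0 * \<alpha> i) = 0"
    by auto
  then show ?case
    by (simp only: mon_0 nat_pow_0)
next
  case (Suc q)
  have "(\<lambda>i. Suc q * \<alpha> i) = (\<lambda>i. q * \<alpha> i) + \<alpha>"
    by auto
  then show ?case
    by (simp only: mon_add Suc nat_pow_Suc)
qed

lemma mon_E_1: "mon ` E 1 = g ` {..<m}"
proof -
  have delta: "mon (\<lambda>j. if j = i then 1 else 0) = g i" if "i < m" for i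
  proof -
    have "mon (\<lambda>j. if j = i then 1 else 0) = (\<Otimes>j\<in>{..<m}. if i = j then g j else \<one>)"
      unfolding mon_def by (intro finprod_cong') auto
    also have "\<dots> = g i"
      using that by (intro finprod_singleton) auto
    finally show ?thesis .
  qed
  have ex: "\<exists>i<m. \<alpha> = (\<lambda>j. if j = i then 1 else 0)" if "\<alpha> \<in> E 1" for \<alpha>
  proof -
    have "sum \<alpha> {..<m} = 1"
      using that by (simp add: multi_indices_deg_def)
    then obtain i where i: "i < m" "\<alpha> i = 1" "\<forall>j\<in>{..<m}. i \<noteq> j \<longrightarrow> \<alpha> j = 0"
      by (subst (asm) sum_eq_1_iff) auto
    have "\<alpha> j = 0" if "j \<ge> m" for j
      using that \<open>\<alpha> \<in> E 1\<close> by (simp add: multi_indices_deg_def multi_indices_def)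
    with i have "\<alpha> j = (if j = i then 1 else 0)" for j
      by (cases "j < m") auto
    with i(1) show ?thesis
      by blast
  qed
  have mem: "(\<lambda>j. if j = i then 1 else 0) \<in> E 1" if "i < m" for i
    unfolding multi_indices_deg_def multi_indices_def mem_Collect_eq
    using that by (intro conjI allI impI) (simp_all add: sum.delta)
  show ?thesis
  proof (intro equalityI image_subsetI)
    fix \<alpha> assume "\<alpha> \<in> E 1"
    then obtain i where i: "i < m" "\<alpha> = (\<lambda>j. if j = i then 1 else 0)"
      using ex by blast
    then have "mon \<alpha> = g i"
      by (simp only: delta)
    with i(1) show "mon \<alpha> \<in> g ` {..<m}"
      by simp
  next
    fix i assume "i \<in> {..<m}"
    then have "i < m" by simp
    have "mon (\<lambda>j. if j = i then 1 else 0) \<in> mon ` E 1"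
      by (rule imageI[OF mem[OF \<open>i < m\<close>]])
    then show "g i \<in> mon ` E 1"
      by (simp only: delta[OF \<open>i < m\<close>])
  qed
qed

lemma pw_ideal [simp]: "ideal (pw n) R"
  unfolding pw_def by (intro genideal_ideal) simp

lemma pw_closed: "x \<in> pw n \<Longrightarrow> x \<in> carrier R"
  using ideal.Icarr[OF pw_ideal] .

lemma mon_in_pw: "\<alpha> \<in> E n \<Longrightarrow> mon \<alpha> \<in> pw n"
  unfolding pw_def by (intro genideal_mem) auto

lemma pw_0 [simp]: "pw 0 = carrier R"
  using genideal_one by (simp add: pw_def)

lemma pw_1: "pw 1 = Idl (g ` {..<m})"
  by (simp only: pw_def mon_E_1)

lemma pw_mult: "x \<in> pw a \<Longrightarrow> y \<in> pw b \<Longrightarrow> x \<otimes> y \<in> pw (a + b)"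
  unfolding pw_def
  by (erule (1) genideal_mult_mem2[rotated -2])
     (auto simp: mon_add[symmetric] intro!: genideal_mem imageI multi_indices_deg_add genideal_ideal)

lemma pow_in_pw_notin_prime:
  assumes Q: "primeideal Q R" and z: "z \<in> pw 1" "z \<notin> Q"
  shows "z [^] k \<in> pw k \<and> z [^] (k :: nat) \<notin> Q"
proof (induction k)
  case 0
  then show ?case
    using prime_one_notin[OF Q] by simp
next
  case (Suc k)
  have "z [^] k \<otimes> z \<in> pw (k + 1)"
    using Suc z(1) by (intro pw_mult) auto
  moreover have "z [^] Suc k \<notin> Q"
    using Suc z(2) pw_closed[OF z(1)] prime_mult_mem[OF Q, of "z [^] k" z] by auto
  ultimately show ?case
    by simp
qed

lemma pw_subset_iff: "ideal J R \<Longrightarrow> pw n \<subseteq> J \<longleftrightarrow> (\<forall>\<alpha>\<in>E n. mon \<alpha> \<in> J)"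
  unfolding pw_def by (subst Idl_subset_ideal) auto

lemma pw_antimono:
  assumes "a \<le> b"
  shows "pw b \<subseteq> pw a"
  unfolding pw_subset_iff[OF pw_ideal]
proof
  fix \<alpha> assume "\<alpha> \<in> E b"
  then obtain \<beta> where "\<beta> \<in> E a" "\<beta> \<le> \<alpha>"
    using assms exists_multi_index_le by blast
  then show "mon \<alpha> \<in> pw a"
    by (simp add: mon_split ideal_rmult_mem mon_in_pw)
qed

lemma pw_Suc: "pw (Suc n) = ideal_prod R (pw n) (pw 1)"
proof
  show "pw (Suc n) \<subseteq> ideal_prod R (pw n) (pw 1)"
    unfolding pw_subset_iff[OF ideal_prod_is_ideal[OF pw_ideal pw_ideal]]
  proof
    fix \<alpha> assume \<alpha>: "\<alpha> \<in> E (Suc n)"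
    then obtain \<beta> where \<beta>: "\<beta> \<in> E n" "\<beta> \<le> \<alpha>"
      using exists_multi_index_le[of \<alpha> m "Suc n" n] by auto
    then have "\<alpha> - \<beta> \<in> E 1"
      using multi_indices_deg_diff[OF \<alpha> \<beta>] by simp
    with \<beta> show "mon \<alpha> \<in> ideal_prod R (pw n) (pw 1)"
      by (simp only: mon_split) (intro ideal_prod.prod mon_in_pw)
  qed
  show "ideal_prod R (pw n) (pw 1) \<subseteq> pw (Suc n)"
    unfolding ideal_prod_eq_genideal[OF pw_ideal pw_ideal]
    using pw_mult[of _ n _ 1] by (intro genideal_minimal) (auto simp: set_mult_def)
qed

lemma ideal_power_eq_pw: "ideal_power R (Idl (g ` {..<m})) n = pw n"
proof (induction n)
  case 0
  then show ?case
    by (simp add: nat_pow_def ideals_set_def)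
next
  case (Suc n)
  interpret S: semiring "ideals_set R"
    by (rule ideals_set_is_semiring)
  show ?case
    using Suc by (simp add: pw_Suc pw_1[symmetric] del: One_nat_def) (simp add: ideals_set_def)
qed

text \<open>In characteristic \<open>p\<close> and for \<open>q\<close> a power of \<open>p\<close>
  this is the Frobenius power of the ideal. In this form the growth argument makes no assumption on
  the characteristic.\<close>

definition generator_powers :: "nat \<Rightarrow> 'a set" where
  "generator_powers q = Idl ((\<lambda>i. g i [^] q) ` {..<m})"

lemma generator_powers_ideal: "ideal (generator_powers q) R"
  unfolding generator_powers_def by (intro genideal_ideal) auto

lemma g_pow_in_pw:
  assumes "i < m"
  shows "g i [^] q \<in> pw q"
proof (induction q)
  case (Suc q)
  have "g i \<in> pw 1"
    unfolding pw_1 using assms by (intro genideal_mem) auto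
  with Suc have "g i [^] q \<otimes> g i \<in> pw (q + 1)"
    by (intro pw_mult)
  then show ?case
    by simp
qed simp

lemma generator_powers_subset_pw: "generator_powers q \<subseteq> pw q"
  unfolding generator_powers_def by (intro genideal_minimal pw_ideal) (auto intro: g_pow_in_pw)

section \<open>Leading coefficients and the Artin-Rees lemma\<close>

definition lower :: "(nat \<Rightarrow> nat) \<Rightarrow> (nat \<Rightarrow> nat) set" where
  "lower \<alpha> = {\<beta> \<in> E (sum \<alpha> {..<m}). less_fun \<beta> \<alpha>}"

lemma lower_span_shift:
  assumes "\<alpha> \<in> multi_indices m" "\<gamma> \<in> multi_indices m" "u \<in> Idl (mon ` lower \<alpha>)"
  shows "mon \<gamma> \<otimes> u \<in> Idl (mon ` lower (\<alpha> + \<gamma>))"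
proof (rule genideal_mult_mem[OF _ _ _ _ assms(3)])
  fix s assume "s \<in> mon ` lower \<alpha>"
  then obtain \<beta> where \<beta>: "\<beta> \<in> lower \<alpha>" "s = mon \<beta>"
    by blast
  then have "\<beta> + \<gamma> \<in> lower (\<alpha> + \<gamma>)"
    using multi_indices_deg_add[of \<beta> m _ \<gamma> "sum \<gamma> {..<m}"] assms(2)
    by (auto simp: lower_def less_fun_add sum.distrib multi_indices_deg_def)
  then show "mon \<gamma> \<otimes> s \<in> Idl (mon ` lower (\<alpha> + \<gamma>))"
    using \<beta>(2) by (auto simp: mon_add[symmetric] add.commute intro!: genideal_mem)
qed (auto intro: genideal_ideal)

text \<open>The coefficients of \<open>mon \<alpha>\<close> in those forms with leading monomial \<open>\<alpha>\<close> whose value lies in \<open>N\<close>.\<close>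

definition lead_coeffs :: "'a set \<Rightarrow> (nat \<Rightarrow> nat) \<Rightarrow> 'a set" where
  "lead_coeffs N \<alpha> = {r \<in> carrier R. \<exists>u\<in>Idl (mon ` lower \<alpha>). r \<otimes> mon \<alpha> \<oplus> u \<in> N}"

lemma span_lower_ideal [simp]: "ideal (Idl (mon ` A)) R"
  by (intro genideal_ideal) simp

lemma span_closed: "u \<in> Idl (mon ` A) \<Longrightarrow> u \<in> carrier R"
  using ideal.Icarr[OF span_lower_ideal] .

lemma lead_coeffs_ideal:
  assumes N: "ideal N R"
  shows "ideal (lead_coeffs N \<alpha>) R"
proof (rule cring_idealI)
  show "\<zero> \<in> lead_coeffs N \<alpha>"
    unfolding lead_coeffs_def using N ideal_zero_mem[OF span_lower_ideal]
    by (auto simp: ideal_zero_mem intro!: bexI[of _ \<zero>])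
next
  fix a b assume "a \<in> lead_coeffs N \<alpha>" "b \<in> lead_coeffs N \<alpha>"
  then obtain u v where uv: "a \<in> carrier R" "b \<in> carrier R" "u \<in> Idl (mon ` lower \<alpha>)" "v \<in> Idl (mon ` lower \<alpha>)"
    "a \<otimes> mon \<alpha> \<oplus> u \<in> N" "b \<otimes> mon \<alpha> \<oplus> v \<in> N"
    by (auto simp: lead_coeffs_def)
  have c: "u \<in> carrier R" "v \<in> carrier R" "mon \<alpha> \<in> carrier R"
    using uv span_closed by auto
  have "(a \<oplus> b) \<otimes> mon \<alpha> \<oplus> (u \<oplus> v) = (a \<otimes> mon \<alpha> \<oplus> u) \<oplus> (b \<otimes> mon \<alpha> \<oplus> v)"
    using uv(1,2) c by algebra
  then show "a \<oplus> b \<in> lead_coeffs N \<alpha>"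
    using uv N ideal_add_mem[OF N] ideal_add_mem[OF span_lower_ideal]
    by (auto simp: lead_coeffs_def intro!: bexI[of _ "u \<oplus> v"])
next
  fix a r assume "a \<in> lead_coeffs N \<alpha>" and r: "r \<in> carrier R"
  then obtain u where u: "a \<in> carrier R" "u \<in> Idl (mon ` lower \<alpha>)" "a \<otimes> mon \<alpha> \<oplus> u \<in> N"
    by (auto simp: lead_coeffs_def)
  have c: "u \<in> carrier R" "mon \<alpha> \<in> carrier R"
    using u span_closed by auto
  have "(r \<otimes> a) \<otimes> mon \<alpha> \<oplus> (r \<otimes> u) = r \<otimes> (a \<otimes> mon \<alpha> \<oplus> u)"
    using u(1) r c by algebra
  then show "r \<otimes> a \<in> lead_coeffs N \<alpha>"
    using u r ideal_lmult_mem[OF N] ideal_lmult_mem[OF span_lower_ideal]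
    by (auto simp: lead_coeffs_def intro!: bexI[of _ "r \<otimes> u"])
qed (auto simp: lead_coeffs_def)

lemma lead_coeffs_mono:
  assumes N: "ideal N R" and "\<alpha> \<in> multi_indices m" "\<gamma> \<in> multi_indices m"
  shows "lead_coeffs N \<alpha> \<subseteq> lead_coeffs N (\<alpha> + \<gamma>)"
proof
  fix r assume "r \<in> lead_coeffs N \<alpha>"
  then obtain u where u: "r \<in> carrier R" "u \<in> Idl (mon ` lower \<alpha>)" "r \<otimes> mon \<alpha> \<oplus> u \<in> N"
    by (auto simp: lead_coeffs_def)
  have c: "u \<in> carrier R" "mon \<alpha> \<in> carrier R" "mon \<gamma> \<in> carrier R"
    using u span_closed by auto
  have "r \<otimes> mon (\<alpha> + \<gamma>) \<oplus> mon \<gamma> \<otimes> u = mon \<gamma> \<otimes> (r \<otimes> mon \<alpha> \<oplus> u)"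
    unfolding mon_add using u(1) c by algebra
  also have "\<dots> \<in> N"
    using u N by (intro ideal_lmult_mem) auto
  finally show "r \<in> lead_coeffs N (\<alpha> + \<gamma>)"
    using u(1) lower_span_shift[OF assms(2,3) u(2)] by (auto simp: lead_coeffs_def)
qed

end

locale noetherian_generated_ideal = generated_ideal R g m + noetherian_ring R
  for R (structure) and g and m
begin

text \<open>The ideals of leading coefficients grow with the multi-index. Dickson's lemma turns an
  infinite failure into an ascending chain of such ideals, which has to stop. The outcome is a
  degree bound of the kind that finite generation over the Rees algebra would give.\<close>

lemma lead_coeffs_finite_basis:
  assumes N: "ideal N R"
  shows "\<exists>h. \<forall>\<alpha>\<in>multi_indices m. \<exists>\<beta>\<in>multi_indices m.
    \<beta> \<le> \<alpha> \<and> sum \<beta> {..<m} \<le> h \<and> lead_coeffs N \<beta> = lead_coeffs N \<alpha>"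
proof (rule ccontr)
  assume "\<not> ?thesis"
  then have "\<forall>h. \<exists>\<alpha>\<in>multi_indices m. \<forall>\<beta>\<in>multi_indices m.
    \<beta> \<le> \<alpha> \<longrightarrow> sum \<beta> {..<m} \<le> h \<longrightarrow> lead_coeffs N \<beta> \<noteq> lead_coeffs N \<alpha>"
    by blast
  then obtain A where A: "\<And>h. A h \<in> multi_indices m"
    "\<And>h \<beta>. \<beta> \<in> multi_indices m \<Longrightarrow> \<beta> \<le> A h \<Longrightarrow> sum \<beta> {..<m} \<le> h \<Longrightarrow> lead_coeffs N \<beta> \<noteq> lead_coeffs N (A h)"
    by metis
  \<comment> \<open>Each bound is the degree of the previous bad index, so an earlier bad index is
    an admissible \<open>\<beta>\<close> for every later one that lies above it.\<close>
  define h where "h = rec_nat 0 (\<lambda>_ k. sum (A k) {..<m})"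
  have h_Suc: "h (Suc j) = sum (A (h j)) {..<m}" for j
    by (simp add: h_def)
  have "h j < h (Suc j)" for j
    using A(2)[of "A (h j)" "h j"] A(1) by (auto simp: h_Suc not_le[symmetric])
  then have h_mono: "strict_mono h"
    by (simp add: strict_mono_Suc_iff)
  obtain r :: "nat \<Rightarrow> nat" where r: "strict_mono r" "\<And>i j. i \<le> j \<Longrightarrow> A (h (r i)) \<le> A (h (r j))"
    using dickson[of "\<lambda>j. A (h j)" m] A(1) by blast
  have "lead_coeffs N (A (h (r i))) \<subseteq> lead_coeffs N (A (h (r j)))" if "i \<le> j" for i j
    using lead_coeffs_mono[OF N A(1) multi_indices_diff[OF A(1)]] multi_indices_add_diff[OF r(2)[OF that]]
    by metis
  then obtain n where n: "\<And>k. k \<ge> n \<Longrightarrow> lead_coeffs N (A (h (r k))) = lead_coeffs N (A (h (r n)))"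
    using ascending_ideals_stabilize[of "\<lambda>i. lead_coeffs N (A (h (r i)))"] lead_coeffs_ideal[OF N] by blast
  have "Suc (r n) \<le> r (Suc n)"
    using r(1) by (simp add: Suc_leI strict_mono_Suc_iff)
  then have "sum (A (h (r n))) {..<m} \<le> h (r (Suc n))"
    using h_mono by (simp add: h_Suc[symmetric] strict_mono_less_eq)
  then show False
    using A(2)[OF A(1) r(2)[of n "Suc n"]] n[of "Suc n"] by simp
qed

text \<open>The top term of a form with value in \<open>N\<close> is cancelled by a monomial
  multiple of a form of degree at most \<open>h\<close> whose value is also in \<open>N\<close>;
  that monomial has degree at least \<open>n - h\<close>.\<close>

theorem artin_rees:
  assumes N: "ideal N R"
  obtains h where "\<And>n. pw n \<inter> N \<subseteq> ideal_prod R (pw (n - h)) N"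
proof -
  obtain h where h: "\<And>\<alpha>. \<alpha> \<in> multi_indices m \<Longrightarrow> \<exists>\<beta>\<in>multi_indices m.
    \<beta> \<le> \<alpha> \<and> sum \<beta> {..<m} \<le> h \<and> lead_coeffs N \<beta> = lead_coeffs N \<alpha>"
    using lead_coeffs_finite_basis[OF N] by blast
  \<comment> \<open>Stated for all initial segments \<open>T\<close> of \<open>E n\<close>, since
    what remains after a cancellation lies in the span of the monomials below the top one.\<close>
  have "y \<in> ideal_prod R (pw (n - h)) N"
    if "T \<subseteq> E n" "\<And>\<alpha> \<beta>. \<alpha> \<in> T \<Longrightarrow> \<beta> \<in> E n \<Longrightarrow> less_fun \<beta> \<alpha> \<Longrightarrow> \<beta> \<in> T"
      "y \<in> Idl (mon ` T)" "y \<in> N" for n T y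
    using that
  proof (induction "card T" arbitrary: T y)
    case 0
    then have "T = {}"
      using finite_multi_indices_deg finite_subset by (metis card_0_eq)
    with 0 have "y = \<zero>"
      using genideal_minimal[OF zeroideal, of "{}"] by auto
    then show ?case
      by (simp add: N ideal_prod_is_ideal ideal_zero_mem)
  next
    case (Suc k)
    have "finite T" "T \<noteq> {}"
      using Suc.hyps(2) finite_subset[OF Suc.prems(1) finite_multi_indices_deg] by auto
    moreover have T_mi: "T \<subseteq> multi_indices m"
      using Suc.prems(1) by (auto simp: multi_indices_deg_def)
    ultimately obtain \<alpha> where \<alpha>: "\<alpha> \<in> T" "\<And>\<beta>. \<beta> \<in> T \<Longrightarrow> \<beta> = \<alpha> \<or> less_fun \<beta> \<alpha>"
      using multi_indices_max by meson
    have \<alpha>_deg: "\<alpha> \<in> E n" "\<alpha> \<in> multi_indices m" "sum \<alpha> {..<m} = n"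
      using \<alpha> Suc.prems(1) by (auto simp: multi_indices_deg_def)
    have T': "T - {\<alpha>} = lower \<alpha>"
      using \<alpha> Suc.prems(1,2) by (auto simp: lower_def \<alpha>_deg less_fun_irrefl)
    then have "mon ` T = insert (mon \<alpha>) (mon ` lower \<alpha>)"
      using \<alpha>(1) by (metis image_insert insert_Diff)
    then obtain r u where ru: "r \<in> carrier R" "u \<in> Idl (mon ` lower \<alpha>)" "y = r \<otimes> mon \<alpha> \<oplus> u"
      using Suc.prems(3) genideal_insertE[of "mon \<alpha>" "mon ` lower \<alpha>" y] by auto
    then have "r \<in> lead_coeffs N \<alpha>"
      using Suc.prems(4) by (auto simp: lead_coeffs_def)
    then obtain \<beta> where \<beta>: "\<beta> \<in> multi_indices m" "\<beta> \<le> \<alpha>" "sum \<beta> {..<m} \<le> h" "r \<in> lead_coeffs N \<beta>"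
      using h \<alpha>_deg(2) by blast
    then obtain v where v: "v \<in> Idl (mon ` lower \<beta>)" "r \<otimes> mon \<beta> \<oplus> v \<in> N"
      by (auto simp: lead_coeffs_def)
    define \<gamma> where "\<gamma> = \<alpha> - \<beta>"
    have \<gamma>: "\<gamma> \<in> multi_indices m" "\<beta> + \<gamma> = \<alpha>"
      using \<beta> \<alpha>_deg by (auto simp: \<gamma>_def multi_indices_diff multi_indices_add_diff)
    have "\<gamma> \<in> E (n - sum \<beta> {..<m})"
      unfolding \<gamma>_def using \<beta> by (intro multi_indices_deg_diff \<alpha>_deg) (auto simp: multi_indices_deg_def)
    then have "mon \<gamma> \<in> pw (n - h)"
      using mon_in_pw pw_antimono[of "n - h" "n - sum \<beta> {..<m}"] \<beta>(3) by (meson diff_le_mono2 subsetD)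
    then have z: "mon \<gamma> \<otimes> (r \<otimes> mon \<beta> \<oplus> v) \<in> ideal_prod R (pw (n - h)) N"
      using v(2) by (intro ideal_prod.prod)
    have c: "u \<in> carrier R" "v \<in> carrier R" "mon \<beta> \<in> carrier R" "mon \<gamma> \<in> carrier R"
      using ru v span_closed by auto
    define y' where "y' = u \<ominus> mon \<gamma> \<otimes> v"
    have y: "y = y' \<oplus> mon \<gamma> \<otimes> (r \<otimes> mon \<beta> \<oplus> v)"
      unfolding ru(3) y'_def \<gamma>(2)[symmetric] mon_add using ru(1) c by algebra
    have "mon \<gamma> \<otimes> v \<in> Idl (mon ` lower \<alpha>)"
      using lower_span_shift[OF \<beta>(1) \<gamma>(1) v(1)] by (simp add: \<gamma>(2))
    then have "y' \<in> Idl (mon ` lower \<alpha>)"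
      unfolding y'_def using ru(2) by (intro ideal_diff_mem) auto
    moreover have "y' \<in> N"
    proof -
      have "y' = y \<ominus> mon \<gamma> \<otimes> (r \<otimes> mon \<beta> \<oplus> v)"
        unfolding ru(3) y'_def \<gamma>(2)[symmetric] mon_add using ru(1) c by algebra
      then show ?thesis
        using N Suc.prems(4) v(2) by (simp add: ideal_diff_mem ideal_lmult_mem)
    qed
    moreover have "card (lower \<alpha>) = k"
      using Suc.hyps(2) \<open>finite T\<close> \<alpha>(1) by (simp add: T'[symmetric])
    moreover have "lower \<alpha> \<subseteq> E n"
      by (auto simp: lower_def \<alpha>_deg)
    moreover have "\<beta> \<in> lower \<alpha>" if "\<beta>' \<in> lower \<alpha>" "\<beta> \<in> E n" "less_fun \<beta> \<beta>'" for \<beta> \<beta>'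
      using that less_fun_trans by (auto simp: lower_def \<alpha>_deg)
    ultimately have "y' \<in> ideal_prod R (pw (n - h)) N"
      using Suc.hyps(1)[of "lower \<alpha>" y'] by blast
    then show ?case
      unfolding y using z by (intro ideal_prod.sum)
  qed
  from this[of "E n" n for n] have "pw n \<inter> N \<subseteq> ideal_prod R (pw (n - h)) N" for n
    by (auto simp: pw_def)
  then show thesis
    by (rule that)
qed

text \<open>Artin-Rees is applied to \<open>N = PIdl z <+> Q\<close>: the part of
  \<open>z \<otimes> y\<close> in \<open>pw n\<close> lies in \<open>N\<close>, hence is
  \<open>z \<otimes> b\<close> modulo \<open>Q\<close> with \<open>b\<close> in
  \<open>pw (n - h)\<close>. As \<open>Q\<close> is prime, \<open>z\<close> cancels from
  \<open>z \<otimes> (y \<ominus> b) \<in> Q\<close>.\<close>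

lemma colon_pw_prime:
  assumes Q: "primeideal Q R" and z: "z \<in> carrier R" "z \<notin> Q"
  obtains h where "\<And>n y. y \<in> carrier R \<Longrightarrow> z \<otimes> y \<in> pw n <+> Q \<Longrightarrow> y \<in> pw (n - h) <+> Q"
proof -
  have QI: "ideal Q R"
    using Q by (rule primeideal.axioms)
  have zI: "ideal (PIdl z) R"
    using z by (intro cgenideal_ideal)
  define N where "N = PIdl z <+> Q"
  have N: "ideal N R"
    unfolding N_def by (intro add_ideals zI QI)
  obtain h where h: "\<And>n. pw n \<inter> N \<subseteq> ideal_prod R (pw (n - h)) N"
    using artin_rees[OF N] by blast
  have "y \<in> pw (n - h) <+> Q" if y: "y \<in> carrier R" "z \<otimes> y \<in> pw n <+> Q" for n y
  proof -
    obtain u w where uw: "u \<in> pw n" "w \<in> Q" "z \<otimes> y = u \<oplus> w"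
      using y(2) by (rule set_add_memE)
    have cc: "u \<in> carrier R" "w \<in> carrier R"
      using uw pw_closed ideal.Icarr[OF QI] by auto
    have prod: "\<exists>b\<in>pw (n - h). \<exists>v\<in>Q. x = z \<otimes> b \<oplus> v" if "x \<in> ideal_prod R (pw (n - h)) N" for x
      using that
    proof (induction rule: ideal_prod.induct)
      case (prod i j)
      then obtain t v where tv: "t \<in> carrier R" "v \<in> Q" "j = t \<otimes> z \<oplus> v"
        unfolding N_def by (metis set_add_memE PIdl_memE)
      have "i \<in> carrier R" "v \<in> carrier R"
        using prod(1) tv(2) pw_closed ideal.Icarr[OF QI] by auto
      then have "i \<otimes> j = z \<otimes> (i \<otimes> t) \<oplus> i \<otimes> v"
        unfolding tv(3) using tv(1) z(1) by algebra
      moreover have "i \<otimes> t \<in> pw (n - h)" "i \<otimes> v \<in> Q"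
        using prod(1) tv \<open>i \<in> carrier R\<close> QI by (auto intro: ideal_rmult_mem ideal_lmult_mem)
      ultimately show ?case
        by blast
    next
      case (sum s1 s2)
      then obtain b1 v1 b2 v2 where *: "b1 \<in> pw (n - h)" "v1 \<in> Q" "s1 = z \<otimes> b1 \<oplus> v1"
        "b2 \<in> pw (n - h)" "v2 \<in> Q" "s2 = z \<otimes> b2 \<oplus> v2"
        by blast
      have "b1 \<in> carrier R" "v1 \<in> carrier R" "b2 \<in> carrier R" "v2 \<in> carrier R"
        using * pw_closed ideal.Icarr[OF QI] by auto
      then have "s1 \<oplus> s2 = z \<otimes> (b1 \<oplus> b2) \<oplus> (v1 \<oplus> v2)"
        unfolding *(3,6) using z(1) by algebra
      moreover have "b1 \<oplus> b2 \<in> pw (n - h)" "v1 \<oplus> v2 \<in> Q"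
        using * QI by (auto intro: ideal_add_mem)
      ultimately show ?case
        by blast
    qed
    have "u = y \<otimes> z \<oplus> (\<ominus> w)"
      using uw(3) cc y z by algebra
    moreover have "\<ominus> w \<in> Q"
      using uw(2) QI by (simp add: additive_subgroup.a_inv_closed ideal.axioms(1))
    moreover have "y \<otimes> z \<in> PIdl z"
      using y by (auto simp: cgenideal_def)
    ultimately have "u \<in> N"
      unfolding N_def by (intro set_add_memI)
    with uw(1) h obtain b v where bv: "b \<in> pw (n - h)" "v \<in> Q" "u = z \<otimes> b \<oplus> v"
      using prod by blast
    have cb: "b \<in> carrier R" "v \<in> carrier R"
      using bv pw_closed ideal.Icarr[OF QI] by auto
    have "z \<otimes> (y \<ominus> b) = v \<oplus> w"
      using uw(3) bv(3) cb cc y z by algebra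
    then have "z \<otimes> (y \<ominus> b) \<in> Q"
      using QI bv uw by (simp add: ideal_add_mem)
    then have "y \<ominus> b \<in> Q"
      using prime_mult_mem[OF Q z(1), of "y \<ominus> b"] z(2) y cb by auto
    moreover have "y = b \<oplus> (y \<ominus> b)"
      using y cb by algebra
    ultimately show ?thesis
      using bv(1) by (intro set_add_memI)
  qed
  then show thesis
    by (rule that)
qed

text \<open>Krull's intersection theorem modulo \<open>Q\<close> and locally at \<open>P\<close>,
  with an exponent independent of \<open>s\<close>: for \<open>n = h + 1\<close>, cancelling
  \<open>z\<close> would leave \<open>s\<close> in \<open>pw 1 <+> Q\<close>, which lies in
  \<open>P\<close>.\<close>

lemma krull_separated:
  assumes Q: "primeideal Q R" and P: "primeideal P R" "Q \<subseteq> P" "pw 1 \<subseteq> P"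
    and z: "z \<in> carrier R" "z \<notin> Q"
  obtains n where "\<And>s. s \<in> carrier R - P \<Longrightarrow> s \<otimes> z \<notin> pw n <+> Q"
proof -
  obtain h where h: "\<And>n y. y \<in> carrier R \<Longrightarrow> z \<otimes> y \<in> pw n <+> Q \<Longrightarrow> y \<in> pw (n - h) <+> Q"
    using colon_pw_prime[OF Q z] by blast
  have "pw 1 <+> Q \<subseteq> P"
    using P by (intro set_add_least) (auto intro: primeideal.axioms)
  then have "s \<otimes> z \<notin> pw (Suc h) <+> Q" if "s \<in> carrier R - P" for s
    using h[of s "Suc h"] that z by (auto simp: m_comm)
  then show thesis
    by (rule that)
qed

end

section \<open>Lengths of saturated ideals\<close>

lemma enat_add_leI:
  assumes "\<And>a b. enat a \<le> x \<Longrightarrow> enat b \<le> y \<Longrightarrow> enat (a + b) \<le> z"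
  shows "x + y \<le> z"
proof (cases z)
  case (enat k)
  obtain a where a: "x = enat a"
    using assms[of "Suc k" 0] enat by (cases x) (auto simp: zero_enat_def[symmetric])
  obtain b where b: "y = enat b"
    using assms[of 0 "Suc k"] enat by (cases y) (auto simp: zero_enat_def[symmetric])
  show ?thesis
    using assms[of a b] a b by simp
qed simp

text \<open>Saturated ideals correspond to the ideals of the localization at \<open>P\<close> of the quotient
  by \<open>p0\<close>, and \<open>cl\<close> to extension followed by contraction.\<close>

locale prime_pair = cring R for R (structure) +
  fixes P p0 :: "'a set"
  assumes P: "primeideal P R" and p0: "primeideal p0 R" and p0_P: "p0 \<subseteq> P"
begin

lemma P_ideal [simp]: "ideal P R" and p0_ideal [simp]: "ideal p0 R"
  using P p0 by (auto intro: primeideal.axioms)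

definition sat :: "'a set \<Rightarrow> bool" where
  "sat J \<longleftrightarrow> ideal J R \<and> p0 \<subseteq> J \<and> (\<forall>s\<in>carrier R - P. \<forall>x\<in>carrier R. s \<otimes> x \<in> J \<longrightarrow> x \<in> J)"

definition cl :: "'a set \<Rightarrow> 'a set" where
  "cl J = {x \<in> carrier R. \<exists>s\<in>carrier R - P. s \<otimes> x \<in> J <+> p0}"

lemma sat_ideal: "sat J \<Longrightarrow> ideal J R"
  by (simp add: sat_def)

lemma sat_cancel: "sat J \<Longrightarrow> s \<in> carrier R - P \<Longrightarrow> x \<in> carrier R \<Longrightarrow> s \<otimes> x \<in> J \<Longrightarrow> x \<in> J"
  by (simp add: sat_def)

lemma mult_notin_P: "s \<in> carrier R - P \<Longrightarrow> t \<in> carrier R - P \<Longrightarrow> s \<otimes> t \<in> carrier R - P"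
  using prime_mult_mem[OF P] by auto

lemma one_notin_P: "\<one> \<in> carrier R - P"
  using prime_one_notin[OF P] by auto

lemma cl_ideal:
  assumes J: "ideal J R"
  shows "ideal (cl J) R"
proof (rule cring_idealI)
  have J': "ideal (J <+> p0) R"
    using J by (intro add_ideals p0_ideal)
  show "\<zero> \<in> cl J"
    using one_notin_P ideal_zero_mem[OF J'] by (auto simp: cl_def)
  show "a \<oplus> b \<in> cl J" if "a \<in> cl J" "b \<in> cl J" for a b
  proof -
    obtain s t where st: "s \<in> carrier R - P" "t \<in> carrier R - P" "s \<otimes> a \<in> J <+> p0" "t \<otimes> b \<in> J <+> p0"
      "a \<in> carrier R" "b \<in> carrier R"
      using \<open>a \<in> cl J\<close> \<open>b \<in> cl J\<close> unfolding cl_def by blast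
    have "(s \<otimes> t) \<otimes> (a \<oplus> b) = t \<otimes> (s \<otimes> a) \<oplus> s \<otimes> (t \<otimes> b)"
      using st(1,2,5,6) unfolding Diff_iff by algebra
    also have "\<dots> \<in> J <+> p0"
      by (rule ideal_add_mem[OF J' ideal_lmult_mem[OF J'] ideal_lmult_mem[OF J']]) (use st in auto)
    finally have "(s \<otimes> t) \<otimes> (a \<oplus> b) \<in> J <+> p0" .
    moreover have "s \<otimes> t \<in> carrier R - P"
      using st by (intro mult_notin_P)
    ultimately show ?thesis
      unfolding cl_def using st(5,6) by blast
  qed
  show "r \<otimes> a \<in> cl J" if "a \<in> cl J" "r \<in> carrier R" for a r
  proof -
    obtain s where s: "s \<in> carrier R - P" "s \<otimes> a \<in> J <+> p0" "a \<in> carrier R"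
      using \<open>a \<in> cl J\<close> unfolding cl_def by blast
    have "s \<otimes> (r \<otimes> a) = r \<otimes> (s \<otimes> a)"
      using s(1,3) that(2) unfolding Diff_iff by algebra
    also have "\<dots> \<in> J <+> p0"
      by (rule ideal_lmult_mem[OF J' s(2) that(2)])
    finally show ?thesis
      unfolding cl_def using s that(2) by blast
  qed
qed (auto simp: cl_def)

lemma cl_superset:
  assumes "ideal J R"
  shows "J \<subseteq> cl J"
proof
  fix x assume "x \<in> J"
  then have "x \<in> carrier R" "x \<in> J <+> p0"
    using assms set_add_left[OF assms p0_ideal] ideal.Icarr[OF assms] by auto
  then show "x \<in> cl J"
    unfolding cl_def using one_notin_P by (intro CollectI conjI bexI[of _ \<one>]) auto
qed

lemma cl_least:
  assumes "sat K" "J \<subseteq> K"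
  shows "cl J \<subseteq> K"
proof
  fix x assume "x \<in> cl J"
  then obtain s where s: "s \<in> carrier R - P" "s \<otimes> x \<in> J <+> p0" "x \<in> carrier R"
    unfolding cl_def by blast
  have "J <+> p0 \<subseteq> K"
    using assms by (intro set_add_least) (auto simp: sat_def)
  with s assms(1) show "x \<in> K"
    by (auto intro: sat_cancel)
qed

lemma sat_cl:
  assumes J: "ideal J R"
  shows "sat (cl J)"
  unfolding sat_def
proof (intro conjI ballI impI)
  show "p0 \<subseteq> cl J"
  proof
    fix x assume "x \<in> p0"
    then have "x \<in> carrier R" "x \<in> J <+> p0"
      using set_add_right[OF J p0_ideal] ideal.Icarr[OF p0_ideal] by auto
    then show "x \<in> cl J"
      unfolding cl_def using one_notin_P by (intro CollectI conjI bexI[of _ \<one>]) auto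
  qed
  fix s x assume s: "s \<in> carrier R - P" and x: "x \<in> carrier R" "s \<otimes> x \<in> cl J"
  then obtain t where t: "t \<in> carrier R - P" "t \<otimes> (s \<otimes> x) \<in> J <+> p0"
    unfolding cl_def by blast
  then have "(t \<otimes> s) \<otimes> x \<in> J <+> p0"
    using s x(1) by (simp add: m_assoc)
  with mult_notin_P[OF t(1) s] x(1) show "x \<in> cl J"
    unfolding cl_def by blast
qed (rule cl_ideal[OF J])

lemma cl_mono: "ideal K R \<Longrightarrow> J \<subseteq> K \<Longrightarrow> cl J \<subseteq> cl K"
  using cl_least[OF sat_cl] cl_superset by blast

lemma sat_carrier: "sat (carrier R)"
  by (auto simp: sat_def oneideal dest: ideal.Icarr[OF p0_ideal])

lemma sat_colon:
  assumes "sat J" "c \<in> carrier R"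
  shows "sat (colon R J c)"
  unfolding sat_def
proof (intro conjI ballI impI)
  show "p0 \<subseteq> colon R J c"
    using assms ideal_lmult_mem[OF p0_ideal] ideal.Icarr[OF p0_ideal] by (auto simp: colon_def sat_def)
  fix s x assume s: "s \<in> carrier R - P" and x: "x \<in> carrier R" "s \<otimes> x \<in> colon R J c"
  have "s \<otimes> (c \<otimes> x) = c \<otimes> (s \<otimes> x)"
    using s x(1) assms(2) unfolding Diff_iff by algebra
  then show "x \<in> colon R J c"
    using s x assms sat_cancel[OF assms(1) s, of "c \<otimes> x"] by (simp add: colon_def)
qed (use assms in \<open>auto intro: colon_ideal sat_ideal\<close>)

lemma sat_Int:
  assumes "sat A" "sat B"
  shows "sat (A \<inter> B)"
  using assms by (auto simp: sat_def intro: i_intersect)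

lemma sat_proper:
  assumes "sat J" "J \<noteq> carrier R"
  shows "J \<subseteq> P"
proof (rule ccontr)
  assume "\<not> J \<subseteq> P"
  then obtain s where "s \<in> J" "s \<notin> P"
    by blast
  then have "\<one> \<in> J"
    using assms(1) sat_cancel[OF assms(1), of s \<one>] ideal.Icarr[OF sat_ideal[OF assms(1)]] by auto
  with assms show False
    using ideal.one_imp_carrier sat_ideal by blast
qed

lemma cl_mult_mem:
  assumes "ideal J R" "ideal K R" "c \<in> carrier R" "\<And>x. x \<in> J \<Longrightarrow> c \<otimes> x \<in> K" "x \<in> cl J"
  shows "c \<otimes> x \<in> cl K"
proof -
  have "J \<subseteq> colon R (cl K) c"
    using assms cl_superset[OF assms(2)] ideal.Icarr[OF assms(1)] by (auto simp: colon_def)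
  then have "cl J \<subseteq> colon R (cl K) c"
    using assms by (intro cl_least sat_colon sat_cl)
  with assms(5) show ?thesis
    by (auto simp: colon_def)
qed

lemma cl_addE:
  assumes "x \<in> cl (A <+> B)"
  obtains s a b w where "s \<in> carrier R - P" "a \<in> A" "b \<in> B" "w \<in> p0" "s \<otimes> x = (a \<oplus> b) \<oplus> w" "x \<in> carrier R"
proof -
  obtain s where s: "s \<in> carrier R - P" "s \<otimes> x \<in> (A <+> B) <+> p0" "x \<in> carrier R"
    using assms unfolding cl_def by blast
  obtain y w where y: "y \<in> A <+> B" "w \<in> p0" "s \<otimes> x = y \<oplus> w"
    using s(2) by (rule set_add_memE)
  obtain a b where ab: "a \<in> A" "b \<in> B" "y = a \<oplus> b"
    using y(1) by (rule set_add_memE)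
  show thesis
    by (rule that[OF s(1) ab(1,2) y(2) y(3)[unfolded ab(3)] s(3)])
qed

text \<open>The modular law up to saturation: a multiple of \<open>x\<close> by an element outside
  \<open>P\<close> splits into parts from \<open>J\<close>, \<open>B\<close> and \<open>p0\<close>,
  and its part from \<open>B\<close> then lies in \<open>J' \<inter> B\<close>.\<close>

lemma sat_modular:
  assumes J: "sat J" and J': "sat J'" and B: "ideal B R" and sub: "J \<subseteq> J'"
    and Int: "J' \<inter> B \<subseteq> J" and add: "J' \<subseteq> cl (J <+> B)"
  shows "J' \<subseteq> J"
proof
  fix x assume x: "x \<in> J'"
  with add have "x \<in> cl (J <+> B)"
    by blast
  then obtain s a b w where *: "s \<in> carrier R - P" "a \<in> J" "b \<in> B" "w \<in> p0" "s \<otimes> x = (a \<oplus> b) \<oplus> w" "x \<in> carrier R"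
    by (rule cl_addE)
  have w: "w \<in> J" "w \<in> carrier R"
    using *(4) J ideal.Icarr[OF p0_ideal] by (auto simp: sat_def)
  have a: "a \<in> carrier R" and b: "b \<in> carrier R"
    using * ideal.Icarr[OF sat_ideal[OF J]] ideal.Icarr[OF B] by auto
  have s: "s \<in> carrier R"
    using *(1) by blast
  have "a \<oplus> w \<in> J'"
    using ideal_add_mem[OF sat_ideal[OF J] *(2) w(1)] sub by blast
  then have "s \<otimes> x \<ominus> (a \<oplus> w) \<in> J'"
    by (rule ideal_diff_mem[OF sat_ideal[OF J'] ideal_lmult_mem[OF sat_ideal[OF J'] x s]])
  moreover have "s \<otimes> x \<ominus> (a \<oplus> w) = b"
    unfolding *(5) using a b w(2) by algebra
  ultimately have "b \<in> J"
    using *(3) Int by auto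
  then have "s \<otimes> x \<in> J"
    unfolding *(5) by (intro ideal_add_mem[OF sat_ideal[OF J]] *(2) w(1))
  then show "x \<in> J"
    by (rule sat_cancel[OF J *(1,6)])
qed

section \<open>Chains of saturated ideals and their lengths\<close>

definition sat_chain :: "'a set \<Rightarrow> 'a set \<Rightarrow> nat \<Rightarrow> (nat \<Rightarrow> 'a set) \<Rightarrow> bool" where
  "sat_chain A B n Q \<longleftrightarrow> (\<forall>i\<le>n. sat (Q i) \<and> A \<subseteq> Q i \<and> Q i \<subseteq> B) \<and> (\<forall>i<n. Q i \<subset> Q (Suc i))"

text \<open>For saturated \<open>A \<subseteq> B\<close> this is the length of \<open>B / A\<close>
  localized at \<open>P\<close>.\<close>

definition len :: "'a set \<Rightarrow> 'a set \<Rightarrow> enat" where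
  "len A B = Sup {enat n |n. \<exists>Q. sat_chain A B n Q}"

lemma len_ge: "sat_chain A B n Q \<Longrightarrow> enat n \<le> len A B"
  unfolding len_def by (rule Sup_upper) blast

lemma sat_chain_shorter: "sat_chain A B n Q \<Longrightarrow> k \<le> n \<Longrightarrow> sat_chain A B k Q"
  by (auto simp: sat_chain_def)

lemma len_geE:
  assumes "enat n \<le> len A B" "sat A" "A \<subseteq> B"
  obtains Q where "sat_chain A B n Q"
proof (cases n)
  case 0
  then have "sat_chain A B n (\<lambda>_. A)"
    using assms by (simp add: sat_chain_def)
  then show thesis by (rule that)
next
  case (Suc k)
  then have "enat k < len A B"
    using assms(1) by (metis Suc_ile_eq)
  then obtain l Q where "sat_chain A B l Q" "k < l"
    unfolding len_def less_Sup_iff by auto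
  then show thesis
    using sat_chain_shorter[of A B l Q n] Suc that by simp
qed

lemma len_leI:
  assumes "\<And>n Q. sat_chain A B n Q \<Longrightarrow> enat n \<le> k"
  shows "len A B \<le> k"
  unfolding len_def by (rule Sup_least) (use assms in blast)

lemma len_mono: "A' \<subseteq> A \<Longrightarrow> B \<subseteq> B' \<Longrightarrow> len A B \<le> len A' B'"
proof (rule len_leI)
  fix n Q assume sub: "A' \<subseteq> A" "B \<subseteq> B'" and Q: "sat_chain A B n Q"
  have "A' \<subseteq> Q i" "Q i \<subseteq> B'" if "i \<le> n" for i
  proof -
    have "A \<subseteq> Q i" "Q i \<subseteq> B"
      using Q that by (auto simp: sat_chain_def)
    with sub show "A' \<subseteq> Q i" "Q i \<subseteq> B'"
      by blast+
  qed
  then have "sat_chain A' B' n Q"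
    using Q by (simp add: sat_chain_def)
  then show "enat n \<le> len A' B'"
    by (rule len_ge)
qed

lemma len_self: "len A A = 0"
proof -
  have "n = 0" if Q: "sat_chain A A n Q" for n Q
  proof (rule ccontr)
    assume "n \<noteq> 0"
    then have "Q 0 \<subset> Q (Suc 0)" "A \<subseteq> Q 0" "Q (Suc 0) \<subseteq> A"
      using Q by (auto simp: sat_chain_def)
    then show False
      by blast
  qed
  then have "len A A \<le> 0"
    by (intro len_leI) (auto simp: zero_enat_def)
  then show ?thesis
    by simp
qed

text \<open>Takes the place of exact sequences: a strictly monotone assignment between saturated
  ideals carries chains to chains of the same length.\<close>

lemma len_image:
  assumes sat: "\<And>J. sat J \<Longrightarrow> A \<subseteq> J \<Longrightarrow> J \<subseteq> B \<Longrightarrow> sat (\<phi> J) \<and> A' \<subseteq> \<phi> J \<and> \<phi> J \<subseteq> B'"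
    and mono: "\<And>J K. sat J \<Longrightarrow> sat K \<Longrightarrow> A \<subseteq> J \<Longrightarrow> J \<subset> K \<Longrightarrow> K \<subseteq> B \<Longrightarrow> \<phi> J \<subset> \<phi> K"
  shows "len A B \<le> len A' B'"
proof (rule len_leI)
  fix n Q assume Q: "sat_chain A B n Q"
  then have "sat_chain A' B' n (\<lambda>i. \<phi> (Q i))"
    unfolding sat_chain_def by (intro conjI allI impI sat[THEN conjunct1] sat[THEN conjunct2, THEN conjunct1]
      sat[THEN conjunct2, THEN conjunct2] mono) auto
  then show "enat n \<le> len A' B'"
    by (rule len_ge)
qed

lemma len_superadd:
  assumes "sat A" "sat K" "A \<subseteq> K" "K \<subseteq> B"
  shows "len A K + len K B \<le> len A B"
proof (rule enat_add_leI)
  fix a b assume "enat a \<le> len A K" "enat b \<le> len K B"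
  then obtain Q Q' where Q: "sat_chain A K a Q" and Q': "sat_chain K B b Q'"
    using assms by (metis len_geE)
  define S where "S i = (if i \<le> a then Q i else Q' (i - a))" for i
  have "S i \<subset> S (Suc i)" if "i < a + b" for i
  proof (cases i a rule: linorder_cases)
    case less
    then show ?thesis
      using Q by (auto simp: S_def sat_chain_def)
  next
    case equal
    then have "S i \<subseteq> K" "K \<subseteq> Q' 0" "Q' 0 \<subset> Q' 1"
      using Q Q' that by (auto simp: S_def sat_chain_def)
    moreover have "S (Suc i) = Q' 1"
      using equal by (simp add: S_def)
    ultimately show ?thesis
      by blast
  next
    case greater
    then show ?thesis
      using Q' that by (auto simp: S_def sat_chain_def Suc_diff_le)
  qed
  moreover have "sat (S i) \<and> A \<subseteq> S i \<and> S i \<subseteq> B" if "i \<le> a + b" for i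
  proof (cases "i \<le> a")
    case True
    then have "sat (Q i) \<and> A \<subseteq> Q i \<and> Q i \<subseteq> K"
      using Q by (simp add: sat_chain_def)
    with True assms(4) show ?thesis
      by (auto simp: S_def)
  next
    case False
    then have "sat (Q' (i - a)) \<and> K \<subseteq> Q' (i - a) \<and> Q' (i - a) \<subseteq> B"
      using Q' that by (simp add: sat_chain_def)
    with False assms(3) show ?thesis
      by (auto simp: S_def)
  qed
  ultimately have "sat_chain A B (a + b) S"
    by (simp add: sat_chain_def)
  then show "enat (a + b) \<le> len A B"
    by (rule len_ge)
qed

lemma len_weak_chain:
  assumes "\<And>i. i \<le> n \<Longrightarrow> sat (Z i)" "\<And>i. i < n \<Longrightarrow> Z i \<subseteq> Z (Suc i)" "A \<subseteq> Z 0" "Z n \<subseteq> B"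
  shows "enat (card {i. i < n \<and> Z i \<noteq> Z (Suc i)}) \<le> len A B"
proof -
  have "\<exists>Q. sat_chain A (Z k) (card {i. i < k \<and> Z i \<noteq> Z (Suc i)}) Q" if "k \<le> n" for k
    using that
  proof (induction k)
    case 0
    then have "sat_chain A (Z 0) 0 (\<lambda>_. Z 0)"
      using assms by (simp add: sat_chain_def)
    then show ?case by auto
  next
    case (Suc k)
    define c where "c = card {i. i < k \<and> Z i \<noteq> Z (Suc i)}"
    obtain Q where Q: "sat_chain A (Z k) c Q"
      using Suc by (auto simp: c_def)
    have step: "Z k \<subseteq> Z (Suc k)"
      using assms(2) Suc.prems by simp
    show ?case
    proof (cases "Z k = Z (Suc k)")
      case True
      then have "{i. i < Suc k \<and> Z i \<noteq> Z (Suc i)} = {i. i < k \<and> Z i \<noteq> Z (Suc i)}"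
        by (auto simp: less_Suc_eq)
      with Q True show ?thesis
        by (auto simp: c_def)
    next
      case False
      then have "{i. i < Suc k \<and> Z i \<noteq> Z (Suc i)} = insert k {i. i < k \<and> Z i \<noteq> Z (Suc i)}"
        by (auto simp: less_Suc_eq)
      then have "card {i. i < Suc k \<and> Z i \<noteq> Z (Suc i)} = Suc c"
        by (simp add: c_def)
      moreover have "sat_chain A (Z (Suc k)) (Suc c) (Q(Suc c := Z (Suc k)))"
        unfolding sat_chain_def
      proof (intro conjI allI impI)
        have Q0: "A \<subseteq> Q c" "Q c \<subseteq> Z k"
          using Q by (auto simp: sat_chain_def)
        fix i
        show "(Q(Suc c := Z (Suc k))) i \<subset> (Q(Suc c := Z (Suc k))) (Suc i)" if "i < Suc c"
          using that Q Q0 step False by (cases "i = c") (auto simp: sat_chain_def)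
        assume i: "i \<le> Suc c"
        show "sat ((Q(Suc c := Z (Suc k))) i)"
          using i Q assms(1)[of "Suc k"] Suc.prems by (cases "i = Suc c") (auto simp: sat_chain_def)
        show "A \<subseteq> (Q(Suc c := Z (Suc k))) i"
          using i Q Q0 step by (cases "i = Suc c") (auto simp: sat_chain_def)
        show "(Q(Suc c := Z (Suc k))) i \<subseteq> Z (Suc k)"
        proof (cases "i = Suc c")
          case False
          then have "Q i \<subseteq> Z k"
            using i Q by (simp add: sat_chain_def)
          with step False show ?thesis
            by simp
        qed simp
      qed
      ultimately show ?thesis
        by auto
    qed
  qed
  then obtain Q where "sat_chain A (Z n) (card {i. i < n \<and> Z i \<noteq> Z (Suc i)}) Q"
    by blast
  then have "enat (card {i. i < n \<and> Z i \<noteq> Z (Suc i)}) \<le> len A (Z n)"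
    by (rule len_ge)
  also have "\<dots> \<le> len A B"
    by (rule len_mono[OF subset_refl assms(4)])
  finally show ?thesis .
qed

text \<open>By the modular law, a strict step of a chain stays strict after intersecting with
  \<open>K\<close> or after adding \<open>K\<close> and saturating. The bound counts the strict
  steps of the two resulting chains.\<close>

lemma len_subadd:
  assumes "sat A" "sat K" "sat B" "A \<subseteq> K" "K \<subseteq> B"
  shows "len A B \<le> len A K + len K B"
proof (rule len_leI)
  fix n Q assume Q: "sat_chain A B n Q"
  let ?X = "\<lambda>i. Q i \<inter> K" and ?Y = "\<lambda>i. cl (Q i <+> K)"
  have satQ: "sat (Q i)" "A \<subseteq> Q i" "Q i \<subseteq> B" if "i \<le> n" for i
    using Q that by (auto simp: sat_chain_def)
  have idl: "ideal (Q i <+> K) R" if "i \<le> n" for i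
    using satQ[OF that] assms(2) by (intro add_ideals sat_ideal)
  have step: "Q i \<subset> Q (Suc i)" if "i < n" for i
    using Q that by (auto simp: sat_chain_def)
  have neq: "?X i \<noteq> ?X (Suc i) \<or> ?Y i \<noteq> ?Y (Suc i)" if "i < n" for i
  proof (rule ccontr)
    assume "\<not> ?thesis"
    then have eq: "?X i = ?X (Suc i)" "?Y i = ?Y (Suc i)"
      by auto
    have "Q (Suc i) \<subseteq> ?Y (Suc i)"
      using cl_superset[OF idl[of "Suc i"]] set_add_left[OF sat_ideal[OF satQ(1)] sat_ideal[OF assms(2)], of "Suc i"] that
      by auto
    then have "Q (Suc i) \<subseteq> Q i"
      using eq satQ(1) that step[OF that] assms(2) by (intro sat_modular[of "Q i" "Q (Suc i)" K]) (auto intro: sat_ideal)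
    with step[OF that] show False
      by blast
  qed
  let ?D = "\<lambda>Z. {i. i < n \<and> Z i \<noteq> Z (Suc i)}"
  have "{..<n} \<subseteq> ?D ?X \<union> ?D ?Y"
    using neq by auto
  then have "card {..<n} \<le> card (?D ?X \<union> ?D ?Y)"
    by (intro card_mono) auto
  also have "\<dots> \<le> card (?D ?X) + card (?D ?Y)"
    by (rule card_Un_le)
  finally have "enat n \<le> enat (card (?D ?X)) + enat (card (?D ?Y))"
    by simp
  also have "\<dots> \<le> len A K + len K B"
  proof (rule add_mono)
    show "enat (card (?D ?X)) \<le> len A K"
    proof (rule len_weak_chain)
      show "?X i \<subseteq> ?X (Suc i)" if "i < n" for i
        using step[OF that] by blast
    qed (use satQ assms in \<open>auto intro: sat_Int\<close>)
    show "enat (card (?D ?Y)) \<le> len K B"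
    proof (rule len_weak_chain)
      show "sat (?Y i)" if "i \<le> n" for i
        using idl[OF that] by (rule sat_cl)
      show "?Y i \<subseteq> ?Y (Suc i)" if "i < n" for i
        using step[OF that] that by (intro cl_mono idl set_add_mono) auto
      show "K \<subseteq> ?Y 0"
        using cl_superset[OF idl[of 0]] set_add_right[OF sat_ideal[OF satQ(1)] sat_ideal[OF assms(2)], of 0]
        by auto
      show "?Y n \<subseteq> B"
        using satQ(3)[of n] assms by (intro cl_least set_add_least sat_ideal) auto
    qed
  qed
  finally show "enat n \<le> len A K + len K B" .
qed

lemma mult_image_ideal:
  assumes "ideal J R" "z \<in> carrier R"
  shows "ideal ((\<otimes>) z ` J) R"
proof (rule cring_idealI)
  show "(\<otimes>) z ` J \<subseteq> carrier R"
    using assms ideal.Icarr[OF assms(1)] by auto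
  show "\<zero> \<in> (\<otimes>) z ` J"
    using assms ideal_zero_mem[OF assms(1)] by (intro image_eqI[of _ _ \<zero>]) auto
next
  fix a b assume "a \<in> (\<otimes>) z ` J" "b \<in> (\<otimes>) z ` J"
  then obtain x y where xy: "x \<in> J" "y \<in> J" "a = z \<otimes> x" "b = z \<otimes> y"
    by blast
  then have "a \<oplus> b = z \<otimes> (x \<oplus> y)"
    using assms(2) ideal.Icarr[OF assms(1)] by (simp add: r_distr)
  then show "a \<oplus> b \<in> (\<otimes>) z ` J"
    using xy assms(1) by (auto intro: ideal_add_mem)
next
  fix a r assume "a \<in> (\<otimes>) z ` J" "r \<in> carrier R"
  then obtain x where x: "x \<in> J" "a = z \<otimes> x"
    by blast
  then have "r \<otimes> a = z \<otimes> (r \<otimes> x)"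
    using assms(2) \<open>r \<in> carrier R\<close> ideal.Icarr[OF assms(1)] by (simp add: m_lcomm)
  then show "r \<otimes> a \<in> (\<otimes>) z ` J"
    using x \<open>r \<in> carrier R\<close> assms(1) by (auto intro: ideal_lmult_mem)
qed

text \<open>Sending \<open>J\<close> to the saturation of \<open>z J + B\<close> is strictly
  monotone above \<open>A\<close>: if \<open>z \<otimes> x\<close> lies in it, then a multiple of
  \<open>x\<close> by an element outside \<open>P\<close> differs from an element of
  \<open>J\<close> by one of \<open>colon R B z\<close>, hence lies in \<open>J\<close>.\<close>

lemma len_le_mult:
  assumes A: "sat A" and B: "sat B" and K: "ideal K R" and z: "z \<in> carrier R" and sub: "colon R B z \<subseteq> A"
  shows "len A K \<le> len B (cl ((\<otimes>) z ` K <+> B))"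
proof (rule len_image)
  have idl: "ideal ((\<otimes>) z ` J <+> B) R" if "ideal J R" for J
    by (rule add_ideals[OF mult_image_ideal[OF that z] sat_ideal[OF B]])
  show "sat (cl ((\<otimes>) z ` J <+> B)) \<and> B \<subseteq> cl ((\<otimes>) z ` J <+> B) \<and>
      cl ((\<otimes>) z ` J <+> B) \<subseteq> cl ((\<otimes>) z ` K <+> B)" if "sat J" "A \<subseteq> J" "J \<subseteq> K" for J
  proof (intro conjI)
    have J: "ideal J R"
      using that by (intro sat_ideal)
    show "sat (cl ((\<otimes>) z ` J <+> B))"
      by (rule sat_cl[OF idl[OF J]])
    show "B \<subseteq> cl ((\<otimes>) z ` J <+> B)"
      using cl_superset[OF idl[OF J]] set_add_right[OF mult_image_ideal[OF J z] sat_ideal[OF B]] by blast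
    show "cl ((\<otimes>) z ` J <+> B) \<subseteq> cl ((\<otimes>) z ` K <+> B)"
      using that by (intro cl_mono idl K set_add_mono image_mono) auto
  qed
  fix J J' assume J: "sat J" and J': "sat J'" and AJ: "A \<subseteq> J" and JJ': "J \<subset> J'"
  have "J' \<subseteq> J" if le: "cl ((\<otimes>) z ` J' <+> B) \<subseteq> cl ((\<otimes>) z ` J <+> B)"
  proof
    fix x assume x: "x \<in> J'"
    have "z \<otimes> x \<in> cl ((\<otimes>) z ` J' <+> B)"
      using x cl_superset[OF idl[OF sat_ideal[OF J']]]
        set_add_left[OF mult_image_ideal[OF sat_ideal[OF J'] z] sat_ideal[OF B]] by blast
    then have "z \<otimes> x \<in> cl ((\<otimes>) z ` J <+> B)"
      using le by blast
    then obtain s j b w where *: "s \<in> carrier R - P" "j \<in> J" "b \<in> B" "w \<in> p0"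
        "s \<otimes> (z \<otimes> x) = (z \<otimes> j \<oplus> b) \<oplus> w"
      by (elim cl_addE) blast
    have w: "w \<in> B"
      using *(4) B by (auto simp: sat_def)
    have c: "x \<in> carrier R" "j \<in> carrier R" "b \<in> carrier R" "w \<in> carrier R" "s \<in> carrier R"
      using x * w ideal.Icarr[OF sat_ideal[OF J']] ideal.Icarr[OF sat_ideal[OF J]] ideal.Icarr[OF sat_ideal[OF B]]
      by auto
    have "z \<otimes> (s \<otimes> x \<ominus> j) = s \<otimes> (z \<otimes> x) \<ominus> z \<otimes> j"
      using c z by algebra
    also have "\<dots> = b \<oplus> w"
      unfolding *(5) using c z by algebra
    also have "\<dots> \<in> B"
      using *(3) w sat_ideal[OF B] by (intro ideal_add_mem)
    finally have "s \<otimes> x \<ominus> j \<in> colon R B z"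
      using c by (simp add: colon_def)
    then have "s \<otimes> x \<ominus> j \<in> J"
      using sub AJ by blast
    then have "(s \<otimes> x \<ominus> j) \<oplus> j \<in> J"
      using *(2) sat_ideal[OF J] by (intro ideal_add_mem)
    moreover have "(s \<otimes> x \<ominus> j) \<oplus> j = s \<otimes> x"
      using c by algebra
    ultimately show "x \<in> J"
      using sat_cancel[OF J *(1) c(1)] by simp
  qed
  moreover have "cl ((\<otimes>) z ` J <+> B) \<subseteq> cl ((\<otimes>) z ` J' <+> B)"
    using JJ' by (intro cl_mono idl sat_ideal[OF J'] set_add_mono image_mono) auto
  ultimately show "cl ((\<otimes>) z ` J <+> B) \<subset> cl ((\<otimes>) z ` J' <+> B)"
    using JJ' by blast
qed

text \<open>In terms of modules, \<open>(z R + B) / B\<close> is \<open>R / (B : z)\<close>. The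
  inequality comes from \<open>J \<mapsto> colon R J z\<close>, which is strictly monotone on
  saturated ideals inside the saturation of \<open>z R + B\<close>.\<close>

lemma len_add_principal:
  assumes B: "sat B" and z: "z \<in> carrier R"
  shows "len B (cl (PIdl z <+> B)) \<le> len (colon R B z) (carrier R)"
proof (rule len_image)
  show "sat (colon R J z) \<and> colon R B z \<subseteq> colon R J z \<and> colon R J z \<subseteq> carrier R"
    if "sat J" "B \<subseteq> J" for J
    using that z by (auto simp: sat_colon) (auto simp: colon_def)
  fix J J' assume J: "sat J" and J': "sat J'" and BJ: "B \<subseteq> J" and JJ': "J \<subset> J'"
    and le: "J' \<subseteq> cl (PIdl z <+> B)"
  have "J' \<subseteq> J" if sub: "colon R J' z \<subseteq> colon R J z"
  proof
    fix x assume x: "x \<in> J'"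
    then have "x \<in> cl (PIdl z <+> B)"
      using le by blast
    then obtain s a b w where *: "s \<in> carrier R - P" "a \<in> PIdl z" "b \<in> B" "w \<in> p0" "s \<otimes> x = (a \<oplus> b) \<oplus> w" "x \<in> carrier R"
      by (rule cl_addE)
    obtain r where r: "r \<in> carrier R" "a = r \<otimes> z"
      using *(2) by (rule PIdl_memE)
    have w: "w \<in> B"
      using *(4) B by (auto simp: sat_def)
    have c: "b \<in> carrier R" "w \<in> carrier R" "s \<in> carrier R"
      using * w ideal.Icarr[OF sat_ideal[OF B]] by auto
    have bw: "b \<oplus> w \<in> J"
      using *(3) w BJ sat_ideal[OF J] by (auto intro: ideal_add_mem)
    have "z \<otimes> r = s \<otimes> x \<ominus> (b \<oplus> w)"
      unfolding *(5) r(2) using c r(1) z by algebra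
    also have "\<dots> \<in> J'"
      using x bw JJ' c sat_ideal[OF J'] by (intro ideal_diff_mem ideal_lmult_mem) auto
    finally have "r \<in> colon R J' z"
      using r(1) by (simp add: colon_def)
    then have "z \<otimes> r \<in> J"
      using sub by (auto simp: colon_def)
    then have "z \<otimes> r \<oplus> (b \<oplus> w) \<in> J"
      by (rule ideal_add_mem[OF sat_ideal[OF J] _ bw])
    moreover have "z \<otimes> r \<oplus> (b \<oplus> w) = s \<otimes> x"
      unfolding *(5) r(2) using c r(1) z by algebra
    ultimately show "x \<in> J"
      using sat_cancel[OF J *(1,6)] by simp
  qed
  moreover have "colon R J z \<subseteq> colon R J' z"
    using JJ' by (auto simp: colon_def)
  ultimately show "colon R J z \<subset> colon R J' z"
    using JJ' by blast
qed

lemma colon_mono: "B \<subseteq> C \<Longrightarrow> colon R B z \<subseteq> colon R C z"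
  by (auto simp: colon_def)

text \<open>The generators are added one at a time. Each adds a cyclic quotient annihilated by
  \<open>N\<close>, of length at most that of \<open>R / N\<close>.\<close>

lemma len_add_generators:
  assumes B: "sat B" and z: "\<And>i. i < k \<Longrightarrow> z i \<in> carrier R" and N: "\<And>i. i < k \<Longrightarrow> N \<subseteq> colon R B (z i)"
  shows "len B (cl (Idl (z ` {..<k}) <+> B)) \<le> enat k * len N (carrier R)"
  using z N
proof (induction k)
  case 0
  have "len B (cl (Idl (z ` {..<0}) <+> B)) \<le> len B B"
    using B sat_ideal[OF B] by (intro len_mono cl_least set_add_least genideal_minimal) auto
  then show ?case
    by (simp add: len_self)
next
  case (Suc k)
  let ?C = "\<lambda>k. cl (Idl (z ` {..<k}) <+> B)"
  have idl: "ideal (Idl (z ` {..<j})) R" if "j \<le> Suc k" for j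
    using that Suc.prems(1) by (intro genideal_ideal) auto
  have add: "ideal (Idl (z ` {..<j}) <+> B) R" if "j \<le> Suc k" for j
    using that B by (intro add_ideals idl sat_ideal)
  have satC: "sat (?C j)" if "j \<le> Suc k" for j
    using add[OF that] by (rule sat_cl)
  have BC: "B \<subseteq> ?C j" if "j \<le> Suc k" for j
    using cl_superset[OF add[OF that]] set_add_right[OF idl[OF that] sat_ideal[OF B]] by blast
  have zk: "z k \<in> carrier R"
    using Suc.prems(1) by simp
  have C_mono: "?C k \<subseteq> ?C (Suc k)"
    using Suc.prems(1) by (intro cl_mono add set_add_mono subset_Idl_subset) auto
  have p: "ideal (PIdl (z k) <+> ?C k) R"
    using satC[of k] zk by (intro add_ideals cgenideal_ideal sat_ideal) auto
  have "Idl (z ` {..<Suc k}) \<subseteq> cl (PIdl (z k) <+> ?C k)"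
  proof (rule genideal_minimal[OF cl_ideal[OF p]])
    have "z k \<in> PIdl (z k) <+> ?C k"
      using set_add_left[OF cgenideal_ideal[OF zk] sat_ideal[OF satC[of k]]] cgenideal_self[OF zk] by auto
    moreover have "z i \<in> PIdl (z k) <+> ?C k" if "i < k" for i
    proof -
      have "z i \<in> Idl (z ` {..<k})"
        using that Suc.prems(1) by (intro genideal_mem) auto
      then have "z i \<in> ?C k"
        using cl_superset[OF add[of k]] set_add_left[OF idl[of k] sat_ideal[OF B]] by auto
      then show ?thesis
        using set_add_right[OF cgenideal_ideal[OF zk] sat_ideal[OF satC[of k]]] by auto
    qed
    ultimately have "z ` {..<Suc k} \<subseteq> PIdl (z k) <+> ?C k"
      by (auto simp: less_Suc_eq)
    then show "z ` {..<Suc k} \<subseteq> cl (PIdl (z k) <+> ?C k)"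
      using cl_superset[OF p] by (rule subset_trans)
  qed
  moreover have "B \<subseteq> cl (PIdl (z k) <+> ?C k)"
    using BC[of k] cl_superset[OF p] set_add_right[OF cgenideal_ideal[OF zk] sat_ideal[OF satC[of k]]] by auto
  ultimately have le: "?C (Suc k) \<subseteq> cl (PIdl (z k) <+> ?C k)"
    using sat_cl[OF p] by (intro cl_least set_add_least sat_ideal)
  have "len B (?C (Suc k)) \<le> len B (?C k) + len (?C k) (?C (Suc k))"
    using B satC BC C_mono by (intro len_subadd) auto
  also have "\<dots> \<le> enat k * len N (carrier R) + len N (carrier R)"
  proof (rule add_mono)
    show "len B (?C k) \<le> enat k * len N (carrier R)"
      using Suc.prems by (intro Suc.IH) auto
    have "len (?C k) (?C (Suc k)) \<le> len (?C k) (cl (PIdl (z k) <+> ?C k))"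
      using le by (intro len_mono) auto
    also have "\<dots> \<le> len (colon R (?C k) (z k)) (carrier R)"
      using satC[of k] zk by (intro len_add_principal) auto
    also have "\<dots> \<le> len N (carrier R)"
      using Suc.prems(2)[of k] colon_mono[OF BC[of k], of "z k"] by (intro len_mono) auto
    finally show "len (?C k) (?C (Suc k)) \<le> len N (carrier R)" .
  qed
  also have "\<dots> = enat (Suc k) * len N (carrier R)"
    by (simp add: eSuc_enat[symmetric] mult_eSuc add.commute)
  finally show ?case .
qed

end

locale noetherian_prime_pair = prime_pair R P p0 + noetherian_ring R for R (structure) and P and p0
begin

text \<open>Noetherian induction: a maximal \<open>J\<close> of infinite length is not prime, so
  \<open>a \<otimes> b \<in> J\<close> with neither factor in \<open>J\<close>. Then
  \<open>J + a R\<close> and \<open>(J : a)\<close>, saturated, are strictly larger, so their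
  quotients have finite length, and the two lengths together bound that of
  \<open>R / J\<close>.\<close>

lemma len_finite:
  assumes I: "I \<subseteq> P" and minimal: "\<And>Q. primeideal Q R \<Longrightarrow> I \<subseteq> Q \<Longrightarrow> Q \<subseteq> P \<Longrightarrow> Q = P"
    and "sat J" "I \<subseteq> J"
  shows "len J (carrier R) \<noteq> \<infinity>"
proof (rule ccontr)
  assume inf: "\<not> len J (carrier R) \<noteq> \<infinity>"
  define F where "F = {J. sat J \<and> I \<subseteq> J \<and> len J (carrier R) = \<infinity>}"
  have "J \<in> F"
    using inf assms(3,4) by (simp add: F_def)
  have F_ideal: "ideal K R" if "K \<in> F" for K
    using that by (auto simp: F_def intro: sat_ideal)
  have "F \<noteq> {}"
    using \<open>J \<in> F\<close> by (metis empty_iff)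
  from exists_maximal_ideal_in[OF this F_ideal]
  obtain J where J: "J \<in> F" "\<And>K. K \<in> F \<Longrightarrow> J \<subseteq> K \<Longrightarrow> K = J"
    by metis
  then have satJ: "sat J" and IJ: "I \<subseteq> J" and inf: "len J (carrier R) = \<infinity>"
    by (auto simp: F_def)
  have fin: "len K (carrier R) \<noteq> \<infinity>" if "sat K" "J \<subset> K" for K
  proof
    assume "len K (carrier R) = \<infinity>"
    then have "K \<in> F"
      using that IJ by (auto simp: F_def)
    with J(2)[of K] that(2) show False
      by blast
  qed
  \<comment> \<open>Two strict steps put a proper saturated ideal strictly above \<open>J\<close>.
    Proper saturated ideals lie in \<open>P\<close>, so \<open>J \<subset> P\<close>, and minimality
    of \<open>P\<close> prevents \<open>J\<close> from being prime.\<close>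
  have ge2: "\<exists>Q. sat_chain J (carrier R) 2 Q"
  proof -
    have "enat 2 \<le> len J (carrier R)" "J \<subseteq> carrier R"
      using inf ideal_subset_carrier[OF sat_ideal[OF satJ]] by auto
    then obtain Q where "sat_chain J (carrier R) 2 Q"
      using satJ by (elim len_geE)
    then show ?thesis
      by blast
  qed
  then obtain Q where "sat_chain J (carrier R) 2 Q"
    by blast
  then have Q: "sat (Q 0)" "sat (Q 1)" "J \<subseteq> Q 0" "Q 0 \<subset> Q 1" "Q 1 \<subset> Q 2" "Q 2 \<subseteq> carrier R"
    by (auto simp: sat_chain_def numeral_2_eq_2)
  then have "Q 1 \<subseteq> P"
    by (intro sat_proper) auto
  then have JP: "J \<subset> P"
    using Q by blast
  have "\<not> primeideal J R"
    using minimal[of J] IJ JP by blast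
  moreover have "carrier R \<noteq> J"
    using JP primeideal.I_notcarr[OF P] ideal_subset_carrier[OF P_ideal] by auto
  ultimately obtain a b where ab: "a \<in> carrier R" "b \<in> carrier R" "a \<otimes> b \<in> J" "a \<notin> J" "b \<notin> J"
    using ideal.primeidealCE[OF sat_ideal[OF satJ] cring_axioms] by metis
  let ?K = "cl (PIdl a <+> J)"
  have p: "ideal (PIdl a <+> J) R"
    using ab satJ by (intro add_ideals cgenideal_ideal sat_ideal)
  have satK: "sat ?K"
    using p by (rule sat_cl)
  have JK: "J \<subseteq> ?K"
    using cl_superset[OF p] set_add_right[OF cgenideal_ideal[OF ab(1)] sat_ideal[OF satJ]] by blast
  have "a \<in> ?K"
    using cl_superset[OF p] set_add_left[OF cgenideal_ideal[OF ab(1)] sat_ideal[OF satJ]] cgenideal_self[OF ab(1)]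
    by blast
  then have "len ?K (carrier R) \<noteq> \<infinity>"
    using JK ab(4) satK by (intro fin) auto
  moreover have "len J ?K \<noteq> \<infinity>"
  proof -
    have "J \<subseteq> colon R J a"
      using ab(1) ideal.Icarr[OF sat_ideal[OF satJ]] ideal_lmult_mem[OF sat_ideal[OF satJ]] by (auto simp: colon_def)
    moreover have "b \<in> colon R J a"
      using ab by (simp add: colon_def)
    ultimately have "len (colon R J a) (carrier R) \<noteq> \<infinity>"
      using ab satJ by (intro fin sat_colon) auto
    with len_add_principal[OF satJ ab(1)] show ?thesis
      by (metis enat_ord_simps(5))
  qed
  moreover have "len J (carrier R) \<le> len J ?K + len ?K (carrier R)"
    using satJ satK JK ideal_subset_carrier[OF sat_ideal[OF satK]] by (intro len_subadd sat_carrier)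
  ultimately show False
    using inf by (auto simp: plus_eq_infty_iff_enat)
qed

end

section \<open>Growth of the powers of an ideal\<close>

locale ideal_prime_pair = noetherian_generated_ideal R g m + noetherian_prime_pair R P p0
  for R (structure) and g m and P and p0 +
  assumes pw_1_subset_P: "pw 1 \<subseteq> P"
    and P_minimal: "primeideal Q R \<Longrightarrow> pw 1 \<subseteq> Q \<Longrightarrow> Q \<subseteq> P \<Longrightarrow> Q = P"
begin

section \<open>Standard monomials and the lengths between successive powers\<close>

definition level :: "nat \<Rightarrow> 'a set" where
  "level n = cl (pw n)"

lemma sat_level [simp]: "sat (level n)"
  unfolding level_def by (rule sat_cl[OF pw_ideal])

lemma level_ideal [simp]: "ideal (level n) R"
  by (rule sat_ideal[OF sat_level])

lemma pw_subset_level: "pw n \<subseteq> level n"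
  unfolding level_def by (rule cl_superset[OF pw_ideal])

lemma level_antimono: "a \<le> b \<Longrightarrow> level b \<subseteq> level a"
  unfolding level_def by (intro cl_mono pw_ideal pw_antimono)

lemma level_subset_carrier: "level n \<subseteq> carrier R"
  by (rule ideal_subset_carrier[OF level_ideal])

lemma level_0: "level 0 = carrier R"
  using pw_subset_level[of 0] level_subset_carrier[of 0] by auto

text \<open>As \<open>T\<close> grows through the initial segments of \<open>E n\<close>, this
  climbs from \<open>level (Suc n)\<close> to \<open>level n\<close> one monomial at a time.\<close>

definition stair :: "(nat \<Rightarrow> nat) set \<Rightarrow> nat \<Rightarrow> 'a set" where
  "stair T n = cl (Idl (mon ` T) <+> pw (Suc n))"

lemma stair_sum_ideal: "ideal (Idl (mon ` T) <+> pw (Suc n)) R"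
  by (intro add_ideals span_lower_ideal pw_ideal)

lemma sat_stair [simp]: "sat (stair T n)"
  unfolding stair_def by (rule sat_cl[OF stair_sum_ideal])

lemma stair_ideal: "ideal (stair T n) R"
  by (rule sat_ideal[OF sat_stair])

lemma level_subset_stair: "level (Suc n) \<subseteq> stair T n"
  unfolding level_def stair_def
  by (intro cl_mono stair_sum_ideal set_add_right span_lower_ideal pw_ideal)

lemma mon_in_stair: "\<alpha> \<in> T \<Longrightarrow> mon \<alpha> \<in> stair T n"
proof -
  assume "\<alpha> \<in> T"
  then have "mon \<alpha> \<in> Idl (mon ` T)"
    by (intro genideal_mem) auto
  then have "mon \<alpha> \<in> Idl (mon ` T) <+> pw (Suc n)"
    using set_add_left[OF span_lower_ideal pw_ideal] by blast
  then show ?thesis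
    unfolding stair_def using cl_superset[OF stair_sum_ideal] by blast
qed

lemma stair_least:
  assumes "sat J" "level (Suc n) \<subseteq> J" "\<And>\<alpha>. \<alpha> \<in> T \<Longrightarrow> mon \<alpha> \<in> J"
  shows "stair T n \<subseteq> J"
  unfolding stair_def using assms pw_subset_level[of "Suc n"]
  by (intro cl_least set_add_least genideal_minimal sat_ideal) auto

lemma stair_mono: "S \<subseteq> T \<Longrightarrow> stair S n \<subseteq> stair T n"
  by (rule stair_least[OF sat_stair level_subset_stair]) (auto intro: mon_in_stair)

lemma stair_full: "stair (E n) n = level n"
proof
  show "stair (E n) n \<subseteq> level n"
    using mon_in_pw pw_subset_level by (intro stair_least level_antimono sat_level) auto
  show "level n \<subseteq> stair (E n) n"
    unfolding level_def using mon_in_stair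
    by (intro cl_least sat_stair) (simp add: pw_subset_iff stair_ideal)
qed

lemma stair_empty: "stair {} n = level (Suc n)"
  by (intro equalityI level_subset_stair stair_least sat_level) auto

text \<open>A monomial is standard if, locally at \<open>P\<close> and modulo \<open>p0\<close>, it is not congruent modulo
  \<open>pw (Suc n)\<close> to a combination of smaller monomials of its degree \<open>n\<close>.\<close>

definition std :: "(nat \<Rightarrow> nat) \<Rightarrow> bool" where
  "std \<alpha> \<longleftrightarrow> mon \<alpha> \<notin> stair (lower \<alpha>) (sum \<alpha> {..<m})"

text \<open>Multiplying a relation for the smaller monomial by
  \<open>mon (\<beta> - \<alpha>)\<close> gives one for the larger.\<close>

lemma std_down_closed:
  assumes \<beta>: "\<beta> \<in> multi_indices m" "std \<beta>" and le: "\<alpha> \<le> \<beta>"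
  shows "std \<alpha>"
  unfolding std_def
proof
  let ?\<gamma> = "\<beta> - \<alpha>"
  assume std: "mon \<alpha> \<in> stair (lower \<alpha>) (sum \<alpha> {..<m})"
  have mi: "\<alpha> \<in> multi_indices m" "?\<gamma> \<in> multi_indices m"
    using \<beta>(1) le by (auto simp: multi_indices_def le_fun_def) (metis le_zero_eq)
  have sum: "\<alpha> + ?\<gamma> = \<beta>"
    using le by (rule multi_indices_add_diff)
  have "sum (\<alpha> + ?\<gamma>) {..<m} = sum \<alpha> {..<m} + sum ?\<gamma> {..<m}"
    unfolding plus_fun_apply by (rule sum.distrib)
  then have deg: "sum \<beta> {..<m} = sum \<alpha> {..<m} + sum ?\<gamma> {..<m}"
    by (simp only: sum)
  have "mon ?\<gamma> \<otimes> mon \<alpha> \<in> stair (lower \<beta>) (sum \<beta> {..<m})"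
    unfolding stair_def
  proof (rule cl_mult_mem[OF stair_sum_ideal stair_sum_ideal mon_closed _ std[unfolded stair_def]])
    fix x assume "x \<in> Idl (mon ` lower \<alpha>) <+> pw (Suc (sum \<alpha> {..<m}))"
    then obtain u v where uv: "u \<in> Idl (mon ` lower \<alpha>)" "v \<in> pw (Suc (sum \<alpha> {..<m}))" "x = u \<oplus> v"
      by (rule set_add_memE)
    have "mon ?\<gamma> \<otimes> u \<in> Idl (mon ` lower \<beta>)"
      using lower_span_shift[OF mi uv(1)] by (simp only: sum)
    moreover have "mon ?\<gamma> \<in> pw (sum ?\<gamma> {..<m})"
      using mi(2) by (intro mon_in_pw) (simp add: multi_indices_deg_def)
    then have "mon ?\<gamma> \<otimes> v \<in> pw (Suc (sum \<beta> {..<m}))"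
      using pw_mult[OF _ uv(2), of "mon ?\<gamma>" "sum ?\<gamma> {..<m}"] by (simp add: deg add.commute)
    moreover have "mon ?\<gamma> \<otimes> x = mon ?\<gamma> \<otimes> u \<oplus> mon ?\<gamma> \<otimes> v"
      unfolding uv(3) using span_closed[OF uv(1)] pw_closed[OF uv(2)] by (simp add: r_distr)
    ultimately show "mon ?\<gamma> \<otimes> x \<in> Idl (mon ` lower \<beta>) <+> pw (Suc (sum \<beta> {..<m}))"
      by (intro set_add_memI)
  qed
  moreover have "mon ?\<gamma> \<otimes> mon \<alpha> = mon \<beta>"
    using mon_split[OF le] by (simp add: m_comm)
  ultimately show False
    using \<beta>(2) by (simp add: std_def)
qed

lemma std_0: "std 0"
  unfolding std_def
proof
  assume "mon 0 \<in> stair (lower 0) (sum 0 {..<m})"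
  moreover have "lower 0 = {}"
    by (auto simp: lower_def less_fun_def)
  ultimately have "\<one> \<in> level 1"
    by (simp add: stair_empty)
  moreover have "level 1 \<subseteq> P"
    unfolding level_def
  proof (rule cl_least[OF _ pw_1_subset_P])
    show "sat P"
      using p0_P prime_mult_mem[OF P] by (auto simp: sat_def)
  qed
  ultimately show False
    using one_notin_P by blast
qed

text \<open>A substitute for the Hilbert function of the associated graded ring, whose values lie
  between \<open>std_count n\<close> and \<open>loc_len * std_count n\<close>.\<close>

definition std_count :: "nat \<Rightarrow> nat" where
  "std_count n = card {\<alpha> \<in> E n. std \<alpha>}"

text \<open>The length of \<open>R / pw 1\<close> modulo \<open>p0\<close> and localized at
  \<open>P\<close>. It is finite by \<open>len_level_1\<close>, so \<open>the_enat\<close> discards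
  nothing.\<close>

definition loc_len :: nat where
  "loc_len = the_enat (len (level 1) (carrier R))"

lemma len_level_1: "len (level 1) (carrier R) = enat loc_len"
proof -
  have "len (level 1) (carrier R) \<noteq> \<infinity>"
    using pw_1_subset_P P_minimal pw_subset_level by (intro len_finite[of "pw 1"]) auto
  then show ?thesis
    by (auto simp: loc_len_def)
qed

text \<open>Monomials are added in increasing order. A nonstandard one changes nothing; a standard
  one adds a nonzero cyclic quotient annihilated by \<open>pw 1\<close>, of length between 1 and
  \<open>loc_len\<close>.\<close>

lemma len_stair:
  assumes "T \<subseteq> E n" "\<And>\<alpha> \<beta>. \<alpha> \<in> T \<Longrightarrow> \<beta> \<in> E n \<Longrightarrow> less_fun \<beta> \<alpha> \<Longrightarrow> \<beta> \<in> T"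
  shows "enat (card {\<alpha> \<in> T. std \<alpha>}) \<le> len (level (Suc n)) (stair T n)
    \<and> len (level (Suc n)) (stair T n) \<le> enat (loc_len * card {\<alpha> \<in> T. std \<alpha>})"
  using assms
proof (induction "card T" arbitrary: T)
  case 0
  then have "T = {}"
    using finite_multi_indices_deg finite_subset by (metis card_0_eq)
  then show ?case
    by (simp add: stair_empty len_self zero_enat_def[symmetric])
next
  case (Suc k)
  have finT: "finite T" and "T \<noteq> {}"
    using Suc.hyps(2) finite_subset[OF Suc.prems(1) finite_multi_indices_deg] by auto
  moreover have "T \<subseteq> multi_indices m"
    using Suc.prems(1) by (auto simp: multi_indices_deg_def)
  ultimately obtain \<alpha> where \<alpha>: "\<alpha> \<in> T" "\<And>\<beta>. \<beta> \<in> T \<Longrightarrow> \<beta> = \<alpha> \<or> less_fun \<beta> \<alpha>"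
    using multi_indices_max by meson
  have \<alpha>_deg: "\<alpha> \<in> E n" "sum \<alpha> {..<m} = n"
    using \<alpha> Suc.prems(1) by (auto simp: multi_indices_deg_def)
  have T': "T - {\<alpha>} = lower \<alpha>"
    using \<alpha> Suc.prems(1,2) by (auto simp: lower_def \<alpha>_deg less_fun_irrefl)
  then have T: "T = insert \<alpha> (lower \<alpha>)" "\<alpha> \<notin> lower \<alpha>"
    using \<alpha>(1) by auto
  have fin: "finite (lower \<alpha>)"
    using finT T(1) by (metis finite_insert)
  let ?h = "card {\<beta> \<in> lower \<alpha>. std \<beta>}" and ?S = "stair (lower \<alpha>) n"
  have "card (lower \<alpha>) = k"
    using Suc.hyps(2) finT \<alpha>(1) by (simp add: T'[symmetric])
  moreover have "lower \<alpha> \<subseteq> E n"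
    by (auto simp: lower_def \<alpha>_deg)
  moreover have "\<beta> \<in> lower \<alpha>" if "\<beta>' \<in> lower \<alpha>" "\<beta> \<in> E n" "less_fun \<beta> \<beta>'" for \<beta> \<beta>'
    using that less_fun_trans by (auto simp: lower_def \<alpha>_deg)
  ultimately have IH: "enat ?h \<le> len (level (Suc n)) ?S" "len (level (Suc n)) ?S \<le> enat (loc_len * ?h)"
    using Suc.hyps(1)[of "lower \<alpha>"] by blast+
  have sub: "?S \<subseteq> stair T n"
    using T(1) by (intro stair_mono) auto
  show ?case
  proof (cases "std \<alpha>")
    case False
    then have "mon \<alpha> \<in> ?S"
      by (simp add: std_def \<alpha>_deg)
    then have "stair T n \<subseteq> ?S"
      using T(1) by (intro stair_least sat_stair level_subset_stair) (auto intro: mon_in_stair)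
    then have eq: "stair T n = ?S"
      using sub by blast
    have "{\<beta> \<in> T. std \<beta>} = {\<beta> \<in> lower \<alpha>. std \<beta>}"
      using T(1) False by auto
    with IH eq show ?thesis
      by simp
  next
    case True
    have "{\<beta> \<in> T. std \<beta>} = insert \<alpha> {\<beta> \<in> lower \<alpha>. std \<beta>}"
      using T(1) True by auto
    then have card: "card {\<beta> \<in> T. std \<beta>} = Suc ?h"
      using fin T(2) by simp
    have "mon \<alpha> \<in> stair T n" "mon \<alpha> \<notin> ?S"
      using True \<alpha>(1) by (auto simp: std_def \<alpha>_deg mon_in_stair)
    then have "sat_chain ?S (stair T n) 1 (\<lambda>i. if i = 0 then ?S else stair T n)"
      using sub by (auto simp: sat_chain_def)
    then have "enat 1 \<le> len ?S (stair T n)"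
      by (rule len_ge)
    with IH(1) have "enat ?h + enat 1 \<le> len (level (Suc n)) ?S + len ?S (stair T n)"
      by (rule add_mono)
    also have "\<dots> \<le> len (level (Suc n)) (stair T n)"
      using sub by (intro len_superadd level_subset_stair sat_stair sat_level)
    finally have lower_bound: "enat (Suc ?h) \<le> len (level (Suc n)) (stair T n)"
      by simp
    have p: "ideal (PIdl (mon \<alpha>) <+> ?S) R"
      by (intro add_ideals cgenideal_ideal mon_closed stair_ideal)
    have S_p: "?S \<subseteq> cl (PIdl (mon \<alpha>) <+> ?S)" "mon \<alpha> \<in> cl (PIdl (mon \<alpha>) <+> ?S)"
      using cl_superset[OF p] set_add_right[OF cgenideal_ideal[OF mon_closed] stair_ideal]
        set_add_left[OF cgenideal_ideal[OF mon_closed] stair_ideal] cgenideal_self[OF mon_closed]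
      by blast+
    then have "stair T n \<subseteq> cl (PIdl (mon \<alpha>) <+> ?S)"
      using T(1) level_subset_stair[of n "lower \<alpha>"] mon_in_stair[of _ "lower \<alpha>" n]
      by (intro stair_least sat_cl[OF p]) auto
    then have "len ?S (stair T n) \<le> len ?S (cl (PIdl (mon \<alpha>) <+> ?S))"
      by (intro len_mono subset_refl)
    also have "\<dots> \<le> len (colon R ?S (mon \<alpha>)) (carrier R)"
      by (intro len_add_principal sat_stair mon_closed)
    also have "\<dots> \<le> len (level 1) (carrier R)"
    proof (rule len_mono[OF _ subset_refl])
      have "mon \<alpha> \<otimes> x \<in> ?S" if "x \<in> pw 1" for x
        using pw_mult[OF mon_in_pw[OF \<alpha>_deg(1)] that] pw_subset_level[of "Suc n"] level_subset_stair[of n "lower \<alpha>"]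
        by auto
      then have "pw 1 \<subseteq> colon R ?S (mon \<alpha>)"
        using pw_closed by (auto simp: colon_def simp del: One_nat_def)
      then show "level 1 \<subseteq> colon R ?S (mon \<alpha>)"
        unfolding level_def by (intro cl_least sat_colon sat_stair mon_closed)
    qed
    finally have step: "len ?S (stair T n) \<le> enat loc_len"
      by (simp only: len_level_1)
    have "len (level (Suc n)) (stair T n) \<le> len (level (Suc n)) ?S + len ?S (stair T n)"
      using sub by (intro len_subadd level_subset_stair sat_stair sat_level)
    also have "\<dots> \<le> enat (loc_len * ?h) + enat loc_len"
      using IH(2) step by (rule add_mono)
    also have "\<dots> = enat (loc_len * Suc ?h)"
      by simp
    finally show ?thesis
      using lower_bound card by simp
  qed
qed

lemma len_level_step:
  "enat (std_count n) \<le> len (level (Suc n)) (level n)"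
  "len (level (Suc n)) (level n) \<le> enat (loc_len * std_count n)"
  using len_stair[of "E n" n] by (simp_all add: stair_full std_count_def)

lemma len_level_le:
  assumes "s \<le> t"
  shows "len (level t) (level s) \<le> enat (loc_len * (\<Sum>i=s..<t. std_count i))"
  using assms
proof (induction t rule: dec_induct)
  case base
  then show ?case
    by (simp add: len_self zero_enat_def[symmetric])
next
  case (step t)
  have "len (level (Suc t)) (level s) \<le> len (level (Suc t)) (level t) + len (level t) (level s)"
    using step.hyps by (intro len_subadd sat_level level_antimono) auto
  also have "\<dots> \<le> enat (loc_len * std_count t) + enat (loc_len * (\<Sum>i=s..<t. std_count i))"
    using len_level_step(2) step.IH by (rule add_mono)
  finally show ?case
    using step.hyps by (simp add: add_mult_distrib2 add.commute)
qed

lemma len_level_ge: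
  assumes "s \<le> t"
  shows "enat (\<Sum>i=s..<t. std_count i) \<le> len (level t) (level s)"
  using assms
proof (induction t rule: dec_induct)
  case base
  then show ?case
    by (simp add: zero_enat_def[symmetric])
next
  case (step t)
  have "enat (std_count t) + enat (\<Sum>i=s..<t. std_count i) \<le> len (level (Suc t)) (level t) + len (level t) (level s)"
    using len_level_step(1) step.IH by (rule add_mono)
  also have "\<dots> \<le> len (level (Suc t)) (level s)"
    using step.hyps by (intro len_superadd sat_level level_antimono) auto
  finally show ?case
    using step.hyps by (simp add: add.commute)
qed

lemma colon_level:
  assumes "z \<in> carrier R" "z \<notin> p0"
  obtains h where "\<And>n. colon R (level n) z \<subseteq> level (n - h)"
proof -
  obtain h where h: "\<And>n y. y \<in> carrier R \<Longrightarrow> z \<otimes> y \<in> pw n <+> p0 \<Longrightarrow> y \<in> pw (n - h) <+> p0"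
    using colon_pw_prime[OF p0 assms] by blast
  have "y \<in> level (n - h)" if "y \<in> colon R (level n) z" for n y
  proof -
    have y: "y \<in> carrier R" "z \<otimes> y \<in> cl (pw n)"
      using that by (auto simp: colon_def level_def)
    then obtain s where s: "s \<in> carrier R - P" "s \<otimes> (z \<otimes> y) \<in> pw n <+> p0"
      unfolding cl_def by blast
    have "z \<otimes> (s \<otimes> y) = s \<otimes> (z \<otimes> y)"
      using s(1) y(1) assms(1) by (simp add: m_lcomm)
    then have "s \<otimes> y \<in> pw (n - h) <+> p0"
      using s y(1) by (intro h) auto
    with s(1) y(1) show ?thesis
      unfolding level_def cl_def by blast
  qed
  then show thesis
    by (intro that subsetI)
qed

text \<open>Multiplication by an \<open>x\<close> in \<open>Q\<close> outside \<open>p0\<close>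
  shifts levels by at most \<open>h\<close>. If the counts were bounded, the length at
  \<open>P\<close> of the quotient by \<open>x\<close> and \<open>pw n\<close> would be bounded
  independently of \<open>n\<close>. So the saturations of \<open>Q <+> pw n\<close> would become
  constant, against Krull's theorem for an element of \<open>pw 1\<close> outside
  \<open>Q\<close>.\<close>

lemma std_count_unbounded:
  assumes Q: "primeideal Q R" "p0 \<subset> Q" "Q \<subset> P"
  shows "\<exists>n. C < std_count n"
proof (rule ccontr)
  assume "\<not> ?thesis"
  then have C: "std_count n \<le> C" for n
    by (auto simp: not_less)
  have QI: "ideal Q R"
    using Q(1) by (rule primeideal.axioms)
  have satQ: "sat Q"
    using QI Q prime_mult_mem[OF Q(1)] by (auto simp: sat_def)
  obtain x where x: "x \<in> Q" "x \<notin> p0"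
    using Q(2) by blast
  then have xR: "x \<in> carrier R"
    using ideal.Icarr[OF QI] by blast
  obtain h where h: "\<And>n. colon R (level n) x \<subseteq> level (n - h)"
    using colon_level[OF xR x(2)] by blast
  define Y where "Y n = cl (Q <+> pw n)" for n
  have Y_idl: "ideal (Q <+> pw n) R" for n
    by (intro add_ideals QI pw_ideal)
  have satY: "sat (Y n)" for n
    unfolding Y_def by (rule sat_cl[OF Y_idl])
  have Y_anti: "Y b \<subseteq> Y a" if "a \<le> b" for a b
    unfolding Y_def using that by (intro cl_mono Y_idl set_add_mono pw_antimono subset_refl)
  define K where "K = loc_len * (h * C)"
  have bound: "len (Y n) (carrier R) \<le> enat K" if "h \<le> n" for n
  proof -
    let ?Z = "cl ((\<otimes>) x ` carrier R <+> level n)"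
    have Z_idl: "ideal ((\<otimes>) x ` carrier R <+> level n) R"
      by (intro add_ideals mult_image_ideal oneideal xR level_ideal)
    have level_Z: "level n \<subseteq> ?Z"
      using cl_superset[OF Z_idl] set_add_right[OF mult_image_ideal[OF oneideal xR] level_ideal] by blast
    have "(\<otimes>) x ` carrier R \<subseteq> Y n"
    proof -
      have "(\<otimes>) x ` carrier R \<subseteq> Q"
        using x(1) QI by (auto intro: ideal_rmult_mem)
      then show ?thesis
        unfolding Y_def using cl_superset[OF Y_idl] set_add_left[OF QI pw_ideal] by blast
    qed
    moreover have "level n \<subseteq> Y n"
      unfolding Y_def level_def by (intro cl_mono Y_idl set_add_right QI pw_ideal)
    ultimately have ZY: "?Z \<subseteq> Y n"
      using satY by (intro cl_least set_add_least sat_ideal)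
    \<comment> \<open>By multiplication with \<open>x\<close>, the length of
      \<open>R / level (n - h)\<close> is at most that of \<open>?Z / level n\<close>. Cancelling it
      leaves for \<open>R / ?Z\<close> at most the length of \<open>h\<close> consecutive
      layers.\<close>
    have "len (level (n - h)) (carrier R) + len ?Z (carrier R) \<le> len (level n) ?Z + len ?Z (carrier R)"
      using h by (intro add_mono len_le_mult sat_level oneideal xR) auto
    also have "\<dots> \<le> len (level n) (carrier R)"
      using level_Z ideal_subset_carrier[OF cl_ideal[OF Z_idl]]
      by (intro len_superadd sat_level sat_cl[OF Z_idl])
    also have "\<dots> \<le> len (level n) (level (n - h)) + len (level (n - h)) (carrier R)"
      by (intro len_subadd sat_level sat_carrier level_antimono level_subset_carrier) auto
    finally have "len (level (n - h)) (carrier R) + len ?Z (carrier R)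
        \<le> len (level (n - h)) (carrier R) + len (level n) (level (n - h))"
      by (simp only: add.commute)
    moreover have "len (level (n - h)) (carrier R) \<noteq> \<infinity>"
    proof
      assume "len (level (n - h)) (carrier R) = \<infinity>"
      with len_level_le[of 0 "n - h"] show False
        by (simp add: level_0)
    qed
    ultimately have "len ?Z (carrier R) \<le> len (level n) (level (n - h))"
      by (simp add: enat_add_left_cancel_le)
    also have "\<dots> \<le> enat (loc_len * (\<Sum>i=n - h..<n. std_count i))"
      by (intro len_level_le) auto
    also have "\<dots> \<le> enat K"
    proof -
      have "(\<Sum>i=n - h..<n. std_count i) \<le> (\<Sum>i=n - h..<n. C)"
        by (intro sum_mono C)
      also have "\<dots> = h * C"
        using that by simp
      finally show ?thesis
        by (simp add: K_def)
    qed
    finally have "len ?Z (carrier R) \<le> enat K" .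
    then show ?thesis
      using len_mono[OF ZY subset_refl, of "carrier R"] by (rule order_trans[rotated])
  qed
  \<comment> \<open>Otherwise repeated strict descents would give, above some \<open>Y n\<close>, a
    chain longer than \<open>K\<close>.\<close>
  have "\<exists>n\<ge>h. \<forall>k\<ge>n. Y k = Y n"
  proof (rule ccontr)
    assume "\<not> ?thesis"
    then have descend: "\<exists>k\<ge>n. Y k \<subset> Y n" if "h \<le> n" for n
      using that Y_anti[of n] by (metis psubsetI)
    have "\<exists>n\<ge>h. \<exists>S. sat_chain (Y n) (carrier R) k S" for k
    proof (induction k)
      case 0
      have "sat_chain (Y h) (carrier R) 0 (\<lambda>_. Y h)"
        using satY ideal_subset_carrier[OF sat_ideal[OF satY]] by (simp add: sat_chain_def)
      then show ?case
        by blast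
    next
      case (Suc k)
      then obtain n S where n: "h \<le> n" and S: "sat_chain (Y n) (carrier R) k S"
        by blast
      obtain l where l: "n \<le> l" "Y l \<subset> Y n"
        using descend[OF n] by blast
      have S_ge: "sat (S i)" "Y n \<subseteq> S i" "S i \<subseteq> carrier R" if "i \<le> k" for i
        using S that by (auto simp: sat_chain_def)
      have "sat_chain (Y l) (carrier R) (Suc k) (case_nat (Y l) S)"
        unfolding sat_chain_def
      proof (intro conjI allI impI)
        fix i
        show "sat (case_nat (Y l) S i)" if "i \<le> Suc k"
          using that S_ge satY by (cases i) auto
        show "Y l \<subseteq> case_nat (Y l) S i" if "i \<le> Suc k"
          using that S_ge(2)[of "i - 1"] l(2) by (cases i) auto
        show "case_nat (Y l) S i \<subseteq> carrier R" if "i \<le> Suc k"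
          using that S_ge(3) ideal_subset_carrier[OF sat_ideal[OF satY]] by (cases i) auto
        show "case_nat (Y l) S i \<subset> case_nat (Y l) S (Suc i)" if "i < Suc k"
          using that S S_ge(2)[of 0] l(2) by (cases i) (auto simp: sat_chain_def)
      qed
      moreover have "h \<le> l"
        using n l(1) by simp
      ultimately show ?case
        by blast
    qed
    then obtain n S where "h \<le> n" "sat_chain (Y n) (carrier R) (Suc K) S"
      by blast
    then have "enat (Suc K) \<le> enat K"
      using bound len_ge by (meson order_trans)
    then show False
      by simp
  qed
  then obtain n where n: "\<And>k. k \<ge> n \<Longrightarrow> Y k = Y n"
    by blast
  \<comment> \<open>It exists because \<open>Q\<close> lies strictly below \<open>P\<close>, which
    is minimal over \<open>pw 1\<close>.\<close>
  obtain z where z: "z \<in> pw 1" "z \<notin> Q"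
    using P_minimal[OF Q(1)] Q(3) by blast
  have zR: "z \<in> carrier R"
    using z(1) by (rule pw_closed)
  have zn: "z [^] k \<in> pw k \<and> z [^] k \<notin> Q" for k :: nat
    by (rule pow_in_pw_notin_prime[OF Q(1) z])
  have "pw 1 \<subseteq> P" "Q \<subseteq> P" "z [^] n \<in> carrier R" "z [^] n \<notin> Q"
    using pw_1_subset_P Q(3) zR zn by auto
  then obtain k where k: "\<And>s. s \<in> carrier R - P \<Longrightarrow> s \<otimes> z [^] n \<notin> pw k <+> Q"
    using krull_separated[OF Q(1) P] by blast
  define l where "l = max n k"
  have "z [^] n \<in> Y n"
    unfolding Y_def using zn[of n] cl_superset[OF Y_idl] set_add_right[OF QI pw_ideal] by blast
  then have "z [^] n \<in> cl (Q <+> pw l)"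
    using n[of l] by (simp add: l_def Y_def)
  then obtain s a b w where *: "s \<in> carrier R - P" "a \<in> Q" "b \<in> pw l" "w \<in> p0"
      "s \<otimes> z [^] n = (a \<oplus> b) \<oplus> w"
    by (elim cl_addE) blast
  have c: "a \<in> carrier R" "b \<in> carrier R" "w \<in> carrier R" "w \<in> Q"
    using * ideal.Icarr[OF QI] pw_closed Q(2) by auto
  have "s \<otimes> z [^] n = b \<oplus> (a \<oplus> w)"
    unfolding *(5) using c by algebra
  moreover have "b \<in> pw k"
    using *(3) pw_antimono[of k l] by (auto simp: l_def)
  moreover have "a \<oplus> w \<in> Q"
    by (rule ideal_add_mem[OF QI *(2) c(4)])
  ultimately have "s \<otimes> z [^] n \<in> pw k <+> Q"
    by (intro set_add_memI)
  with k *(1) show False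
    by blast
qed

text \<open>Each \<open>g i [^] q\<close> multiplies \<open>pw n\<close> into
  \<open>pw (q + n)\<close>, so each of the \<open>m\<close> generators contributes at most the
  length of \<open>R / level n\<close>.\<close>

lemma len_generator_powers_level:
  "len (level (q + n)) (cl (generator_powers q <+> level (q + n))) \<le> enat (m * (loc_len * (\<Sum>i<n. std_count i)))"
proof -
  have "len (level (q + n)) (cl (generator_powers q <+> level (q + n))) \<le> enat m * len (level n) (carrier R)"
    unfolding generator_powers_def
  proof (rule len_add_generators[OF sat_level])
    fix i assume "i < m"
    have "pw n \<subseteq> colon R (level (q + n)) (g i [^] q)"
      using pw_mult[OF g_pow_in_pw[OF \<open>i < m\<close>]] pw_subset_level pw_closed by (fastforce simp: colon_def)
    then show "level n \<subseteq> colon R (level (q + n)) (g i [^] q)"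
      unfolding level_def[of n] by (intro cl_least sat_colon sat_level) auto
  qed auto
  also have "\<dots> \<le> enat m * enat (loc_len * (\<Sum>i<n. std_count i))"
    using len_level_le[of 0 n] by (intro mult_left_mono) (auto simp: level_0 atLeast0LessThan)
  finally show ?thesis
    by simp
qed

text \<open>Both sides count lengths inside \<open>level (q + n)\<close>: multiplication by \<open>c\<close> is injective up to a
  bounded shift of levels, and the right-hand side comes from the \<open>m\<close> generators of \<open>generator_powers q\<close>.\<close>

lemma std_count_inequality:
  assumes c: "c \<in> carrier R" and h: "\<And>n. colon R (level n) c \<subseteq> level (n - h)"
    and sub: "\<And>x. x \<in> pw t \<Longrightarrow> c \<otimes> x \<in> generator_powers q" and t: "t \<le> q + n - h"
  shows "(\<Sum>i=t..<q + n - h. std_count i) \<le> m * (loc_len * (\<Sum>i<n. std_count i))"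
proof -
  let ?B = "level (q + n)"
  have G: "ideal (generator_powers q <+> ?B) R"
    by (intro add_ideals generator_powers_ideal level_ideal)
  have "(\<otimes>) c ` level t \<subseteq> cl (generator_powers q <+> ?B)"
  proof safe
    fix x assume "x \<in> level t"
    then show "c \<otimes> x \<in> cl (generator_powers q <+> ?B)"
      unfolding level_def[of t]
      by (rule cl_mult_mem[OF pw_ideal G c, rotated])
         (use sub set_add_left[OF generator_powers_ideal level_ideal] in blast)
  qed
  moreover have "?B \<subseteq> cl (generator_powers q <+> ?B)"
    using cl_superset[OF G] set_add_right[OF generator_powers_ideal level_ideal] by blast
  ultimately have "cl ((\<otimes>) c ` level t <+> ?B) \<subseteq> cl (generator_powers q <+> ?B)"
    by (intro cl_least sat_cl[OF G] set_add_least cl_ideal[OF G])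
  then have "len ?B (cl ((\<otimes>) c ` level t <+> ?B)) \<le> len ?B (cl (generator_powers q <+> ?B))"
    by (intro len_mono subset_refl)
  moreover have "len (level (q + n - h)) (level t) \<le> len ?B (cl ((\<otimes>) c ` level t <+> ?B))"
    by (intro len_le_mult sat_level level_ideal c h)
  moreover have "enat (\<Sum>i=t..<q + n - h. std_count i) \<le> len (level (q + n - h)) (level t)"
    using t by (rule len_level_ge)
  ultimately have "enat (\<Sum>i=t..<q + n - h. std_count i) \<le> enat (m * (loc_len * (\<Sum>i<n. std_count i)))"
    using len_generator_powers_level[of q n] by (meson order_trans)
  then show ?thesis
    by simp
qed

text \<open>With \<open>q = M * n\<close>, the left side of \<open>std_count_inequality\<close> sums
  at least \<open>n / 4\<close> layers of degree at least \<open>M * n\<close>, the right side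
  \<open>n\<close> layers of degree below \<open>n\<close>. The ratio of the two bounds has order
  \<open>M ^ (D - 1)\<close>, which is unbounded once \<open>D \<ge> 2\<close>.\<close>

theorem no_asymptotic_containment:
  assumes Q: "primeideal Q R" "p0 \<subset> Q" "Q \<subset> P"
    and H: "\<And>M0. \<exists>M\<ge>M0. \<exists>c\<in>carrier R. c \<notin> p0 \<and>
       (\<forall>N. \<exists>n\<ge>N. \<exists>s\<le>M * n + n div 2. \<forall>x\<in>pw s. c \<otimes> x \<in> generator_powers (M * n))"
  shows False
proof -
  let ?\<Sigma> = "{\<alpha> \<in> multi_indices m. std \<alpha>}"
  have count: "std_count n = card (?\<Sigma> \<inter> E n)" for n
    unfolding std_count_def by (rule arg_cong[of _ _ card]) (auto simp: multi_indices_deg_def)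
  have down: "\<alpha> \<in> ?\<Sigma>" if "\<beta> \<in> ?\<Sigma>" "\<alpha> \<le> \<beta>" for \<alpha> \<beta>
  proof -
    have "\<alpha> i = 0" if "i \<ge> m" for i
      using \<open>\<beta> \<in> ?\<Sigma>\<close> \<open>\<alpha> \<le> \<beta>\<close> that by (auto simp: multi_indices_def le_fun_def) (metis le_zero_eq)
    then show ?thesis
      using that std_down_closed by (auto simp: multi_indices_def)
  qed
  have "0 \<in> ?\<Sigma>"
    using std_0 by (simp add: multi_indices_def)
  then have "?\<Sigma> \<noteq> {}"
    by blast
  then obtain C D where
    upper: "\<And>n. std_count n \<le> C * (n + 1) ^ (D - 1)" and
    lower_D: "\<And>n. D \<noteq> 0 \<Longrightarrow> n ^ (D - 1) \<le> D ^ (D - 1) * std_count n"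
    using down_closed_growth[of ?\<Sigma> m] down unfolding count by blast
  have D: "D \<ge> 2"
  proof (rule ccontr)
    assume "\<not> D \<ge> 2"
    then have "std_count n \<le> C" for n
      using upper[of n] by simp
    with std_count_unbounded[OF Q, of C] show False
      by (simp add: not_less[symmetric])
  qed
  define d where "d = D - 1"
  have d: "d \<ge> 1" "D \<noteq> 0" "D - 1 = d"
    using D by (auto simp: d_def)
  \<comment> \<open>Chosen so that the comparison below becomes \<open>M ^ d \<le> B\<close>, and
    fixed before \<open>M\<close>, \<open>c\<close> and \<open>h\<close>. The factor 4 comes from
    the number of summands on the left.\<close>
  define B where "B = 4 * (D ^ d * (m * (loc_len * C)))"
  obtain M c where M: "M \<ge> Suc B" and c: "c \<in> carrier R" "c \<notin> p0"
    and Hc: "\<And>N. \<exists>n\<ge>N. \<exists>s\<le>M * n + n div 2. \<forall>x\<in>pw s. c \<otimes> x \<in> generator_powers (M * n)"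
    using H[of "Suc B"] by blast
  obtain h where h: "\<And>n. colon R (level n) c \<subseteq> level (n - h)"
    using colon_level[OF c] by blast
  obtain n s where n: "n \<ge> 4 * h + 1" and s: "s \<le> M * n + n div 2" "\<And>x. x \<in> pw s \<Longrightarrow> c \<otimes> x \<in> generator_powers (M * n)"
    using Hc[of "4 * h + 1"] by blast
  let ?q = "M * n"
  let ?t = "?q + n div 2"
  \<comment> \<open>At most half of \<open>n\<close> is lost to the excess of \<open>?t\<close> over
    \<open>?q\<close> and less than a quarter to the shift \<open>h\<close>, so at least a quarter
    of the layers remain.\<close>
  have nh: "n \<le> 4 * (n - n div 2 - h)"
    using n by linarith
  have "(\<Sum>i=?t..<?q + n - h. std_count i) \<le> m * (loc_len * (\<Sum>i<n. std_count i))"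
  proof (rule std_count_inequality[OF c(1) h])
    show "c \<otimes> x \<in> generator_powers ?q" if "x \<in> pw ?t" for x
      using that s pw_antimono[OF s(1)] by blast
    show "?t \<le> ?q + n - h"
      using n by linarith
  qed
  moreover have "(\<Sum>i<n. std_count i) \<le> n * (C * n ^ d)"
  proof -
    have "std_count i \<le> C * n ^ d" if "i < n" for i
    proof -
      have "std_count i \<le> C * (i + 1) ^ d"
        using upper[of i] by (simp only: d)
      also have "\<dots> \<le> C * n ^ d"
        using that by (intro mult_left_mono power_mono) auto
      finally show ?thesis .
    qed
    then have "(\<Sum>i<n. std_count i) \<le> (\<Sum>i<n. C * n ^ d)"
      by (intro sum_mono) auto
    then show ?thesis
      by simp
  qed
  ultimately have up: "(\<Sum>i=?t..<?q + n - h. std_count i) \<le> m * (loc_len * (n * (C * n ^ d)))"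
    by (meson le_trans mult_le_mono2)
  have "(n - n div 2 - h) * ?q ^ d = (\<Sum>i=?t..<?q + n - h. ?q ^ d)"
  proof -
    have "?q + n - h - ?t = n - n div 2 - h"
      by linarith
    then show ?thesis
      by simp
  qed
  also have "\<dots> \<le> (\<Sum>i=?t..<?q + n - h. D ^ d * std_count i)"
  proof (rule sum_mono)
    fix i assume "i \<in> {?t..<?q + n - h}"
    then have "?q ^ d \<le> i ^ d"
      by (intro power_mono) auto
    also have "\<dots> \<le> D ^ d * std_count i"
      using lower_D[of i] d by simp
    finally show "?q ^ d \<le> D ^ d * std_count i" .
  qed
  also have "\<dots> = D ^ d * (\<Sum>i=?t..<?q + n - h. std_count i)"
    by (simp add: sum_distrib_left)
  also have "\<dots> \<le> D ^ d * (m * (loc_len * (n * (C * n ^ d))))"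
    using up by (rule mult_le_mono2)
  finally have "4 * ((n - n div 2 - h) * ?q ^ d) \<le> B * n * n ^ d"
    by (simp add: B_def mult.assoc mult.left_commute)
  moreover have "n * ?q ^ d \<le> 4 * ((n - n div 2 - h) * ?q ^ d)"
    using mult_le_mono1[OF nh, of "?q ^ d"] by (simp only: mult.assoc)
  ultimately have "n * ?q ^ d \<le> B * n * n ^ d"
    by (rule le_trans[rotated])
  then have "(n * n ^ d) * M ^ d \<le> (n * n ^ d) * B"
    by (simp add: power_mult_distrib mult_ac)
  moreover have "n * n ^ d > 0"
    using n by simp
  ultimately have "M ^ d \<le> B"
    by simp
  moreover have "M \<le> M ^ d"
    using d(1) M by (intro self_le_power) auto
  ultimately show False
    using M by simp
qed

end

section \<open>Tight closure and exponents\<close>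

context cring
begin

lemma binomial_expansion:
  assumes x: "x \<in> carrier R" and y: "y \<in> carrier R"
  shows "(x \<oplus> y) [^] n = (\<Oplus>k\<in>{..n}. add_pow R (n choose k) (x [^] k \<otimes> y [^] (n - k)))"
proof (induction n)
  case 0
  then show ?case
    using x y by simp
next
  case (Suc n)
  define t where "t i j = x [^] i \<otimes> y [^] j" for i j :: nat
  have t [simp]: "t i j \<in> carrier R" for i j
    using x y by (simp add: t_def)
  have tx: "t i j \<otimes> x = t (Suc i) j" and ty: "t i j \<otimes> y = t i (Suc j)" for i j
    using x y by (simp_all add: t_def m_assoc m_comm m_lcomm)
  have sum_closed: "(\<Oplus>k\<in>{..n}. add_pow R (n choose k) (t k (n - k))) \<in> carrier R"
    by (intro finsum_closed) auto
  have X: "(\<Oplus>k\<in>{..n}. add_pow R (n choose k) (t k (n - k))) \<otimes> x = (\<Oplus>k\<in>{..n}. add_pow R (n choose k) (t (Suc k) (n - k)))"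
    by (subst finsum_ldistr) (auto simp: x add_pow_ldistr tx)
  have "(\<Oplus>k\<in>{..n}. add_pow R (n choose k) (t k (n - k))) \<otimes> y = (\<Oplus>k\<in>{..n}. add_pow R (n choose k) (t k (Suc (n - k))))"
    by (subst finsum_ldistr) (auto simp: y add_pow_ldistr ty)
  also have "\<dots> = (\<Oplus>k\<in>{..n}. add_pow R (n choose k) (t k (Suc n - k)))"
    by (intro finsum_cong') (auto simp: Suc_diff_le)
  \<comment> \<open>The additional summand has the coefficient \<open>n choose Suc n\<close>, which
    is 0; it allows the index to be shifted.\<close>
  also have "\<dots> = (\<Oplus>k\<in>{..Suc n}. add_pow R (n choose k) (t k (Suc n - k)))"
  proof -
    have "(\<Oplus>k\<in>{..Suc n}. add_pow R (n choose k) (t k (Suc n - k)))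
        = add_pow R (n choose Suc n) (t (Suc n) (Suc n - Suc n)) \<oplus> (\<Oplus>k\<in>{..n}. add_pow R (n choose k) (t k (Suc n - k)))"
      by (rule finsum_Suc) auto
    then show ?thesis
      by (simp add: binomial_eq_0 finsum_closed)
  qed
  also have "\<dots> = (\<Oplus>k\<in>{..n}. add_pow R (n choose Suc k) (t (Suc k) (n - k))) \<oplus> t 0 (Suc n)"
    by (subst finsum_Suc2) (auto simp: add.nat_pow_eone)
  finally have Y: "(\<Oplus>k\<in>{..n}. add_pow R (n choose k) (t k (n - k))) \<otimes> y
      = (\<Oplus>k\<in>{..n}. add_pow R (n choose Suc k) (t (Suc k) (n - k))) \<oplus> t 0 (Suc n)" .
  have "(x \<oplus> y) [^] Suc n = (\<Oplus>k\<in>{..n}. add_pow R (n choose k) (t k (n - k))) \<otimes> (x \<oplus> y)"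
    using Suc by (simp add: t_def)
  also have "\<dots> = (\<Oplus>k\<in>{..n}. add_pow R (n choose k) (t (Suc k) (n - k)))
      \<oplus> ((\<Oplus>k\<in>{..n}. add_pow R (n choose Suc k) (t (Suc k) (n - k))) \<oplus> t 0 (Suc n))"
    using sum_closed x y by (simp only: r_distr X Y)
  also have "\<dots> = (\<Oplus>k\<in>{..n}. add_pow R (n choose k) (t (Suc k) (n - k)) \<oplus> add_pow R (n choose Suc k) (t (Suc k) (n - k))) \<oplus> t 0 (Suc n)"
    by (subst finsum_addf) (auto intro!: a_assoc[symmetric] finsum_closed)
  also have "\<dots> = (\<Oplus>k\<in>{..n}. add_pow R (Suc n choose Suc k) (t (Suc k) (n - k))) \<oplus> t 0 (Suc n)"
    by (intro arg_cong2[of _ _ _ _ "(\<oplus>)"] finsum_cong') (auto simp: add.nat_pow_mult)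
  also have "\<dots> = (\<Oplus>k\<in>{..Suc n}. add_pow R (Suc n choose k) (t k (Suc n - k)))"
  proof -
    have "(\<Oplus>k\<in>{..Suc n}. add_pow R (Suc n choose k) (t k (Suc n - k)))
        = (\<Oplus>k\<in>{..n}. add_pow R (Suc n choose Suc k) (t (Suc k) (Suc n - Suc k))) \<oplus> add_pow R (Suc n choose 0) (t 0 (Suc n - 0))"
      by (rule finsum_Suc2) auto
    then show ?thesis
      by (simp add: add.nat_pow_eone del: binomial_Suc_Suc)
  qed
  finally show ?case
    by (simp only: t_def)
qed

text \<open>Zorn's lemma produces maximal elements, so it is applied to the complements of the
  primes below \<open>Q\<close>; unions of chains of complements correspond to intersections of
  chains of primes.\<close>

lemma exists_minimal_prime_below:
  assumes Q: "primeideal Q R"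
  obtains P where "P \<in> minimal_primes R" "P \<subseteq> Q"
proof -
  define F where "F = {carrier R - P | P. primeideal P R \<and> P \<subseteq> Q}"
  have F_iff: "K \<in> F \<longleftrightarrow> (\<exists>P. primeideal P R \<and> P \<subseteq> Q \<and> K = carrier R - P)" for K
    by (auto simp: F_def)
  have compl: "carrier R - (carrier R - P) = P" if "primeideal P R" for P
    using ideal_subset_carrier[OF primeideal.axioms(1)[OF that]] by blast
  have "\<exists>M\<in>F. \<forall>K\<in>F. M \<subseteq> K \<longrightarrow> K = M"
  proof (rule subset_Zorn_nonempty)
    show "F \<noteq> {}"
      using Q F_iff by blast
    fix C assume C: "C \<noteq> {}" "subset.chain F C"
    have CF: "\<exists>P. primeideal P R \<and> P \<subseteq> Q \<and> c = carrier R - P" if "c \<in> C" for c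
      using C(2) that F_iff by (auto simp: pred_on.chain_def)
    define J where "J = carrier R - \<Union>C"
    have J: "x \<in> J \<longleftrightarrow> x \<in> carrier R \<and> (\<forall>c\<in>C. x \<notin> c)" for x
      by (auto simp: J_def)
    have JQ: "J \<subseteq> Q"
      using C(1) CF by (fastforce simp: J)
    have idl: "ideal (carrier R - c) R" "primeideal (carrier R - c) R" if "c \<in> C" for c
      using CF[OF that] compl primeideal.axioms(1) by metis+
    have Jm: "x \<in> J \<longleftrightarrow> x \<in> carrier R \<and> (\<forall>c\<in>C. x \<in> carrier R - c)" for x
      by (auto simp: J)
    have "ideal J R"
    proof (rule cring_idealI)
      show "\<zero> \<in> J"
        unfolding Jm using ideal_zero_mem[OF idl(1)] zero_closed by metis
      show "a \<oplus> b \<in> J" if "a \<in> J" "b \<in> J" for a b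
        using that ideal_add_mem[OF idl(1)] a_closed unfolding Jm by metis
      show "r \<otimes> a \<in> J" if "a \<in> J" "r \<in> carrier R" for a r
        using that ideal_lmult_mem[OF idl(1)] m_closed unfolding Jm by metis
    qed (auto simp: J)
    moreover have "carrier R \<noteq> J"
      using JQ prime_one_notin[OF Q] one_closed by blast
    moreover have "a \<in> J \<or> b \<in> J" if ab: "a \<in> carrier R" "b \<in> carrier R" "a \<otimes> b \<in> J" for a b
    proof (rule ccontr)
      assume "\<not> ?thesis"
      \<comment> \<open>The two factors lie in complements from the chain; the larger complement
        contains both, which contradicts primality there.\<close>
      then obtain c d where cd: "c \<in> C" "a \<in> c" "d \<in> C" "b \<in> d"
        using ab by (auto simp: J)
      have "\<forall>x\<in>C. \<forall>y\<in>C. (\<subset>)\<^sup>=\<^sup>= x y \<or> (\<subset>)\<^sup>=\<^sup>= y x"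
        using C(2) unfolding pred_on.chain_def by (rule conjunct2)
      from this[rule_format, OF cd(1,3)] have "c \<subseteq> d \<or> d \<subseteq> c"
        by auto
      then obtain e where e: "e \<in> C" "a \<in> e" "b \<in> e"
        using cd by blast
      have "a \<otimes> b \<in> carrier R - e"
        using ab(3) e(1) unfolding Jm by simp
      from prime_mult_mem[OF idl(2)[OF e(1)] ab(1,2) this] e(2,3) show False
        by simp
    qed
    ultimately have "primeideal J R"
      by (intro primeidealI cring_axioms)
    moreover have "\<Union>C = carrier R - J"
      using CF by (auto simp: J)
    ultimately show "\<Union>C \<in> F"
      using JQ F_iff by blast
  qed
  then obtain M where M: "M \<in> F" and M_max: "\<forall>K\<in>F. M \<subseteq> K \<longrightarrow> K = M"
    by (rule bexE)
  then obtain P where P: "primeideal P R" "P \<subseteq> Q" "M = carrier R - P"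
    unfolding F_iff by (elim exE conjE)
  have max: "carrier R - P' = carrier R - P"
    if "primeideal P' R" "P' \<subseteq> Q" "carrier R - P \<subseteq> carrier R - P'" for P'
  proof -
    have "carrier R - P' \<in> F"
      unfolding F_iff using that(1,2) by (intro exI[of _ P'] conjI refl)
    then show ?thesis
      using M_max that(3) unfolding P(3) by simp
  qed
  have "P' = P" if "primeideal P' R" "P' \<subseteq> P" for P'
  proof -
    have "P' \<subseteq> Q" "carrier R - P \<subseteq> carrier R - P'"
      using that(2) P(2) by auto
    with that(1) have "carrier R - P' = carrier R - P"
      by (rule max)
    then show ?thesis
      using compl[OF that(1)] compl[OF P(1)] by metis
  qed
  then have "P \<in> minimal_primes R"
    using P(1) ideal_zero_mem[OF primeideal.axioms(1)[OF P(1)]]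
    by (auto simp: minimal_primes_def minimal_primes_over_def)
  then show thesis
    using P(2) by (rule that)
qed

end

section \<open>Frobenius powers and tight closure in characteristic \<open>p\<close>\<close>

locale prime_char_cring = cring R for R (structure) +
  fixes p :: nat
  assumes p_prime: "Factorial_Ring.prime p" and char_p: "ring_char R = p"
begin

lemma p_ge_2: "p \<ge> 2"
  using p_prime by (rule prime_ge_2_nat)

lemma p_pow_pos [simp]: "p ^ n > 0"
  using p_ge_2 by simp

lemma char_mult_zero:
  assumes "p dvd k" "x \<in> carrier R"
  shows "add_pow R k x = \<zero>"
proof -
  have "add_pow R p \<one> = \<zero>"
    using group.pow_ord_eq_1[OF a_group, of \<one>] char_p by (simp add: ring_char_def add_pow_def)
  then have p0: "add_pow R p y = \<zero>" if "y \<in> carrier R" for y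
    using add_pow_ldistr[of \<one> y p] that by simp
  obtain l where "k = p * l"
    using assms(1) by blast
  then have "add_pow R k x = add_pow R p (add_pow R l x)"
    using assms(2) by (simp add: add.nat_pow_pow mult.commute)
  then show ?thesis
    using p0 assms(2) by simp
qed

lemma frobenius_add_1:
  assumes "x \<in> carrier R" "y \<in> carrier R"
  shows "(x \<oplus> y) [^] p = x [^] p \<oplus> y [^] p"
proof -
  let ?f = "\<lambda>k. add_pow R (p choose k) (x [^] k \<otimes> y [^] (p - k))"
  have "(x \<oplus> y) [^] p = (\<Oplus>k\<in>{..p}. ?f k)"
    by (rule binomial_expansion[OF assms])
  also have "\<dots> = (\<Oplus>k\<in>{0, p}. ?f k)"
  proof (rule add.finprod_mono_neutral_cong_right)
    fix k assume "k \<in> {..p} - {0, p}"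
    then show "?f k = \<zero>"
      using assms p_prime by (intro char_mult_zero dvd_choose_prime) auto
  qed (use assms in auto)
  also have "\<dots> = y [^] p \<oplus> x [^] p"
    using assms p_ge_2 by (simp add: add.nat_pow_eone)
  finally show ?thesis
    using assms by (simp add: a_comm)
qed

lemma frobenius_add:
  assumes "x \<in> carrier R" "y \<in> carrier R"
  shows "(x \<oplus> y) [^] (p ^ n) = x [^] (p ^ n) \<oplus> y [^] (p ^ n)"
proof (induction n)
  case (Suc n)
  have "(x \<oplus> y) [^] (p ^ Suc n) = ((x \<oplus> y) [^] (p ^ n)) [^] p"
    using assms by (simp add: nat_pow_pow mult.commute)
  also have "\<dots> = (x [^] (p ^ n)) [^] p \<oplus> (y [^] (p ^ n)) [^] p"
    unfolding Suc using assms by (intro frobenius_add_1) auto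
  also have "\<dots> = x [^] (p ^ Suc n) \<oplus> y [^] (p ^ Suc n)"
    using assms by (simp add: nat_pow_pow mult.commute)
  finally show ?case .
qed (use assms in simp)

text \<open>Since the Frobenius is additive, the elements whose \<open>p ^ n\<close>-th power lies
  in \<open>J\<close> form an ideal, so generators suffice.\<close>

lemma genideal_pow_mem:
  assumes "S \<subseteq> carrier R" "ideal J R" "\<And>s. s \<in> S \<Longrightarrow> s [^] (p ^ n) \<in> J" "x \<in> Idl S"
  shows "x [^] (p ^ n) \<in> J"
proof -
  have "ideal {x \<in> carrier R. x [^] (p ^ n) \<in> J} R"
  proof (rule cring_idealI)
    have "\<zero> [^] (p ^ n) = \<zero>"
      using p_pow_pos[of n] by (cases "p ^ n") auto
    then show "\<zero> \<in> {x \<in> carrier R. x [^] (p ^ n) \<in> J}"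
      using ideal_zero_mem[OF assms(2)] by simp
    show "a \<oplus> b \<in> {x \<in> carrier R. x [^] (p ^ n) \<in> J}"
      if "a \<in> {x \<in> carrier R. x [^] (p ^ n) \<in> J}" "b \<in> {x \<in> carrier R. x [^] (p ^ n) \<in> J}" for a b
      using that assms(2) by (simp add: frobenius_add ideal_add_mem)
    show "r \<otimes> a \<in> {x \<in> carrier R. x [^] (p ^ n) \<in> J}"
      if "a \<in> {x \<in> carrier R. x [^] (p ^ n) \<in> J}" "r \<in> carrier R" for a r
      using that assms(2) by (simp add: nat_pow_distrib ideal_lmult_mem)
  qed auto
  moreover have "S \<subseteq> {x \<in> carrier R. x [^] (p ^ n) \<in> J}"
    using assms(1,3) by auto
  ultimately show ?thesis
    using genideal_minimal assms(4) by blast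
qed

lemma pow_image_closed: "S \<subseteq> carrier R \<Longrightarrow> (\<lambda>x. x [^] (q :: nat)) ` S \<subseteq> carrier R"
  by auto

lemma bracket_power_genideal:
  assumes S: "S \<subseteq> carrier R"
  shows "bracket_power R (Idl S) (p ^ n) = Idl ((\<lambda>x. x [^] (p ^ n)) ` S)"
proof
  show "bracket_power R (Idl S) (p ^ n) \<subseteq> Idl ((\<lambda>x. x [^] (p ^ n)) ` S)"
    unfolding bracket_power_def
    using genideal_pow_mem[OF S genideal_ideal[OF pow_image_closed[OF S]]] genideal_mem[OF pow_image_closed[OF S]]
    by (intro genideal_minimal genideal_ideal pow_image_closed S) auto
  show "Idl ((\<lambda>x. x [^] (p ^ n)) ` S) \<subseteq> bracket_power R (Idl S) (p ^ n)"
    unfolding bracket_power_def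
    using genideal_self[OF S] ideal_subset_carrier[OF genideal_ideal[OF S]]
    by (intro subset_Idl_subset pow_image_closed image_mono)
qed

lemma bracket_power_ideal: "A \<subseteq> carrier R \<Longrightarrow> ideal (bracket_power R A q) R"
  unfolding bracket_power_def by (intro genideal_ideal pow_image_closed)

lemma pow_in_bracket_power: "A \<subseteq> carrier R \<Longrightarrow> x \<in> A \<Longrightarrow> x [^] q \<in> bracket_power R A q"
  unfolding bracket_power_def by (intro genideal_mem pow_image_closed) auto

lemma bracket_power_bracket_power:
  assumes A: "A \<subseteq> carrier R"
  shows "bracket_power R (bracket_power R A q) (p ^ n) = bracket_power R A (q * p ^ n)"
proof -
  have "bracket_power R (bracket_power R A q) (p ^ n) = Idl ((\<lambda>x. x [^] (p ^ n)) ` (\<lambda>x. x [^] q) ` A)"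
    unfolding bracket_power_def[of R A q] by (rule bracket_power_genideal[OF pow_image_closed[OF A]])
  also have "(\<lambda>x. x [^] (p ^ n)) ` (\<lambda>x. x [^] q) ` A = (\<lambda>x. x [^] (q * p ^ n)) ` A"
    unfolding image_image using A by (intro image_cong) (auto simp: nat_pow_pow)
  finally show ?thesis
    by (simp only: bracket_power_def)
qed

lemma minimal_primes_prime: "P \<in> minimal_primes R \<Longrightarrow> primeideal P R"
  by (simp add: minimal_primes_def minimal_primes_over_def)

lemma subset_tight_closure:
  assumes A: "ideal A R"
  shows "A \<subseteq> tight_closure R p A"
proof
  fix x assume x: "x \<in> A"
  have AR: "A \<subseteq> carrier R"
    using A by (rule ideal_subset_carrier)
  have "\<one> \<otimes> x [^] (p ^ n) \<in> bracket_power R A (p ^ n)" for n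
    using pow_in_bracket_power[OF AR x] AR x by auto
  moreover have "\<forall>P\<in>minimal_primes R. \<one> \<notin> P"
    using minimal_primes_prime prime_one_notin by blast
  ultimately show "x \<in> tight_closure R p A"
    unfolding tight_closure_def using x AR by (auto intro!: bexI[of _ \<one>])
qed

lemma minimal_primes_mult_notin:
  assumes "c \<in> carrier R" "d \<in> carrier R" "\<forall>P\<in>minimal_primes R. c \<notin> P" "\<forall>P\<in>minimal_primes R. d \<notin> P"
  shows "\<forall>P\<in>minimal_primes R. c \<otimes> d \<notin> P"
proof
  fix P assume "P \<in> minimal_primes R"
  with assms minimal_primes_prime[OF this] prime_mult_mem show "c \<otimes> d \<notin> P"
    by metis
qed

lemma tight_closure_ideal:
  assumes A: "ideal A R"
  shows "ideal (tight_closure R p A) R"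
proof (rule cring_idealI)
  show "tight_closure R p A \<subseteq> carrier R"
    by (auto simp: tight_closure_def)
  show "\<zero> \<in> tight_closure R p A"
    using subset_tight_closure[OF A] ideal_zero_mem[OF A] by blast
next
  have B: "ideal (bracket_power R A q) R" for q
    by (intro bracket_power_ideal ideal_subset_carrier A)
  fix x y assume "x \<in> tight_closure R p A" "y \<in> tight_closure R p A"
  then obtain c d where cd: "x \<in> carrier R" "c \<in> carrier R" "\<forall>P\<in>minimal_primes R. c \<notin> P"
     "\<forall>\<^sub>F n in sequentially. c \<otimes> x [^] (p ^ n) \<in> bracket_power R A (p ^ n)"
     "y \<in> carrier R" "d \<in> carrier R" "\<forall>P\<in>minimal_primes R. d \<notin> P"
     "\<forall>\<^sub>F n in sequentially. d \<otimes> y [^] (p ^ n) \<in> bracket_power R A (p ^ n)"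
    unfolding tight_closure_def by blast
  have "\<forall>\<^sub>F n in sequentially. (c \<otimes> d) \<otimes> (x \<oplus> y) [^] (p ^ n) \<in> bracket_power R A (p ^ n)"
    using cd(4,8)
  proof eventually_elim
    case (elim n)
    have "(c \<otimes> d) \<otimes> (x \<oplus> y) [^] (p ^ n) = d \<otimes> (c \<otimes> x [^] (p ^ n)) \<oplus> c \<otimes> (d \<otimes> y [^] (p ^ n))"
      using cd(1,2,5,6) by (simp add: frobenius_add r_distr m_assoc m_lcomm)
    also have "\<dots> \<in> bracket_power R A (p ^ n)"
      by (rule ideal_add_mem[OF B ideal_lmult_mem[OF B elim(1) cd(6)] ideal_lmult_mem[OF B elim(2) cd(2)]])
    finally show ?case .
  qed
  then show "x \<oplus> y \<in> tight_closure R p A"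
    unfolding tight_closure_def using cd minimal_primes_mult_notin[OF cd(2,6,3,7)]
    by (intro CollectI conjI bexI[of _ "c \<otimes> d"]) auto
next
  have B: "ideal (bracket_power R A q) R" for q
    by (intro bracket_power_ideal ideal_subset_carrier A)
  fix x r assume x: "x \<in> tight_closure R p A" and r: "r \<in> carrier R"
  then obtain c where c: "x \<in> carrier R" "c \<in> carrier R" "\<forall>P\<in>minimal_primes R. c \<notin> P"
     "\<forall>\<^sub>F n in sequentially. c \<otimes> x [^] (p ^ n) \<in> bracket_power R A (p ^ n)"
    unfolding tight_closure_def by blast
  have "\<forall>\<^sub>F n in sequentially. c \<otimes> (r \<otimes> x) [^] (p ^ n) \<in> bracket_power R A (p ^ n)"
    using c(4)
  proof eventually_elim
    case (elim n)
    have "c \<otimes> (r \<otimes> x) [^] (p ^ n) = r [^] (p ^ n) \<otimes> (c \<otimes> x [^] (p ^ n))"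
      using c(1,2) r by (simp add: nat_pow_distrib m_lcomm)
    also have "\<dots> \<in> bracket_power R A (p ^ n)"
      using r by (intro ideal_lmult_mem[OF B elim]) auto
    finally show ?case .
  qed
  then show "r \<otimes> x \<in> tight_closure R p A"
    unfolding tight_closure_def using c r by blast
qed

text \<open>The multiplier of \<open>x\<close> serves for its power as well: the Frobenius exponent
  is only shifted by \<open>k\<close>.\<close>

lemma pow_in_tight_closure:
  assumes A: "A \<subseteq> carrier R" and x: "x \<in> tight_closure R p A"
  shows "x [^] (p ^ k) \<in> tight_closure R p (bracket_power R A (p ^ k))"
proof -
  obtain c where c: "x \<in> carrier R" "c \<in> carrier R" "\<forall>P\<in>minimal_primes R. c \<notin> P"
     "\<forall>\<^sub>F n in sequentially. c \<otimes> x [^] (p ^ n) \<in> bracket_power R A (p ^ n)"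
    using x unfolding tight_closure_def by blast
  have "\<forall>\<^sub>F n in sequentially. c \<otimes> x [^] (p ^ (n + k)) \<in> bracket_power R A (p ^ (n + k))"
    using c(4) by (subst eventually_sequentially_seg)
  then have "\<forall>\<^sub>F n in sequentially. c \<otimes> (x [^] (p ^ k)) [^] (p ^ n) \<in> bracket_power R (bracket_power R A (p ^ k)) (p ^ n)"
    by eventually_elim (use c(1) A in \<open>simp add: nat_pow_pow power_add mult.commute bracket_power_bracket_power\<close>)
  then show ?thesis
    unfolding tight_closure_def using c by blast
qed

end

section \<open>Exponents and the existence of the limits\<close>

lemma multi_index_divide:
  assumes "\<gamma> \<in> multi_indices_deg m ((s + m) * q)" "q > 0"
  shows "\<exists>\<alpha>\<in>multi_indices_deg m s. (\<lambda>i. q * \<alpha> i) \<le> \<gamma>"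
proof -
  define \<beta> where "\<beta> = (\<lambda>i. \<gamma> i div q)"
  have "(s + m) * q = (\<Sum>i<m. \<gamma> i)"
    using assms(1) by (simp add: multi_indices_deg_def)
  \<comment> \<open>Rounding an entry down to a multiple of \<open>q\<close> loses less than
    \<open>q\<close>; the summand \<open>m\<close> in \<open>(s + m) * q\<close> pays for this in
    all \<open>m\<close> entries.\<close>
  also have "\<dots> \<le> (\<Sum>i<m. q * \<beta> i + q)"
  proof (rule sum_mono)
    fix i
    have "\<gamma> i = q * \<beta> i + \<gamma> i mod q"
      by (simp add: \<beta>_def)
    moreover have "\<gamma> i mod q < q"
      using assms(2) by simp
    ultimately show "\<gamma> i \<le> q * \<beta> i + q"
      by linarith
  qed
  also have "\<dots> = (sum \<beta> {..<m} + m) * q"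
    by (simp add: sum.distrib sum_distrib_left[symmetric] algebra_simps)
  finally have "s \<le> sum \<beta> {..<m}"
    using assms(2) by simp
  moreover have "\<beta> \<in> multi_indices_deg m (sum \<beta> {..<m})"
    using assms(1) by (simp add: multi_indices_deg_def multi_indices_def \<beta>_def)
  ultimately obtain \<alpha> where \<alpha>: "\<alpha> \<in> multi_indices_deg m s" "\<alpha> \<le> \<beta>"
    using exists_multi_index_le by blast
  have "q * \<alpha> i \<le> \<gamma> i" for i
  proof -
    have "q * \<alpha> i \<le> q * \<beta> i"
      using \<alpha>(2) by (simp add: le_fun_def)
    also have "\<dots> \<le> \<gamma> i"
      by (simp add: \<beta>_def)
    finally show ?thesis .
  qed
  with \<alpha>(1) show ?thesis
    by (auto simp: le_fun_def)
qed

text \<open>The limit is the infimum of \<open>u n + C / b ^ n\<close>: each of these values bounds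
  all later terms of \<open>u\<close> from above, while the correction tends to 0.\<close>

lemma almost_decreasing_convergent:
  fixes u :: "nat \<Rightarrow> real"
  assumes nonneg: "\<And>n. 0 \<le> u n" and b: "b > 1"
    and step: "\<And>n k. u (n + k) \<le> u n + C / b ^ n"
  shows "convergent u"
proof -
  have C: "0 \<le> C"
    using step[of 0 0] by simp
  let ?v = "\<lambda>n. u n + C / b ^ n"
  define L where "L = Inf (range ?v)"
  have bdd: "bdd_below (range ?v)"
    using nonneg C b by (intro bdd_belowI[of _ 0]) auto
  have L_le: "L \<le> ?v n" for n
    unfolding L_def using bdd by (intro cInf_lower) auto
  have tail: "(\<lambda>n. C / b ^ n) \<longlonglongrightarrow> 0"
    using tendsto_mult[OF tendsto_const[of C] LIMSEQ_inverse_realpow_zero[OF b]] by (simp add: divide_inverse)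
  have "u \<longlonglongrightarrow> L"
  proof (rule LIMSEQ_I)
    fix e :: real assume e: "0 < e"
    obtain n0 where n0: "?v n0 < L + e"
      using e cInf_lessD[of "range ?v" "L + e"] by (auto simp: L_def)
    obtain n1 where n1: "\<And>n. n \<ge> n1 \<Longrightarrow> norm (C / b ^ n - 0) < e"
      using LIMSEQ_D[OF tail e] by blast
    have "norm (u n - L) < e" if "n \<ge> max n0 n1" for n
    proof -
      have "u n < L + e"
        using step[of n0 "n - n0"] n0 that by simp
      moreover have "C / b ^ n < e"
        using n1[of n] that C b by (simp add: abs_if split: if_splits)
      then have "L - e < u n"
        using L_le[of n] by simp
      ultimately show ?thesis
        by (simp add: abs_less_iff)
    qed
    then show "\<exists>no. \<forall>n\<ge>no. norm (u n - L) < e"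
      by blast
  qed
  then show ?thesis
    by (rule convergentI)
qed

locale prime_char_ideal = noetherian_generated_ideal R g m + prime_char_cring R p
  for R (structure) and g m and p
begin

abbreviation I where "I \<equiv> Idl (g ` {..<m})"

lemma I_carrier: "I \<subseteq> carrier R"
  by (rule ideal_subset_carrier, rule genideal_ideal) auto

text \<open>On naturals \<open>Sup {}\<close> is 0, which is the value taken when \<open>V n\<close>
  is the whole ring.\<close>

definition exponent :: "(nat \<Rightarrow> 'a set) \<Rightarrow> nat \<Rightarrow> nat" where
  "exponent V n = Sup {t. \<not> pw t \<subseteq> V n}"

lemma pw_subset_of_monomial_powers:
  assumes J: "ideal J R" and "\<And>\<alpha>. \<alpha> \<in> E s \<Longrightarrow> mon \<alpha> [^] (p ^ k) \<in> J"
  shows "pw ((s + m) * p ^ k) \<subseteq> J"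
  unfolding pw_subset_iff[OF J]
proof
  fix \<gamma> assume "\<gamma> \<in> E ((s + m) * p ^ k)"
  then obtain \<alpha> where \<alpha>: "\<alpha> \<in> E s" "(\<lambda>i. p ^ k * \<alpha> i) \<le> \<gamma>"
    using multi_index_divide p_pow_pos by blast
  then show "mon \<gamma> \<in> J"
    using assms(2)[OF \<alpha>(1)] J by (simp add: mon_split[OF \<alpha>(2)] mon_pow ideal_rmult_mem)
qed

end

text \<open>Treats the Frobenius powers and their tight closures together; convergence of the
  exponents is derived from the compatibility with \<open>p ^ k\<close>-th powers.\<close>

locale exponent_family = prime_char_ideal R g m p for R (structure) and g m p +
  fixes V :: "nat \<Rightarrow> 'a set"
  assumes V_ideal: "ideal (V n) R" and V_0: "pw 1 \<subseteq> V 0"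
    and V_pow: "x \<in> V n \<Longrightarrow> x [^] (p ^ k) \<in> V (n + k)"
begin

lemma V_step: "pw s \<subseteq> V n \<Longrightarrow> pw ((s + m) * p ^ k) \<subseteq> V (n + k)"
  using mon_in_pw V_pow by (intro pw_subset_of_monomial_powers V_ideal) blast

lemma exponents_bounded: "\<exists>T. \<forall>t. \<not> pw t \<subseteq> V n \<longrightarrow> t < T"
proof -
  have "pw ((1 + m) * p ^ n) \<subseteq> V (0 + n)"
    by (rule V_step[OF V_0])
  then have "\<not> pw t \<subseteq> V n \<Longrightarrow> t < (1 + m) * p ^ n" for t
    using pw_antimono[of "(1 + m) * p ^ n" t] by (metis add_0 not_le order_trans)
  then show ?thesis
    by blast
qed

lemma finite_exponents: "finite {t. \<not> pw t \<subseteq> V n}"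
proof -
  obtain T where "\<forall>t. \<not> pw t \<subseteq> V n \<longrightarrow> t < T"
    using exponents_bounded by blast
  then have "{t. \<not> pw t \<subseteq> V n} \<subseteq> {..<T}"
    by auto
  then show ?thesis
    by (rule finite_subset) simp
qed

lemma le_exponent: "\<not> pw t \<subseteq> V n \<Longrightarrow> t \<le> exponent V n"
  using finite_exponents[of n] by (auto simp: exponent_def Sup_nat_def)

lemma pw_Suc_exponent: "pw (Suc (exponent V n)) \<subseteq> V n"
  using le_exponent[of "Suc (exponent V n)" n] by fastforce

lemma exponent_step: "exponent V (n + k) \<le> (Suc (exponent V n) + m) * p ^ k"
proof (rule ccontr)
  let ?e = "exponent V (n + k)"
  assume "\<not> ?thesis"
  then have le: "(Suc (exponent V n) + m) * p ^ k < ?e"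
    by simp
  then have "{t. \<not> pw t \<subseteq> V (n + k)} \<noteq> {}"
    unfolding exponent_def by (metis (no_types, lifting) Sup_nat_empty not_less_zero)
  then have "?e \<in> {t. \<not> pw t \<subseteq> V (n + k)}"
    unfolding exponent_def Sup_nat_def using finite_exponents[of "n + k"] Max_in by auto
  moreover have "pw ?e \<subseteq> V (n + k)"
    using V_step[OF pw_Suc_exponent, of n k] pw_antimono[OF less_imp_le[OF le]] by blast
  ultimately show False
    by blast
qed

abbreviation threshold_seq :: "nat \<Rightarrow> real" where
  "threshold_seq n \<equiv> 1 / real (p ^ n) * real (exponent V n)"

lemma threshold_seq_convergent: "convergent threshold_seq"
proof (rule almost_decreasing_convergent)
  show "real p > 1"
    using p_ge_2 by simp
  show "threshold_seq (n + k) \<le> threshold_seq n + real (Suc m) / real p ^ n" for n k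
  proof -
    have "real (exponent V (n + k)) \<le> real ((Suc (exponent V n) + m) * p ^ k)"
      using exponent_step by (simp only: of_nat_le_iff)
    then have "threshold_seq (n + k) \<le> 1 / real (p ^ (n + k)) * real ((Suc (exponent V n) + m) * p ^ k)"
      by (intro mult_left_mono) auto
    also have "\<dots> = threshold_seq n + real (Suc m) / real p ^ n"
      using p_ge_2 by (simp add: power_add field_simps)
    finally show ?thesis .
  qed
qed auto

definition threshold :: real where
  "threshold = lim threshold_seq"

lemma threshold_LIMSEQ: "threshold_seq \<longlonglongrightarrow> threshold"
  unfolding threshold_def using threshold_seq_convergent by (simp add: convergent_LIMSEQ_iff)

text \<open>The summand \<open>m\<close> is included because passing from \<open>n\<close> to
  \<open>n + k\<close> multiplies \<open>s + m\<close>, not \<open>s\<close>, by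
  \<open>p ^ k\<close>; in this form the ratio to \<open>p ^ (n + k)\<close> stays at most
  \<open>\<rho>\<close>.\<close>

lemma exists_small_exponent:
  assumes "threshold < \<rho>"
  obtains n s where "pw s \<subseteq> V n" "real (s + m) \<le> \<rho> * real (p ^ n)"
proof -
  have "(\<lambda>n. inverse (real p ^ n)) \<longlonglongrightarrow> 0"
    using p_ge_2 by (intro LIMSEQ_inverse_realpow_zero) simp
  then have "(\<lambda>n. threshold_seq n + real (Suc m) * inverse (real p ^ n)) \<longlonglongrightarrow> threshold + real (Suc m) * 0"
    by (intro tendsto_intros threshold_LIMSEQ)
  then have "\<forall>\<^sub>F n in sequentially. threshold_seq n + real (Suc m) * inverse (real p ^ n) < \<rho>"
    using assms by (intro order_tendstoD(2)[where y = "threshold + real (Suc m) * 0"]) auto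
  then obtain n where "threshold_seq n + real (Suc m) * inverse (real p ^ n) < \<rho>"
    by (auto simp: eventually_sequentially)
  then have n: "real (Suc (exponent V n) + m) * inverse (real p ^ n) < \<rho>"
    by (simp add: divide_inverse algebra_simps)
  have "real (Suc (exponent V n) + m) = real (Suc (exponent V n) + m) * inverse (real p ^ n) * real p ^ n"
    using p_ge_2 by simp
  also have "\<dots> \<le> \<rho> * real p ^ n"
    using n by (intro mult_right_mono) auto
  finally have "real (Suc (exponent V n) + m) \<le> \<rho> * real (p ^ n)"
    by simp
  with pw_Suc_exponent show thesis
    by (rule that)
qed

end

lemma Sup_nat_eq_Max: "S \<noteq> {} \<Longrightarrow> Sup S = Max (S :: nat set)"
  by (simp add: Sup_nat_def)

section \<open>The two thresholds and their lower bounds\<close>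

context prime_char_ideal
begin

definition bracket :: "nat \<Rightarrow> 'a set" where
  "bracket n = bracket_power R I (p ^ n)"

lemma bracket_ideal: "ideal (bracket n) R"
  unfolding bracket_def by (rule bracket_power_ideal[OF I_carrier])

lemma bracket_eq_generator_powers: "bracket n = generator_powers (p ^ n)"
  unfolding bracket_def generator_powers_def by (subst bracket_power_genideal) (auto simp: image_image)

lemma bracket_subset_pw: "bracket n \<subseteq> pw (p ^ n)"
  unfolding bracket_eq_generator_powers by (rule generator_powers_subset_pw)

lemma bracket_power_bracket: "bracket_power R (bracket n) (p ^ k) = bracket (n + k)"
  unfolding bracket_def bracket_power_bracket_power[OF I_carrier] by (simp add: power_add)

sublocale ord: exponent_family R g m p bracket
proof (rule exponent_family.intro[OF prime_char_ideal_axioms], rule exponent_family_axioms.intro)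
  show "ideal (bracket n) R" for n
    by (rule bracket_ideal)
  show "pw 1 \<subseteq> bracket 0"
  proof
    fix x assume "x \<in> pw 1"
    then have x: "x \<in> I" "x \<in> carrier R"
      using pw_closed by (simp_all only: pw_1[symmetric])
    then have "x [^] (1 :: nat) \<in> bracket_power R I 1"
      by (intro pow_in_bracket_power I_carrier)
    then show "x \<in> bracket 0"
      using x(2) by (simp add: bracket_def)
  qed
  show "x [^] (p ^ k) \<in> bracket (n + k)" if "x \<in> bracket n" for x n k
    using pow_in_bracket_power[OF ideal_subset_carrier[OF bracket_ideal] that, of "p ^ k"]
    by (simp only: bracket_power_bracket)
qed

sublocale tight: exponent_family R g m p "\<lambda>n. tight_closure R p (bracket n)"
proof (rule exponent_family.intro[OF prime_char_ideal_axioms], rule exponent_family_axioms.intro)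
  show "ideal (tight_closure R p (bracket n)) R" for n
    by (rule tight_closure_ideal[OF bracket_ideal])
  show "pw 1 \<subseteq> tight_closure R p (bracket 0)"
    using ord.V_0 subset_tight_closure[OF bracket_ideal] by (rule order_trans)
  show "x [^] (p ^ k) \<in> tight_closure R p (bracket (n + k))" if "x \<in> tight_closure R p (bracket n)" for x n k
    using pow_in_tight_closure[OF ideal_subset_carrier[OF bracket_ideal] that]
    by (simp only: bracket_power_bracket)
qed

lemma F_threshold_self_eq: "F_threshold_self R p I = ord.threshold"
  unfolding F_threshold_self_def ord.threshold_def exponent_def ideal_power_eq_pw bracket_def ..

text \<open>\<open>Max\<close> agrees with \<open>Sup\<close> on nonempty sets of naturals, and
  properness of the tight closures puts 0 into each set.\<close>

lemma F_threshold_tight_self_eq: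
  assumes "\<And>n. \<one> \<notin> tight_closure R p (bracket n)"
  shows "F_threshold_tight_self R p I = tight.threshold"
proof -
  have "{t. \<not> pw t \<subseteq> tight_closure R p (bracket n)} \<noteq> {}" for n
  proof -
    have "\<not> pw 0 \<subseteq> tight_closure R p (bracket n)"
      using assms[of n] by auto
    then show ?thesis
      by blast
  qed
  from Sup_nat_eq_Max[OF this] show ?thesis
    unfolding F_threshold_tight_self_def tight.threshold_def exponent_def ideal_power_eq_pw bracket_def[symmetric]
    by (simp only:)
qed

lemma tight_threshold_le: "tight.threshold \<le> ord.threshold"
proof (rule LIMSEQ_le[OF tight.threshold_LIMSEQ ord.threshold_LIMSEQ])
  have "exponent (\<lambda>n. tight_closure R p (bracket n)) n \<le> exponent bracket n" for n
  proof (cases "{t. \<not> pw t \<subseteq> tight_closure R p (bracket n)} = {}")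
    case True
    then show ?thesis
      by (simp add: exponent_def)
  next
    case False
    then have "exponent (\<lambda>n. tight_closure R p (bracket n)) n \<in> {t. \<not> pw t \<subseteq> tight_closure R p (bracket n)}"
      unfolding exponent_def Sup_nat_eq_Max[OF False] by (intro Max_in tight.finite_exponents)
    then show ?thesis
      using subset_tight_closure[OF bracket_ideal] by (intro ord.le_exponent) blast
  qed
  then show "\<exists>N. \<forall>n\<ge>N. tight.threshold_seq n \<le> ord.threshold_seq n"
    by (intro exI[of _ 0] allI impI mult_left_mono) auto
qed

lemma tight_closure_common_multiplier:
  assumes A: "ideal A R" and "finite T" "T \<subseteq> tight_closure R p A"
  shows "\<exists>c\<in>carrier R. (\<forall>P\<in>minimal_primes R. c \<notin> P) \<and>
    (\<forall>\<^sub>F n in sequentially. \<forall>x\<in>T. c \<otimes> x [^] (p ^ n) \<in> bracket_power R A (p ^ n))"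
  using assms(2,3)
proof (induction T rule: finite_induct)
  case empty
  have "\<forall>P\<in>minimal_primes R. \<one> \<notin> P"
    using minimal_primes_prime prime_one_notin by blast
  then show ?case
    by (intro bexI[of _ \<one>]) auto
next
  case (insert x T)
  have B: "ideal (bracket_power R A q) R" for q
    by (intro bracket_power_ideal ideal_subset_carrier A)
  obtain c where c: "c \<in> carrier R" "\<forall>P\<in>minimal_primes R. c \<notin> P"
    "\<forall>\<^sub>F n in sequentially. \<forall>x\<in>T. c \<otimes> x [^] (p ^ n) \<in> bracket_power R A (p ^ n)"
    using insert by auto
  obtain d where d: "x \<in> carrier R" "d \<in> carrier R" "\<forall>P\<in>minimal_primes R. d \<notin> P"
    "\<forall>\<^sub>F n in sequentially. d \<otimes> x [^] (p ^ n) \<in> bracket_power R A (p ^ n)"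
    using insert.prems unfolding tight_closure_def by blast
  have TR: "y \<in> carrier R" if "y \<in> T" for y
    using insert.prems that by (auto simp: tight_closure_def)
  have "\<forall>\<^sub>F n in sequentially. \<forall>y\<in>insert x T. (c \<otimes> d) \<otimes> y [^] (p ^ n) \<in> bracket_power R A (p ^ n)"
    using c(3) d(4)
  proof eventually_elim
    case (elim n)
    have "(c \<otimes> d) \<otimes> x [^] (p ^ n) \<in> bracket_power R A (p ^ n)"
      using ideal_lmult_mem[OF B elim(2) c(1)] c(1) d(1,2) by (simp add: m_assoc)
    moreover have "(c \<otimes> d) \<otimes> y [^] (p ^ n) \<in> bracket_power R A (p ^ n)" if "y \<in> T" for y
    proof -
      have "(c \<otimes> d) \<otimes> y [^] (p ^ n) = d \<otimes> (c \<otimes> y [^] (p ^ n))"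
        using c(1) d(2) TR[OF that] by (simp add: m_assoc m_lcomm)
      then show ?thesis
        using ideal_lmult_mem[OF B elim(1)[rule_format, OF that] d(2)] by simp
    qed
    ultimately show ?case
      by blast
  qed
  then show ?case
    using minimal_primes_mult_notin[OF c(1) d(2) c(2) d(3)] c(1) d(2) by (intro bexI[of _ "c \<otimes> d"]) auto
qed

text \<open>Tight closure is used at a single stage \<open>n0\<close>, where the finitely many
  monomials of degree \<open>s0\<close> have a common multiplier \<open>c\<close>. Raising them to
  \<open>p ^ k\<close>-th powers reaches all later stages with the same \<open>c\<close>.\<close>

lemma exists_uniform_multiplier:
  assumes "tight.threshold < \<rho>"
  obtains c N where "c \<in> carrier R" "\<forall>P\<in>minimal_primes R. c \<notin> P"
    "\<forall>n\<ge>N. \<exists>s. real s \<le> \<rho> * real (p ^ n) \<and> (\<forall>x\<in>pw s. c \<otimes> x \<in> generator_powers (p ^ n))"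
proof -
  obtain n0 s0 where n0: "pw s0 \<subseteq> tight_closure R p (bracket n0)" "real (s0 + m) \<le> \<rho> * real (p ^ n0)"
    using tight.exists_small_exponent[OF assms] by blast
  have "mon ` E s0 \<subseteq> tight_closure R p (bracket n0)"
    using n0(1) mon_in_pw by blast
  then obtain c where c: "c \<in> carrier R" "\<forall>P\<in>minimal_primes R. c \<notin> P"
    "\<forall>\<^sub>F k in sequentially. \<forall>x\<in>mon ` E s0. c \<otimes> x [^] (p ^ k) \<in> bracket_power R (bracket n0) (p ^ k)"
    using tight_closure_common_multiplier[OF bracket_ideal, of "mon ` E s0" n0] finite_multi_indices_deg by blast
  obtain N where N: "\<And>k \<alpha>. k \<ge> N \<Longrightarrow> \<alpha> \<in> E s0 \<Longrightarrow> c \<otimes> mon \<alpha> [^] (p ^ k) \<in> generator_powers (p ^ (n0 + k))"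
    using c(3) unfolding eventually_sequentially bracket_power_bracket unfolding bracket_eq_generator_powers by (metis imageI)
  have "\<exists>s. real s \<le> \<rho> * real (p ^ n) \<and> (\<forall>x\<in>pw s. c \<otimes> x \<in> generator_powers (p ^ n))" if "n \<ge> n0 + N" for n
  proof -
    define k where "k = n - n0"
    have n: "n = n0 + k" and k: "k \<ge> N"
      using that by (auto simp: k_def)
    have "pw ((s0 + m) * p ^ k) \<subseteq> colon R (generator_powers (p ^ n)) c"
      using N[OF k] c(1) by (intro pw_subset_of_monomial_powers colon_ideal generator_powers_ideal) (auto simp: colon_def n)
    then have "\<forall>x\<in>pw ((s0 + m) * p ^ k). c \<otimes> x \<in> generator_powers (p ^ n)"
      by (auto simp: colon_def)
    moreover have "real ((s0 + m) * p ^ k) \<le> \<rho> * real (p ^ n)"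
      using mult_right_mono[OF n0(2), of "real (p ^ k)"] by (simp add: n power_add mult.assoc)
    ultimately show ?thesis
      by blast
  qed
  then have "\<forall>n\<ge>n0 + N. \<exists>s. real s \<le> \<rho> * real (p ^ n) \<and> (\<forall>x\<in>pw s. c \<otimes> x \<in> generator_powers (p ^ n))"
    by blast
  with c(1,2) show thesis
    by (rule that)
qed

lemma exists_pow_ge: "\<exists>n. k \<le> p ^ n"
proof -
  have "k < 2 ^ k"
    by simp
  also have "2 ^ k \<le> p ^ k"
    using p_ge_2 by (intro power_mono) auto
  finally show ?thesis
    by (intro exI[of _ k]) simp
qed

lemma p_pow_mono: "a \<le> b \<Longrightarrow> p ^ a \<le> p ^ b"
  using p_ge_2 by (intro power_increasing) auto

text \<open>Otherwise a multiplier \<open>c\<close> outside \<open>p0\<close> would lie in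
  arbitrarily high powers of the ideal, against Krull's theorem modulo \<open>p0\<close>.\<close>

lemma one_notin_tight_closure:
  assumes P: "primeideal P R" "pw 1 \<subseteq> P" and p0: "p0 \<in> minimal_primes R" "p0 \<subseteq> P"
  shows "\<one> \<notin> tight_closure R p (bracket n)"
proof
  assume "\<one> \<in> tight_closure R p (bracket n)"
  then obtain c where c: "c \<in> carrier R" "c \<notin> p0"
    "\<forall>\<^sub>F k in sequentially. c \<otimes> \<one> [^] (p ^ k) \<in> bracket_power R (bracket n) (p ^ k)"
    using p0(1) unfolding tight_closure_def by blast
  have prime: "primeideal p0 R"
    using p0(1) by (rule minimal_primes_prime)
  then have idl: "ideal p0 R"
    by (rule primeideal.axioms)
  obtain l where l: "\<And>s. s \<in> carrier R - P \<Longrightarrow> s \<otimes> c \<notin> pw l <+> p0"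
    using krull_separated[OF prime P(1) p0(2) P(2) c(1,2)] by blast
  obtain N where N: "\<And>k. k \<ge> N \<Longrightarrow> c \<in> bracket (n + k)"
    using c(1,3) unfolding eventually_sequentially bracket_power_bracket by auto
  obtain j where j: "l \<le> p ^ j"
    using exists_pow_ge by blast
  have "p ^ j \<le> p ^ (n + max N j)"
    by (intro p_pow_mono) auto
  then have "pw (p ^ (n + max N j)) \<subseteq> pw l"
    using j by (intro pw_antimono) simp
  then have "c \<in> pw l"
    using N[of "max N j"] bracket_subset_pw by fastforce
  then have "c \<in> pw l <+> p0"
    using set_add_left[OF pw_ideal idl] by blast
  then show False
    using l[of \<one>] prime_one_notin[OF P(1)] c(1) by simp
qed

text \<open>A monomial of degree \<open>s + k\<close> has a factor of degree \<open>s\<close>, to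
  which the hypothesis applies, so the degree can be raised indefinitely.\<close>

lemma pw_stable_absorb:
  assumes Q: "ideal Q R" and s: "pw s \<subseteq> pw (Suc s) <+> Q"
  shows "pw s \<subseteq> pw (s + k) <+> Q"
proof (induction k)
  case 0
  then show ?case
    using set_add_left[OF pw_ideal Q] by simp
next
  case (Suc k)
  have idl: "ideal (pw n <+> Q) R" for n
    by (intro add_ideals pw_ideal Q)
  have "mon \<gamma> \<in> pw (s + Suc k) <+> Q" if \<gamma>: "\<gamma> \<in> E (s + k)" for \<gamma>
  proof -
    obtain \<alpha> where \<alpha>: "\<alpha> \<in> E s" "\<alpha> \<le> \<gamma>"
      using exists_multi_index_le[OF \<gamma>, of s] by auto
    then have \<beta>: "mon (\<gamma> - \<alpha>) \<in> pw k"
      using multi_indices_deg_diff[OF \<gamma> \<alpha>] by (intro mon_in_pw) simp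
    have "mon \<alpha> \<in> pw (Suc s) <+> Q"
      using s mon_in_pw[OF \<alpha>(1)] by blast
    then obtain a w where aw: "a \<in> pw (Suc s)" "w \<in> Q" "mon \<alpha> = a \<oplus> w"
      by (rule set_add_memE)
    have "mon \<gamma> = a \<otimes> mon (\<gamma> - \<alpha>) \<oplus> w \<otimes> mon (\<gamma> - \<alpha>)"
      unfolding mon_split[OF \<alpha>(2)] aw(3) using aw pw_closed ideal.Icarr[OF Q] by (simp add: l_distr)
    moreover have "a \<otimes> mon (\<gamma> - \<alpha>) \<in> pw (s + Suc k)"
      using pw_mult[OF aw(1) \<beta>] by simp
    moreover have "w \<otimes> mon (\<gamma> - \<alpha>) \<in> Q"
      by (intro ideal_rmult_mem[OF Q aw(2)] mon_closed)
    ultimately show ?thesis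
      by (intro set_add_memI)
  qed
  then have "pw (s + k) \<subseteq> pw (s + Suc k) <+> Q"
    by (simp add: pw_subset_iff[OF idl])
  then have "pw (s + k) <+> Q \<subseteq> pw (s + Suc k) <+> Q"
    by (intro set_add_least idl set_add_right pw_ideal Q)
  with Suc show ?case
    by blast
qed

lemma tight_threshold_ge_1:
  assumes P: "primeideal P R" "pw 1 \<subseteq> P" and p0: "p0 \<in> minimal_primes R" "p0 \<subseteq> P" "\<not> pw 1 \<subseteq> p0"
  shows "1 \<le> tight.threshold"
proof (rule ccontr)
  assume "\<not> ?thesis"
  then obtain \<rho> where \<rho>: "tight.threshold < \<rho>" "\<rho> < 1"
    using dense by (metis not_le)
  obtain c N where c: "c \<in> carrier R" "\<forall>P\<in>minimal_primes R. c \<notin> P"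
    "\<forall>n\<ge>N. \<exists>s. real s \<le> \<rho> * real (p ^ n) \<and> (\<forall>x\<in>pw s. c \<otimes> x \<in> generator_powers (p ^ n))"
    using \<rho>(1) by (rule exists_uniform_multiplier)
  have prime: "primeideal p0 R"
    using p0(1) by (rule minimal_primes_prime)
  then have idl: "ideal p0 R"
    by (rule primeideal.axioms)
  obtain h where h: "\<And>n y. y \<in> carrier R \<Longrightarrow> c \<otimes> y \<in> pw n <+> p0 \<Longrightarrow> y \<in> pw (n - h) <+> p0"
    using colon_pw_prime[OF prime c(1) c(2)[rule_format, OF p0(1)]] by blast
  \<comment> \<open>Chosen so that for \<open>p ^ n \<ge> k\<close> the gap between
    \<open>\<rho> * p ^ n\<close> and \<open>p ^ n\<close> has room for the Artin-Rees shift
    \<open>h\<close> and one further degree.\<close>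
  obtain k where k: "real (h + 1) / (1 - \<rho>) \<le> real k"
    using real_arch_simple by blast
  obtain j where j: "k \<le> p ^ j"
    using exists_pow_ge by blast
  define n where "n = max N j"
  have "p ^ j \<le> p ^ n"
    by (intro p_pow_mono) (simp add: n_def)
  then have "real (h + 1) / (1 - \<rho>) \<le> real (p ^ n)"
    using k j by (meson le_trans of_nat_le_iff order_trans)
  then have large: "real (h + 1) \<le> (1 - \<rho>) * real (p ^ n)"
    using \<rho>(2) by (simp add: pos_divide_le_eq mult.commute)
  obtain s where s: "real s \<le> \<rho> * real (p ^ n)" "\<forall>x\<in>pw s. c \<otimes> x \<in> generator_powers (p ^ n)"
    using c(3)[rule_format, of n] by (auto simp: n_def)
  have "real (s + h + 1) \<le> real (p ^ n)"
    using s(1) large by (simp add: algebra_simps)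
  then have le: "Suc s \<le> p ^ n - h"
    by linarith
  have "pw s \<subseteq> pw (Suc s) <+> p0"
  proof
    fix y assume y: "y \<in> pw s"
    then have "c \<otimes> y \<in> pw (p ^ n) <+> p0"
      using s(2) generator_powers_subset_pw set_add_left[OF pw_ideal idl] by blast
    then have "y \<in> pw (p ^ n - h) <+> p0"
      using y pw_closed by (intro h)
    then show "y \<in> pw (Suc s) <+> p0"
      using set_add_mono[OF pw_antimono[OF le] subset_refl] by blast
  qed
  then have absorb: "pw s \<subseteq> pw (s + k) <+> p0" for k
    by (rule pw_stable_absorb[OF idl])
  \<comment> \<open>Krull's theorem is contradicted by \<open>z [^] s\<close>, which lies outside
    \<open>p0\<close> but would lie in \<open>pw (s + l) <+> p0\<close> for every
    \<open>l\<close>.\<close>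
  obtain z where z: "z \<in> pw 1" "z \<notin> p0"
    using p0(3) by blast
  have zR: "z \<in> carrier R"
    using z(1) by (rule pw_closed)
  have zk: "z [^] k \<in> pw k \<and> z [^] k \<notin> p0" for k :: nat
    using pow_in_pw_notin_prime[OF prime z] by blast
  obtain l where l: "\<And>t. t \<in> carrier R - P \<Longrightarrow> t \<otimes> z [^] s \<notin> pw l <+> p0"
    using krull_separated[OF prime P(1) p0(2) P(2), of "z [^] s"] zk[of s] zR by blast
  have "z [^] s \<in> pw (s + l) <+> p0"
    using absorb zk by blast
  then have "z [^] s \<in> pw l <+> p0"
    using set_add_mono[OF pw_antimono[of l "s + l"] subset_refl] by auto
  then show False
    using l[of \<one>] prime_one_notin[OF P(1)] zR by simp
qed

lemma tight_threshold_gt_1: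
  assumes P: "primeideal P R" "pw 1 \<subseteq> P"
    and minimal: "\<And>Q. primeideal Q R \<Longrightarrow> pw 1 \<subseteq> Q \<Longrightarrow> Q \<subseteq> P \<Longrightarrow> Q = P"
    and p0_min: "p0 \<in> minimal_primes R" and Q: "primeideal Q R" "p0 \<subset> Q" "Q \<subset> P"
  shows "1 < tight.threshold"
proof (rule ccontr)
  assume "\<not> ?thesis"
  then have le: "tight.threshold \<le> 1"
    by simp
  interpret ideal_prime_pair R g m P p0
  proof (intro ideal_prime_pair.intro ideal_prime_pair_axioms.intro noetherian_prime_pair.intro
      prime_pair.intro prime_pair_axioms.intro noetherian_generated_ideal_axioms noetherian_ring_axioms cring_axioms)
    show "primeideal p0 R"
      using p0_min by (rule minimal_primes_prime)
    show "p0 \<subseteq> P"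
      using Q by blast
  qed (fact P minimal)+
  show False
  proof (rule no_asymptotic_containment[OF Q])
    fix M0 :: nat
    obtain k where k: "M0 \<le> p ^ k"
      using exists_pow_ge by blast
    \<comment> \<open>A power of \<open>p\<close>, so that \<open>M * n\<close> is one whenever
      \<open>n\<close> is.\<close>
    define M where "M = p ^ k"
    have M: "M > 0"
      unfolding M_def by (rule p_pow_pos)
    \<comment> \<open>Relative to \<open>M * n\<close>, the excess \<open>1 / (4 * M)\<close>
      amounts to \<open>n / 4\<close>.\<close>
    have "tight.threshold < 1 + 1 / (4 * real M)"
      using le M by (simp add: le_less_trans)
    then obtain c N where c: "c \<in> carrier R" "\<forall>P\<in>minimal_primes R. c \<notin> P"
      "\<forall>n\<ge>N. \<exists>s. real s \<le> (1 + 1 / (4 * real M)) * real (p ^ n) \<and> (\<forall>x\<in>pw s. c \<otimes> x \<in> generator_powers (p ^ n))"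
      by (rule exists_uniform_multiplier)
    have "\<exists>n\<ge>N'. \<exists>s\<le>M * n + n div 2. \<forall>x\<in>pw s. c \<otimes> x \<in> generator_powers (M * n)" for N'
    proof -
      \<comment> \<open>The summand 2 ensures \<open>n \<ge> 2\<close>, from where on
        \<open>n div 2\<close> is at least \<open>n / 4\<close>.\<close>
      obtain j where j: "N' + 2 \<le> p ^ j"
        using exists_pow_ge by blast
      define i where "i = max N j"
      define n where "n = p ^ i"
      have "p ^ j \<le> n"
        unfolding n_def by (intro p_pow_mono) (simp add: i_def)
      then have n: "N' + 2 \<le> n"
        using j by simp
      have Mn: "p ^ (k + i) = M * n"
        by (simp add: M_def n_def power_add)
      have "N \<le> k + i"
        by (simp add: i_def)
      from c(3)[rule_format, OF this] obtain s where
        s: "real s \<le> (1 + 1 / (4 * real M)) * real (M * n)" "\<forall>x\<in>pw s. c \<otimes> x \<in> generator_powers (M * n)"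
        unfolding Mn by blast
      have "(1 + 1 / (4 * real M)) * real (M * n) = real (M * n) + real n / 4"
        using M by (simp add: field_simps)
      then have "4 * real s \<le> 4 * real (M * n) + real n"
        using s(1) by simp
      then have "real (4 * s) \<le> real (4 * (M * n) + n)"
        by simp
      then have "4 * s \<le> 4 * (M * n) + n"
        by (simp only: of_nat_le_iff)
      then have "s \<le> M * n + n div 2"
        using n by linarith
      with s(2) n show ?thesis
        by (intro exI[of _ n]) auto
    qed
    with k c(1) c(2)[rule_format, OF p0_min] show "\<exists>M\<ge>M0. \<exists>c\<in>carrier R. c \<notin> p0 \<and>
       (\<forall>N. \<exists>n\<ge>N. \<exists>s\<le>M * n + n div 2. \<forall>x\<in>pw s. c \<otimes> x \<in> generator_powers (M * n))"
      unfolding M_def by blast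
  qed
qed

end

section \<open>Chains of primes and the conclusion\<close>

lemma prime_height_geE:
  assumes "enat k \<le> prime_height R P" "k > 0"
  obtains Q where "\<And>i. i \<le> k \<Longrightarrow> primeideal (Q i) R" "\<And>i. i < k \<Longrightarrow> Q i \<subset> Q (Suc i)" "Q k = P"
proof -
  have "enat (k - 1) < prime_height R P"
    using assms by (metis Suc_ile_eq Suc_pred')
  then obtain n where "enat (k - 1) < enat n"
    and "\<exists>Q. (\<forall>i\<le>n. primeideal (Q i) R) \<and> (\<forall>i<n. Q i \<subset> Q (Suc i)) \<and> Q n = P"
    unfolding prime_height_def less_Sup_iff by blast
  then obtain Q where Q: "k \<le> n" "\<forall>i\<le>n. primeideal (Q i) R" "\<forall>i<n. Q i \<subset> Q (Suc i)" "Q n = P"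
    using assms(2) by fastforce
  \<comment> \<open>Only the top \<open>k\<close> inclusions of a possibly longer chain are kept, so
    that it still ends in \<open>P\<close>.\<close>
  show thesis
    by (rule that[of "\<lambda>i. Q (i + (n - k))"]) (use Q in auto)
qed

text \<open>The padding with \<open>z\<close> keeps all values in \<open>C\<close>, as
  \<open>g_closed\<close> demands for every index and not only below \<open>m\<close>.\<close>

lemma finite_set_as_sequence:
  assumes "finite A" "A \<subseteq> C" "z \<in> C"
  obtains g and m :: nat where "A = g ` {..<m}" "\<And>i. g i \<in> C"
proof -
  obtain m and f :: "nat \<Rightarrow> 'a" where f: "A = f ` {i. i < m}"
    using finite_imp_nat_seg_image_inj_on[OF assms(1)] by blast
  show thesis
  proof (rule that[of "\<lambda>i. if i < m then f i else z" m])
    show "A = (\<lambda>i. if i < m then f i else z) ` {..<m}"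
      using f by auto
    show "(if i < m then f i else z) \<in> C" for i
      using f assms(2,3) by auto
  qed
qed

theorem corollary8p6:
  fixes R :: "('a, 'b) ring_scheme" and I :: "'a set" and p :: nat
  assumes "cring R" and "noetherian_ring R"
    and "Factorial_Ring.prime p" and "ring_char R = p"
    and "F_finite R p"
    and "ideal I R"
  shows "((\<exists>P\<in>minimal_primes_over R I. prime_height R P \<ge> 1) \<longrightarrow>
            1 \<le> F_threshold_tight_self R p I \<and>
            F_threshold_tight_self R p I \<le> F_threshold_self R p I)
       \<and> ((\<exists>P\<in>minimal_primes_over R I. prime_height R P \<ge> 2) \<longrightarrow>
            1 < F_threshold_tight_self R p I \<and>
            F_threshold_tight_self R p I \<le> F_threshold_self R p I)"
proof -
  interpret cring R by (rule assms(1))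
  interpret noetherian_ring R by (rule assms(2))
  obtain A where A: "A \<subseteq> carrier R" "finite A" "I = Idl\<^bsub>R\<^esub> A"
    using finetely_gen[OF assms(6)] by blast
  obtain g and m :: nat where g: "A = g ` {..<m}" "\<And>i. g i \<in> carrier R"
    using finite_set_as_sequence[OF A(2,1) zero_closed] by blast
  interpret prime_char_ideal R g m p
    by unfold_locales (use g(2) assms(3,4) in auto)
  have I: "Idl\<^bsub>R\<^esub> (g ` {..<m}) = I"
    by (simp only: A(3) g(1))
  have pw1: "pw 1 = I"
    by (simp only: pw_1 I)
  \<comment> \<open>A prime over \<open>I\<close> makes the tight closures proper, so that every
    \<open>Max\<close> in the definition is taken over a nonempty set.\<close>
  have common: "F_threshold_tight_self R p I = tight.threshold \<and> tight.threshold \<le> F_threshold_self R p I"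
    if P: "P \<in> minimal_primes_over R I" for P
  proof -
    have P': "primeideal P R" "I \<subseteq> P"
      using P by (auto simp: minimal_primes_over_def)
    obtain p0 where p0: "p0 \<in> minimal_primes R" "p0 \<subseteq> P"
      using exists_minimal_prime_below[OF P'(1)] .
    have "\<one>\<^bsub>R\<^esub> \<notin> tight_closure R p (bracket n)" for n
      using P'(2) by (intro one_notin_tight_closure[OF P'(1) _ p0]) (simp only: pw1)
    from F_threshold_tight_self_eq[OF this] have "F_threshold_tight_self R p I = tight.threshold"
      by (simp only: I)
    then show ?thesis
      using tight_threshold_le F_threshold_self_eq by (simp only: I)
  qed
  have "1 \<le> tight.threshold" if P: "P \<in> minimal_primes_over R I" "prime_height R P \<ge> 1" for P
  proof -
    have P': "primeideal P R" "I \<subseteq> P" "\<And>Q. primeideal Q R \<Longrightarrow> I \<subseteq> Q \<Longrightarrow> Q \<subseteq> P \<Longrightarrow> Q = P"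
      using P by (auto simp: minimal_primes_over_def)
    have "enat 1 \<le> prime_height R P"
      using P(2) by (simp add: one_enat_def)
    then obtain Q where "\<And>i. i \<le> 1 \<Longrightarrow> primeideal (Q i) R" "\<And>i. i < 1 \<Longrightarrow> Q i \<subset> Q (Suc i)" "Q 1 = P"
      by (rule prime_height_geE) auto
    from this(1)[of 0] this(2)[of 0] this(3) have Q: "primeideal (Q 0) R" "Q 0 \<subset> P"
      by auto
    obtain p0 where p0: "p0 \<in> minimal_primes R" "p0 \<subseteq> Q 0"
      using exists_minimal_prime_below[OF Q(1)] .
    \<comment> \<open>Otherwise minimality of \<open>P\<close> over \<open>I\<close> would give
      \<open>p0 = P\<close>, although \<open>p0 \<subseteq> Q 0 \<subset> P\<close>.\<close>
    have "\<not> I \<subseteq> p0"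
      using P'(3)[OF minimal_primes_prime[OF p0(1)]] p0(2) Q(2) by blast
    then show ?thesis
      using tight_threshold_ge_1[OF P'(1) _ p0(1)] P'(2) p0(2) Q(2) unfolding pw1 by blast
  qed
  moreover have "1 < tight.threshold" if P: "P \<in> minimal_primes_over R I" "prime_height R P \<ge> 2" for P
  proof -
    have P': "primeideal P R" "I \<subseteq> P" "\<And>Q. primeideal Q R \<Longrightarrow> I \<subseteq> Q \<Longrightarrow> Q \<subseteq> P \<Longrightarrow> Q = P"
      using P by (auto simp: minimal_primes_over_def)
    have "enat 2 \<le> prime_height R P"
      using P(2) by (simp add: numeral_eq_enat)
    then obtain Q where Q: "\<And>i. i \<le> 2 \<Longrightarrow> primeideal (Q i) R" "\<And>i. i < 2 \<Longrightarrow> Q i \<subset> Q (Suc i)" "Q 2 = P"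
      using prime_height_geE[of 2 R P] by auto
    have Q01: "primeideal (Q 0) R" "primeideal (Q 1) R" "Q 0 \<subset> Q 1" "Q 1 \<subset> P"
      using Q(1)[of 0] Q(1)[of 1] Q(2)[of 0] Q(2)[of 1] Q(3) by (auto simp: numeral_2_eq_2)
    obtain p0 where p0: "p0 \<in> minimal_primes R" "p0 \<subseteq> Q 0"
      using exists_minimal_prime_below[OF Q01(1)] .
    \<comment> \<open>The bottom of the chain is replaced by a minimal prime because multipliers are
      only known to avoid minimal primes.\<close>
    have "p0 \<subset> Q 1"
      using p0(2) Q01(3) by blast
    then show ?thesis
      using tight_threshold_gt_1[OF P'(1) _ _ p0(1) Q01(2) _ Q01(4)] P'(2,3) unfolding pw1 by blast
  qed
  ultimately show ?thesis
    using common by auto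
qed

end
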